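(* Let $\mathcal{E}$ be an election system and let $\delta>0$. The special case of Swap Bribery for $\mathcal{E}$ in which all swap costs are in $\{0,\delta\}$ and the budget is $\beta=0$ is equivalent to the Possible Winner problem for $\mathcal{E}$; that is, each of the two decision problems is polynomial-time many-one reducible to the other.
   Context: Elections. An election consists of a set $C=\{c_1,\dots,c_m\}$ of candidates and votes $V=\{v_1,\dots,v_n\}$; each vote is a strict linear order over $C$ (several voters may have the same order), and $\mathrm{rank}(c,v)$ is the position of $c$ in $v$. An election system $\mathcal{E}$ maps each pair $(C,V)$ to a set $W\subseteq C$ of winners. Swaps. A swap in a vote $v$ is a triple $(v,a,b)$ with $a,b\in C$, $a\ne b$. It is admissible in $v$ if $\mathrm{rank}(a,v)=\mathrm{rank}(b,v)-1$; applying it exchanges the positions of $a$ and $b$ in $v$. A set $\Gamma$ of swaps is admissible in $v$ if its elements can be applied to $v$ one after the other in some order, each being admissible in the vote obtained so far; the resulting vote is $v^{\Gamma}$. This extends vote by vote to several votes, the resulting votes being denoted $V^{\Gamma}$. Swap Bribery for $\mathcal{E}$: given an $\mathcal{E}$-election $(C,V)$, a preferred candidate $p\in C$, a cost function $c$ assigning to each possible swap in each vote a non-negative cost, and a budget $\beta$, decide whether there is an admissible set $\Gamma$ of swaps of total cost at most $\beta$ such that $p$ is a winner in the $\mathcal{E}$-election $(C,V^{\Gamma})$. Possible Winner for $\mathcal{E}$: given a set $C$ of candidates, partial votes $V'=(v'_1,\dots,v'_n)$ (strict partial orders over $C$), and a preferred candidate $p\in C$, decide whether there are linear orders $V=(v_1,\dots,v_n)$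 such that each $v_i$ extends $v'_i$ and $p$ is a winner in the $\mathcal{E}$-election $(C,V)$. *)

theory Defs
  imports Complex_Main "HOL-Combinatorics.Transposition" "HOL-Computational_Algebra.Polynomial"
begin

section \<open>Elections\<close>

text \<open>
  A strict linear order over a finite set is represented by the list of its elements, most
  preferred first; a profile is the list of the votes of voters \<open>0, 1, \<dots>\<close>.
\<close>

type_synonym 'a vote = "'a list"

type_synonym 'a election_system = "'a set \<Rightarrow> 'a vote list \<Rightarrow> 'a set"

definition is_vote :: "'a set \<Rightarrow> 'a vote \<Rightarrow> bool" where
  "is_vote C v \<longleftrightarrow> distinct v \<and> set v = C"

definition is_election :: "'a set \<Rightarrow> 'a vote list \<Rightarrow> bool" where
  "is_election C V \<longleftrightarrow> finite C \<and> (\<forall>v\<in>set V. is_vote C v)"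

definition is_election_system :: "'a election_system \<Rightarrow> bool" where
  "is_election_system \<E> \<longleftrightarrow> (\<forall>C V. is_election C V \<longrightarrow> \<E> C V \<subseteq> C)"

text \<open>The best candidate has rank 1.\<close>

definition rank :: "'a \<Rightarrow> 'a vote \<Rightarrow> nat" where
  "rank c v = length (takeWhile (\<lambda>x. x \<noteq> c) v) + 1"

definition order_of_vote :: "'a vote \<Rightarrow> 'a rel" where
  "order_of_vote v = {(a, b). a \<in> set v \<and> b \<in> set v \<and> rank a v < rank b v}"


section \<open>Swap Bribery\<close>

definition swap_admissible :: "'a \<times> 'a \<Rightarrow> 'a vote \<Rightarrow> bool" where
  "swap_admissible s v \<longleftrightarrow> (case s of (a, b) \<Rightarrow>
     a \<in> set v \<and> b \<in> set v \<and> a \<noteq> b \<and> rank b v = rank a v + 1)"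

definition apply_swap :: "'a \<times> 'a \<Rightarrow> 'a vote \<Rightarrow> 'a vote" where
  "apply_swap s v = (case s of (a, b) \<Rightarrow> map (Transposition.transpose a b) v)"

fun swaps_admissible :: "('a \<times> 'a) list \<Rightarrow> 'a vote \<Rightarrow> bool" where
  "swaps_admissible [] v \<longleftrightarrow> True"
| "swaps_admissible (s # ss) v \<longleftrightarrow> swap_admissible s v \<and> swaps_admissible ss (apply_swap s v)"

text \<open>
  \<open>swap_result v \<Gamma> w\<close> says that \<open>\<Gamma>\<close> is admissible in \<open>v\<close> with \<open>v\<^sup>\<Gamma> = w\<close>. Each ordered pair is
  swapped at most once, so the swaps of a fixed pair of candidates must alternate; hence \<open>w\<close> does
  not depend on the order in which the elements of \<open>\<Gamma>\<close> are applied.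
\<close>

definition swap_result :: "'a vote \<Rightarrow> ('a \<times> 'a) set \<Rightarrow> 'a vote \<Rightarrow> bool" where
  "swap_result v \<Gamma> w \<longleftrightarrow>
     (\<exists>ss. distinct ss \<and> set ss = \<Gamma> \<and> swaps_admissible ss v \<and> w = fold apply_swap ss v)"

text \<open>
  Different voters may cast the same vote, so in a profile a swap \<open>(i, a, b)\<close> refers to the voter
  \<open>i\<close>.
\<close>

definition profile_swap_result ::
    "'a vote list \<Rightarrow> (nat \<times> 'a \<times> 'a) set \<Rightarrow> 'a vote list \<Rightarrow> bool" where
  "profile_swap_result V \<Gamma> W \<longleftrightarrow>
     length W = length V \<and> fst ` \<Gamma> \<subseteq> {..<length V} \<and>
     (\<forall>i<length V. swap_result (V ! i) {(a, b). (i, a, b) \<in> \<Gamma>} (W ! i))"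

record 'a swap_bribery =
  sb_candidates :: "'a set"
  sb_votes :: "'a vote list"
  sb_preferred :: 'a
  sb_cost :: "nat \<Rightarrow> 'a \<Rightarrow> 'a \<Rightarrow> real"
  sb_budget :: real

definition is_sb_swap :: "'a swap_bribery \<Rightarrow> nat \<times> 'a \<times> 'a \<Rightarrow> bool" where
  "is_sb_swap I s \<longleftrightarrow> (case s of (i, a, b) \<Rightarrow>
     i < length (sb_votes I) \<and> a \<in> sb_candidates I \<and> b \<in> sb_candidates I \<and> a \<noteq> b)"

definition is_sb_instance :: "'a swap_bribery \<Rightarrow> bool" where
  "is_sb_instance I \<longleftrightarrow>
     is_election (sb_candidates I) (sb_votes I) \<and>
     sb_preferred I \<in> sb_candidates I \<and>
     (\<forall>i a b. is_sb_swap I (i, a, b) \<longrightarrow> sb_cost I i a b \<ge> 0)"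

definition sb_solvable :: "'a election_system \<Rightarrow> 'a swap_bribery \<Rightarrow> bool" where
  "sb_solvable \<E> I \<longleftrightarrow>
     (\<exists>\<Gamma> W. profile_swap_result (sb_votes I) \<Gamma> W \<and>
        (\<Sum>(i, a, b)\<in>\<Gamma>. sb_cost I i a b) \<le> sb_budget I \<and>
        sb_preferred I \<in> \<E> (sb_candidates I) W)"

definition is_zero_budget_instance :: "real \<Rightarrow> 'a swap_bribery \<Rightarrow> bool" where
  "is_zero_budget_instance \<delta> I \<longleftrightarrow>
     is_sb_instance I \<and>
     (\<forall>i a b. is_sb_swap I (i, a, b) \<longrightarrow> sb_cost I i a b \<in> {0, \<delta>}) \<and>
     sb_budget I = 0"


section \<open>Possible Winner\<close>

record 'a possible_winner =
  pw_candidates :: "'a set"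
  pw_votes :: "'a rel list"
  pw_preferred :: 'a

definition is_partial_vote :: "'a set \<Rightarrow> 'a rel \<Rightarrow> bool" where
  "is_partial_vote C r \<longleftrightarrow> r \<subseteq> C \<times> C \<and> irrefl r \<and> trans r"

definition is_pw_instance :: "'a possible_winner \<Rightarrow> bool" where
  "is_pw_instance I \<longleftrightarrow>
     finite (pw_candidates I) \<and>
     (\<forall>r\<in>set (pw_votes I). is_partial_vote (pw_candidates I) r) \<and>
     pw_preferred I \<in> pw_candidates I"

definition pw_solvable :: "'a election_system \<Rightarrow> 'a possible_winner \<Rightarrow> bool" where
  "pw_solvable \<E> I \<longleftrightarrow>
     (\<exists>V. length V = length (pw_votes I) \<and>
        (\<forall>i<length V. is_vote (pw_candidates I) (V ! i) \<and>
                      pw_votes I ! i \<subseteq> order_of_vote (V ! i)) \<and>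
        pw_preferred I \<in> \<E> (pw_candidates I) V)"


section \<open>Polynomial-time computable functions\<close>

text \<open>
  Words over a fixed four-letter alphabet are the inputs and outputs of deterministic multi-tape
  Turing machines. Tape symbols are natural numbers, 0 being the blank; every tape is infinite to
  the right, and a head moving left from cell 0 stays there.
\<close>

datatype letter = Bit0 | Bit1 | Comma | Semicolon

type_synonym word = "letter list"

fun letter_symbol :: "letter \<Rightarrow> nat" where
  "letter_symbol Bit0 = 1"
| "letter_symbol Bit1 = 2"
| "letter_symbol Comma = 3"
| "letter_symbol Semicolon = 4"

datatype move = Move_Left | Stay | Move_Right

type_synonym tape = "(nat \<Rightarrow> nat) \<times> nat"

type_synonym config = "nat \<times> tape list"

record tm =
  tm_tapes :: nat
  tm_states :: "nat set"
  tm_symbols :: "nat set"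
  tm_start :: nat
  tm_halt :: nat
  tm_delta :: "nat \<Rightarrow> nat list \<Rightarrow> nat \<times> (nat \<times> move) list"

definition is_tm :: "tm \<Rightarrow> bool" where
  "is_tm M \<longleftrightarrow>
     tm_tapes M \<ge> 2 \<and>
     finite (tm_states M) \<and> tm_start M \<in> tm_states M \<and> tm_halt M \<in> tm_states M \<and>
     finite (tm_symbols M) \<and> 0 \<in> tm_symbols M \<and> range letter_symbol \<subseteq> tm_symbols M \<and>
     (\<forall>q\<in>tm_states M. \<forall>xs. length xs = tm_tapes M \<and> set xs \<subseteq> tm_symbols M \<longrightarrow>
        fst (tm_delta M q xs) \<in> tm_states M \<and>
        length (snd (tm_delta M q xs)) = tm_tapes M \<and>
        fst ` set (snd (tm_delta M q xs)) \<subseteq> tm_symbols M)"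

definition tape_read :: "tape \<Rightarrow> nat" where
  "tape_read tp = fst tp (snd tp)"

fun tape_act :: "nat \<times> move \<Rightarrow> tape \<Rightarrow> tape" where
  "tape_act (x, d) (t, h) =
     (t(h := x), case d of Move_Left \<Rightarrow> h - 1 | Stay \<Rightarrow> h | Move_Right \<Rightarrow> h + 1)"

fun tm_step :: "tm \<Rightarrow> config \<Rightarrow> config" where
  "tm_step M (q, ts) =
     (if q = tm_halt M then (q, ts)
      else case tm_delta M q (map tape_read ts) of (q', as) \<Rightarrow> (q', map2 tape_act as ts))"

definition word_on_tape :: "word \<Rightarrow> nat \<Rightarrow> nat" where
  "word_on_tape w i = (if i < length w then letter_symbol (w ! i) else 0)"

text \<open>Tape 0 initially holds the input, and tape 1 holds the output on halting.\<close>

definition tm_init :: "tm \<Rightarrow> word \<Rightarrow> config" where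
  "tm_init M w =
     (tm_start M, (word_on_tape w, 0) # replicate (tm_tapes M - 1) (word_on_tape [], 0))"

definition tm_computes_within :: "tm \<Rightarrow> word \<Rightarrow> nat \<Rightarrow> word \<Rightarrow> bool" where
  "tm_computes_within M w t u \<longleftrightarrow>
     (case (tm_step M ^^ t) (tm_init M w) of (q, ts) \<Rightarrow>
        q = tm_halt M \<and> fst (ts ! 1) = word_on_tape u)"

definition polytime_on :: "word set \<Rightarrow> (word \<Rightarrow> word) \<Rightarrow> bool" where
  "polytime_on D f \<longleftrightarrow>
     (\<exists>M (P :: nat poly). is_tm M \<and>
        (\<forall>w\<in>D. tm_computes_within M w (poly P (length w)) (f w)))"


section \<open>Decision problems and reductions\<close>

record 'i decision_problem =
  instances :: "'i set"
  yes_instances :: "'i set"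
  encoding :: "'i \<Rightarrow> word"

definition polytime_many_one_reducible :: "'i decision_problem \<Rightarrow> 'j decision_problem \<Rightarrow> bool" where
  "polytime_many_one_reducible A B \<longleftrightarrow>
     (\<exists>f. polytime_on (encoding A ` instances A) f \<and>
        (\<forall>x\<in>instances A. \<exists>y\<in>instances B.
           f (encoding A x) = encoding B y \<and> (x \<in> yes_instances A \<longleftrightarrow> y \<in> yes_instances B)))"

text \<open>
  Candidates are natural numbers, written in binary (least significant bit first). Every
  elementary item is terminated by a comma and every list by a semicolon, except that the sequence
  of the voters' blocks extends to the end of the word.
\<close>

fun binary :: "nat \<Rightarrow> word" where
  "binary n = (if n = 0 then [] else (if odd n then Bit1 else Bit0) # binary (n div 2))"

declare binary.simps [simp del]

definition encode_candidate :: "nat \<Rightarrow> word" where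
  "encode_candidate c = binary c @ [Comma]"

definition encode_list :: "('b \<Rightarrow> word) \<Rightarrow> 'b list \<Rightarrow> word" where
  "encode_list e xs = concat (map e xs) @ [Semicolon]"

definition encode_candidates :: "nat set \<Rightarrow> word" where
  "encode_candidates C = encode_list encode_candidate (sorted_list_of_set C)"

definition candidate_pairs :: "nat set \<Rightarrow> (nat \<times> nat) list" where
  "candidate_pairs C = List.product (sorted_list_of_set C) (sorted_list_of_set C)"

text \<open>
  In the special case of Swap Bribery every cost and the budget is either 0 or the fixed number
  \<open>\<delta>\<close>, so that one bit suffices.
\<close>

definition encode_amount :: "real \<Rightarrow> word" where
  "encode_amount x = [if x = 0 then Bit0 else Bit1, Comma]"

definition encode_costs :: "nat set \<Rightarrow> (nat \<Rightarrow> nat \<Rightarrow> real) \<Rightarrow> word" where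
  "encode_costs C c =
     encode_list (\<lambda>(a, b). encode_candidate a @ encode_candidate b @ encode_amount (c a b))
       (filter (\<lambda>(a, b). a \<noteq> b) (candidate_pairs C))"

definition encode_zero_budget_sb :: "nat swap_bribery \<Rightarrow> word" where
  "encode_zero_budget_sb I =
     encode_candidates (sb_candidates I) @
     encode_candidate (sb_preferred I) @
     encode_amount (sb_budget I) @
     concat (map
       (\<lambda>i. encode_list encode_candidate (sb_votes I ! i) @
            encode_costs (sb_candidates I) (sb_cost I i))
       [0..<length (sb_votes I)])"

definition encode_partial_vote :: "nat set \<Rightarrow> nat rel \<Rightarrow> word" where
  "encode_partial_vote C r =
     encode_list (\<lambda>(a, b). encode_candidate a @ encode_candidate b)
       (filter (\<lambda>ab. ab \<in> r) (candidate_pairs C))"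

definition encode_pw :: "nat possible_winner \<Rightarrow> word" where
  "encode_pw I =
     encode_candidates (pw_candidates I) @
     encode_candidate (pw_preferred I) @
     concat (map (encode_partial_vote (pw_candidates I)) (pw_votes I))"

definition zero_budget_swap_bribery_problem ::
    "nat election_system \<Rightarrow> real \<Rightarrow> nat swap_bribery decision_problem" where
  "zero_budget_swap_bribery_problem \<E> \<delta> =
     \<lparr>instances = {I. is_zero_budget_instance \<delta> I},
      yes_instances = {I. is_zero_budget_instance \<delta> I \<and> sb_solvable \<E> I},
      encoding = encode_zero_budget_sb\<rparr>"

definition possible_winner_problem ::
    "nat election_system \<Rightarrow> nat possible_winner decision_problem" where
  "possible_winner_problem \<E> =
     \<lparr>instances = {I. is_pw_instance I},
      yes_instances = {I. is_pw_instance I \<and> pw_solvable \<E> I},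
      encoding = encode_pw\<rparr>"

end

theory Submission imports Defs begin

text \<open>
  A bubble sort shows that a vote \<open>v\<close> can be turned into \<open>w\<close> by swaps of cost 0 exactly if \<open>w\<close>
  respects the relation \<open>R\<close> of all pairs \<open>(a, b)\<close> such that \<open>v\<close> prefers \<open>a\<close> to \<open>b\<close> and swapping
  \<open>(a, b)\<close> has positive cost. Hence Swap Bribery with budget 0 becomes Possible Winner with the
  partial votes \<open>R\<^sup>+\<close>. Conversely, a partial vote \<open>r\<close> is replaced by a linear extension of \<open>r\<close>, where
  the swap \<open>(a, b)\<close> costs \<open>\<delta>\<close> exactly if \<open>(a, b) \<in> r\<close>.

  The Turing machines for the transitive closure and for the topological sort are obtained from
  programs of a small structured language. Their time bounds are polynomials in any bound \<open>N\<close> on the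
  contents of the tapes, and \<open>N\<close> can be chosen as twice the length of the input.
\<close>

section \<open>A structured language for Turing machines\<close>

text \<open>With budget 0 and nonnegative costs every swap used must be free. A pair of candidates
  can be reversed only by the swap in the direction in which the vote ranks it, and the bubble sort
  needs no swap beyond those of the reversed pairs; hence only costly pairs ranked by the given vote
  constrain the result. The closure is taken because costs are arbitrary while a partial vote must
  be transitive; a linear order contains a relation exactly if it contains its closure. In the
  converse direction the chosen vote extends \<open>r\<close>, so every pair of \<open>r\<close> is
  ranked in its costly direction and none is lost.

  The bulk of the proof is due to reductions being maps on words computed by a concrete machine. The
  output must agree letter by letter with the encoding of an instance, in which pairs follow the
  sorted candidate list; therefore both programs write their pairs in nested loops over two copies
  of that list. The factor 2 in \<open>N\<close> pays for storing a pair of a partial vote as a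
  triple with a bit.\<close>

text \<open>
  A zipper \<open>(l, r)\<close> is a tape with its head: \<open>l\<close> holds the cells left of the head in reverse, \<open>r\<close> those
  from the head on. Cells beyond \<open>r\<close> are blank; \<open>cons_cell\<close> does not store a blank at the end.
\<close>

type_synonym zipper = "nat list \<times> nat list"

definition cons_cell :: "nat \<Rightarrow> nat list \<Rightarrow> nat list" where
  "cons_cell x r = (if x = 0 \<and> r = [] then [] else x # r)"

fun zip_read :: "zipper \<Rightarrow> nat" where
  "zip_read (l, []) = 0"
| "zip_read (l, x # r) = x"

fun zip_act :: "nat \<Rightarrow> move \<Rightarrow> zipper \<Rightarrow> zipper" where
  "zip_act x Stay (l, r) = (l, cons_cell x (tl r))"
| "zip_act x Move_Right (l, r) = (x # l, tl r)"
| "zip_act x Move_Left ([], r) = ([], cons_cell x (tl r))"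
| "zip_act x Move_Left (y # l, r) = (l, cons_cell y (cons_cell x (tl r)))"

definition cells :: "nat list \<Rightarrow> nat \<Rightarrow> nat" where
  "cells xs i = (if i < length xs then xs ! i else 0)"

fun zip_tape :: "zipper \<Rightarrow> tape" where
  "zip_tape (l, r) = (cells (rev l @ r), length l)"

lemma tape_read_zip_tape: "tape_read (zip_tape z) = zip_read z"
  by (cases z rule: zip_read.cases) (auto simp: tape_read_def cells_def nth_append)

lemma cells_cons_cell: "cells (xs @ cons_cell x r) = cells (xs @ x # r)"
  by (rule ext) (auto simp: cells_def cons_cell_def nth_append less_Suc_eq)

lemmas cells_cons_cell1 = cells_cons_cell[of "[]", simplified]

lemma cells_cons_cell2: "cells (xs @ y # cons_cell x r) = cells (xs @ y # x # r)"
  using cells_cons_cell[of "xs @ [y]" x r] by simp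

lemma cells_update: "(cells (xs @ r))(length xs := x) = cells (xs @ x # tl r)"
  by (rule ext) (cases r; auto simp: cells_def nth_append nth_Cons split: nat.splits)

lemma tape_act_zip_tape: "tape_act (x, d) (zip_tape z) = zip_tape (zip_act x d z)"
proof -
  obtain l r where z: "z = (l, r)" by (cases z)
  show ?thesis
    using cells_update[of "rev l" r x]
    by (cases d; cases l) (auto simp: z cells_cons_cell cells_cons_cell1 cells_cons_cell2)
qed

text \<open>A machine step acts on all tapes; a tape that a command leaves alone gets its own symbol
  back and its head stays.\<close>

lemma tape_act_idle: "tape_act (tape_read tp, Stay) tp = tp"
  by (cases tp) (auto simp: tape_read_def)

text \<open>Tests are arbitrary predicates of the symbols under the heads: a transition function can
  tabulate any of them, so a test takes a single step. \<open>Transfer\<close> moves data between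
  tapes; with equal tape numbers it is a pure head movement.\<close>

datatype com =
    Put nat nat move
  | Transfer nat nat move
  | Seq com com
  | Cond "nat list \<Rightarrow> bool" com com
  | Loop "nat list \<Rightarrow> bool" com

type_synonym state = "zipper list"

abbreviation reads :: "state \<Rightarrow> nat list" where
  "reads s \<equiv> map zip_read s"

text \<open>The stack of commands still to be executed plays the role of the machine state.\<close>

fun step :: "com list \<times> state \<Rightarrow> com list \<times> state" where
  "step ([], s) = ([], s)"
| "step (Put k x d # cs, s) = (cs, s[k := zip_act x d (s ! k)])"
| "step (Transfer k l d # cs, s) = (cs, s[k := zip_act (zip_read (s ! l)) d (s ! k)])"
| "step (Seq c c' # cs, s) = (c # c' # cs, s)"
| "step (Cond b c c' # cs, s) = ((if b (reads s) then c else c') # cs, s)"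
| "step (Loop b c # cs, s) = (if b (reads s) then c # Loop b c # cs else cs, s)"

text \<open>The number of steps is chosen before the rest \<open>cs\<close> of the stack, so a run
  can be placed in any context. Only a bound is kept, as branches may differ in length.\<close>

definition runs :: "com \<Rightarrow> nat \<Rightarrow> state \<Rightarrow> state \<Rightarrow> bool" where
  "runs c B s s' \<longleftrightarrow> (\<exists>t\<le>B. \<forall>cs. (step ^^ t) (c # cs, s) = (cs, s'))"

text \<open>The equation between states is a premise so that a rule can be applied with whatever
  state it produces, leaving the comparison with the intended state to the simplifier.\<close>

lemma runs_weaken: "runs c B s s' \<Longrightarrow> B \<le> B' \<Longrightarrow> s' = s'' \<Longrightarrow> runs c B' s s''"
  unfolding runs_def using le_trans by blast

lemma runs_Put: "s' = s[k := zip_act x d (s ! k)] \<Longrightarrow> runs (Put k x d) 1 s s'"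
  unfolding runs_def by (rule exI[of _ 1]) simp

lemma runs_Transfer: "s' = s[k := zip_act (zip_read (s ! l)) d (s ! k)] \<Longrightarrow> runs (Transfer k l d) 1 s s'"
  unfolding runs_def by (rule exI[of _ 1]) simp

lemma funpow_chain:
  "(f ^^ t) (f x) = y \<Longrightarrow> (f ^^ t') y = z \<Longrightarrow> (f ^^ (t' + (t + 1))) x = z"
  by (simp add: funpow_add funpow_Suc_right del: funpow.simps(2))

lemma runs_Seq:
  assumes "runs c B s s'" and "runs c' B' s' s''"
  shows "runs (Seq c c') (B + B' + 1) s s''"
proof -
  obtain t t' where "t \<le> B" "\<And>cs. (step ^^ t) (c # cs, s) = (cs, s')"
    and "t' \<le> B'" "\<And>cs. (step ^^ t') (c' # cs, s') = (cs, s'')"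
    using assms unfolding runs_def by blast
  then show ?thesis
    unfolding runs_def
    by (intro exI[of _ "t' + (t + 1)"] conjI allI funpow_chain) simp_all
qed

lemma runs_Cond:
  assumes "b (reads s) \<Longrightarrow> runs c B s s'" and "\<not> b (reads s) \<Longrightarrow> runs c' B s s'"
  shows "runs (Cond b c c') (B + 1) s s'"
proof -
  have "runs (if b (reads s) then c else c') B s s'" using assms by simp
  then obtain t where "t \<le> B" "\<And>cs. (step ^^ t) ((if b (reads s) then c else c') # cs, s) = (cs, s')"
    unfolding runs_def by blast
  then show ?thesis
    unfolding runs_def
    by (intro exI[of _ "0 + (t + 1)"] conjI allI funpow_chain) simp_all
qed

lemma runs_Loop_done: "\<not> b (reads s) \<Longrightarrow> runs (Loop b c) 1 s s"
  unfolding runs_def by (rule exI[of _ 1]) simp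

lemma runs_Loop_step:
  assumes "b (reads s)" "runs c B s s'" and "runs (Loop b c) B' s' s''"
  shows "runs (Loop b c) (B + B' + 1) s s''"
proof -
  obtain t t' where "t \<le> B" "\<And>cs. (step ^^ t) (c # cs, s) = (cs, s')"
    and "t' \<le> B'" "\<And>cs. (step ^^ t') (Loop b c # cs, s') = (cs, s'')"
    using assms unfolding runs_def by blast
  then show ?thesis
    unfolding runs_def using assms(1)
    by (intro exI[of _ "t' + (t + 1)"] conjI allI funpow_chain) simp_all
qed

text \<open>\<open>S L R\<close> is the state when the items \<open>L\<close> have been processed and \<open>R\<close> are still to come.\<close>

lemma runs_Loop_list:
  assumes "\<And>L x R. L @ x # R = xs \<Longrightarrow> b (reads (S L (x # R)))"
    and "\<And>L x R. L @ x # R = xs \<Longrightarrow> runs c B (S L (x # R)) (S (L @ [x]) R)"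
    and "\<not> b (reads (S xs []))"
  shows "runs (Loop b c) (length xs * (B + 1) + 1) (S [] xs) (S xs [])"
proof -
  have "runs (Loop b c) (length R * (B + 1) + 1) (S L R) (S xs [])" if "L @ R = xs" for L R
    using that
  proof (induction R arbitrary: L)
    case Nil
    then show ?case using assms(3) runs_Loop_done[of b] by simp
  next
    case (Cons x R)
    from Cons have "runs (Loop b c) (length R * (B + 1) + 1) (S (L @ [x]) R) (S xs [])" by simp
    from runs_Loop_step[OF assms(1)[OF Cons.prems] assms(2)[OF Cons.prems] this]
    show ?case by (rule runs_weaken) auto
  qed
  from this[of "[]" xs] show ?thesis by simp
qed

section \<open>Compilation of programs to Turing machines\<close>

fun well_formed :: "nat \<Rightarrow> com \<Rightarrow> bool" where
  "well_formed K (Put k x d) \<longleftrightarrow> k < K \<and> x \<le> 5"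
| "well_formed K (Transfer k l d) \<longleftrightarrow> k < K \<and> l < K"
| "well_formed K (Seq c c') \<longleftrightarrow> well_formed K c \<and> well_formed K c'"
| "well_formed K (Cond b c c') \<longleftrightarrow> well_formed K c \<and> well_formed K c'"
| "well_formed K (Loop b c) \<longleftrightarrow> well_formed K c"

text \<open>These are the stacks that can occur while \<open>c\<close> runs above \<open>cs\<close>,
  before \<open>cs\<close> is exposed. They are finitely many because a loop returns to the same
  stack after its body; they become the machine states.\<close>

fun conts :: "com \<Rightarrow> com list \<Rightarrow> com list set" where
  "conts (Seq c c') cs = insert (Seq c c' # cs) (conts c (c' # cs) \<union> conts c' cs)"
| "conts (Cond b c c') cs = insert (Cond b c c' # cs) (conts c cs \<union> conts c' cs)"
| "conts (Loop b c) cs = insert (Loop b c # cs) (conts c (Loop b c # cs))"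
| "conts c cs = {c # cs}"

lemma finite_conts: "finite (conts c cs)"
  by (induction c arbitrary: cs) auto

lemma conts_self: "c # cs \<in> conts c cs"
  by (cases c) auto

definition idle :: "nat \<Rightarrow> nat \<times> move" where
  "idle x = (x, Stay)"

text \<open>A transition function sees only the state and the symbols read, so \<open>step\<close>
  is recast as a function of these two that returns one action per tape.\<close>

fun control :: "com list \<Rightarrow> nat list \<Rightarrow> com list \<times> (nat \<times> move) list" where
  "control [] rs = ([], map idle rs)"
| "control (Put k x d # cs) rs = (cs, (map idle rs)[k := (x, d)])"
| "control (Transfer k l d # cs) rs = (cs, (map idle rs)[k := (rs ! l, d)])"
| "control (Seq c c' # cs) rs = (c # c' # cs, map idle rs)"
| "control (Cond b c c' # cs) rs = ((if b rs then c else c') # cs, map idle rs)"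
| "control (Loop b c # cs) rs = (if b rs then c # Loop b c # cs else cs, map idle rs)"

lemma control_conts: "q \<in> conts c cs \<Longrightarrow> fst (control q rs) \<in> insert cs (conts c cs)"
proof (induction c arbitrary: cs)
  case (Seq c c')
  show ?case using Seq.prems Seq.IH(1)[of "c' # cs"] Seq.IH(2)[of cs] conts_self[of c "c' # cs"] conts_self[of c' cs]
    by auto
next
  case (Loop b c)
  show ?case using Loop.prems Loop.IH[of "Loop b c # cs"] conts_self[of c "Loop b c # cs"]
    by (cases "b rs") auto
qed (auto simp: conts_self)

lemma map_idle_update:
  assumes "set rs \<subseteq> {..5}" "x \<le> 5"
  shows "fst ` set ((map idle rs)[k := (x, d)]) \<subseteq> {..5}"
proof -
  have "set ((map idle rs)[k := (x, d)]) \<subseteq> insert (x, d) (set (map idle rs))"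
    by (rule set_update_subset_insert)
  then show ?thesis using assms by (force simp: idle_def)
qed

lemma control_head:
  assumes rs: "length rs = K" "set rs \<subseteq> {..5}"
  shows "q \<in> conts c cs \<Longrightarrow> well_formed K c \<Longrightarrow>
    length (snd (control q rs)) = K \<and> fst ` set (snd (control q rs)) \<subseteq> {..5}"
proof (induction c arbitrary: cs)
  case (Put k x d)
  then show ?case using rs map_idle_update[OF rs(2)] by auto
next
  case (Transfer k l d)
  then have "rs ! l \<le> 5" using subsetD[OF rs(2) nth_mem[of l rs]] rs(1) by simp
  with Transfer show ?case using rs map_idle_update[OF rs(2)] by auto
qed (use rs in \<open>auto simp: idle_def\<close>)

lemma map2_idle: "map2 tape_act (map idle (map tape_read ts)) ts = ts"
  by (induction ts) (auto simp: idle_def tape_act_idle simp del: tape_act.simps)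

lemma map2_idle_update:
  "map2 tape_act ((map idle (map tape_read ts))[k := a]) ts = ts[k := tape_act a (ts ! k)]"
proof (induction ts arbitrary: k)
  case (Cons t ts)
  then show ?case
    using map2_idle[of ts]
    by (cases k) (auto simp: idle_def tape_act_idle comp_def simp del: tape_act.simps)
qed simp

lemma control_step:
  assumes "well_formed K c" "q \<in> conts c cs" "length s = K"
  shows "control q (reads s) = (fst (step (q, s)), snd (control q (reads s)))"
    and "map2 tape_act (snd (control q (reads s))) (map zip_tape s) = map zip_tape (snd (step (q, s)))"
    and "length (snd (step (q, s))) = K"
proof -
  have r: "reads s = map tape_read (map zip_tape s)" by (simp add: tape_read_zip_tape comp_def)
  note upd = map2_idle_update[of "map zip_tape s", folded r]
  have "control q (reads s) = (fst (step (q, s)), snd (control q (reads s))) \<and>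
    map2 tape_act (snd (control q (reads s))) (map zip_tape s) = map zip_tape (snd (step (q, s))) \<and>
    length (snd (step (q, s))) = K"
    using assms(1,2)
  proof (induction c arbitrary: cs)
    case (Put k x d)
    then show ?case using assms(3)
      by (simp add: upd map_update tape_act_zip_tape del: map_map tape_act.simps)
  next
    case (Transfer k l d)
    then show ?case using assms(3)
      by (simp add: upd map_update tape_act_zip_tape del: map_map tape_act.simps)
  next
    case (Seq c c')
    then show ?case using assms(3) map2_idle[of "map zip_tape s", folded r] by auto
  next
    case (Cond b c c')
    then show ?case using assms(3) map2_idle[of "map zip_tape s", folded r] by auto
  next
    case (Loop b c)
    then show ?case using assms(3) map2_idle[of "map zip_tape s", folded r] by auto
  qed
  then show "control q (reads s) = (fst (step (q, s)), snd (control q (reads s)))"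
    "map2 tape_act (snd (control q (reads s))) (map zip_tape s) = map zip_tape (snd (step (q, s)))"
    "length (snd (step (q, s))) = K" by auto
qed

definition word_symbols :: "word \<Rightarrow> nat list" where
  "word_symbols w = map letter_symbol w"

definition initial_state :: "nat \<Rightarrow> word \<Rightarrow> state" where
  "initial_state K w = ([], word_symbols w) # replicate (K - 1) ([], [])"

lemma word_on_tape_cells: "word_on_tape w = cells (word_symbols w)"
  by (rule ext) (simp add: word_on_tape_def cells_def word_symbols_def)

text \<open>The states are numbers assigned injectively to the stacks in \<open>conts c []\<close>
  and to the empty stack, which is the halting state. One machine step then simulates one
  \<open>step\<close> on the tapes denoted by the zippers.\<close>

lemma runs_tm:
  assumes wf: "well_formed K c" and K: "2 \<le> K"
  obtains M where "is_tm M"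
    and "\<And>w B s u. runs c B (initial_state K w) s \<Longrightarrow> s ! 1 = (rev (word_symbols u), []) \<Longrightarrow>
      tm_computes_within M w B u"
proof -
  define Q where "Q = insert [] (conts c [])"
  have "finite Q" by (simp add: Q_def finite_conts)
  then obtain num :: "com list \<Rightarrow> nat" where inj: "inj_on num Q"
    using finite_imp_inj_to_nat_seg by blast
  define M where "M = \<lparr>tm_tapes = K, tm_states = num ` Q, tm_symbols = {..5},
    tm_start = num [c], tm_halt = num [],
    tm_delta = (\<lambda>n rs. case control (inv_into Q num n) rs of (q, as) \<Rightarrow> (num q, as))\<rparr>"
  have start: "[c] \<in> Q" using conts_self[of c "[]"] by (simp add: Q_def)
  have ctrl: "fst (control q rs) \<in> Q" if "q \<in> Q" for q rs
    using that control_conts[of q c "[]" rs] by (auto simp: Q_def)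
  have head: "length (snd (control q rs)) = K \<and> fst ` set (snd (control q rs)) \<subseteq> {..5}"
    if "q \<in> Q" "length rs = K" "set rs \<subseteq> {..5}" for q rs
  proof (cases "q = []")
    case True
    then show ?thesis using that by (auto simp: idle_def)
  next
    case False
    then show ?thesis using that control_head[OF that(2,3) _ wf] by (auto simp: Q_def)
  qed
  have letters: "range letter_symbol \<subseteq> {..5}"
  proof
    fix x assume "x \<in> range letter_symbol"
    then obtain y where "x = letter_symbol y" by auto
    then show "x \<in> {..5}" by (cases y) auto
  qed
  have tm: "is_tm M"
    unfolding is_tm_def
  proof (intro conjI ballI allI impI)
    fix n rs assume n: "n \<in> tm_states M" and rs: "length rs = tm_tapes M \<and> set rs \<subseteq> tm_symbols M"
    then obtain q where q: "q \<in> Q" "n = num q" by (auto simp: M_def)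
    then have "inv_into Q num n = q" using inj by simp
    then have \<delta>: "tm_delta M n rs = (num (fst (control q rs)), snd (control q rs))"
      by (simp add: M_def split: prod.split)
    show "fst (tm_delta M n rs) \<in> tm_states M"
      using ctrl[OF q(1)] \<delta> by (simp add: M_def)
    show "length (snd (tm_delta M n rs)) = tm_tapes M" "fst ` set (snd (tm_delta M n rs)) \<subseteq> tm_symbols M"
      using head[OF q(1), of rs] rs \<delta> by (simp_all add: M_def)
  qed (use K \<open>finite Q\<close> start letters in \<open>simp_all add: M_def Q_def\<close>)
  have sim: "tm_step M (num q, map zip_tape s) = (num (fst (step (q, s))), map zip_tape (snd (step (q, s))))
      \<and> fst (step (q, s)) \<in> Q \<and> length (snd (step (q, s))) = K"
    if q: "q \<in> Q" and s: "length s = K" for q s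
  proof (cases "q = []")
    case True
    then show ?thesis using s by (simp add: M_def Q_def)
  next
    case False
    then have q': "q \<in> conts c []" using q by (simp add: Q_def)
    have "num q \<noteq> num []" using False q inj by (auto simp: inj_on_def Q_def)
    moreover have "inv_into Q num (num q) = q" using inj q by simp
    moreover have "map tape_read (map zip_tape s) = reads s" by (simp add: tape_read_zip_tape)
    moreover note control_step[OF wf q' s]
    ultimately show ?thesis
      using ctrl[OF q, of "reads s"] by (auto simp: M_def split: prod.split simp del: map_map)
  qed
  have sims: "(tm_step M ^^ t) (num q, map zip_tape s) =
      (num (fst ((step ^^ t) (q, s))), map zip_tape (snd ((step ^^ t) (q, s))))
      \<and> fst ((step ^^ t) (q, s)) \<in> Q \<and> length (snd ((step ^^ t) (q, s))) = K"
    if "q \<in> Q" "length s = K" for q s t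
  proof (induction t)
    case (Suc t)
    then show ?case
      using sim[of "fst ((step ^^ t) (q, s))" "snd ((step ^^ t) (q, s))"] by simp
  qed (use that in simp)
  have "tm_computes_within M w B u"
    if run: "runs c B (initial_state K w) s" and out: "s ! 1 = (rev (word_symbols u), [])" for w B s u
  proof -
    let ?s = "initial_state K w"
    obtain t where t: "t \<le> B" "(step ^^ t) ([c], ?s) = ([], s)"
      using run unfolding runs_def by blast
    \<comment> \<open>The machine is inspected after exactly \<open>B\<close> steps; since the empty
      stack is a fixed point, a shorter run can be padded.\<close>
    have "(step ^^ n) ([], s) = ([], s)" for n by (induction n) auto
    then have "(step ^^ (B - t + t)) ([c], ?s) = ([], s)"
      using t(2) by (simp only: funpow_add comp_apply)
    then have B: "(step ^^ B) ([c], ?s) = ([], s)" using t(1) by simp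
    have len: "length ?s = K" using K by (simp add: initial_state_def)
    have "tm_init M w = (num [c], map zip_tape ?s)"
      by (simp add: tm_init_def M_def initial_state_def word_on_tape_cells word_symbols_def)
    then have "(tm_step M ^^ B) (tm_init M w) = (num [], map zip_tape s)" "length s = K"
      using sims[OF start len, of B] B by simp_all
    then show ?thesis
      using out K by (simp add: tm_computes_within_def M_def word_on_tape_cells)
  qed
  then show thesis using that tm by blast
qed

section \<open>Tapes holding lists of items\<close>

lemma cons_cell_Cons [simp]: "cons_cell x (y # r) = x # y # r"
  by (simp add: cons_cell_def)

lemma cons_cell_nonzero [simp]: "x \<noteq> 0 \<Longrightarrow> cons_cell x r = x # r"
  by (simp add: cons_cell_def)

lemma cons_cell_read: "r = [] \<or> hd r \<noteq> 0 \<Longrightarrow> cons_cell (zip_read (l, r)) (tl r) = r"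
  by (cases r) (auto simp: cons_cell_def)

notation Seq (infixr ";;" 60)

abbreviation go :: "nat \<Rightarrow> move \<Rightarrow> com" where
  "go k d \<equiv> Transfer k k d"

definition skip :: com where
  "skip = Loop (\<lambda>_. False) (Put 0 0 Stay)"

lemma runs_skip: "runs skip 1 s s"
  unfolding skip_def by (rule runs_Loop_done) simp

section \<open>Scanning, copying, comparing and erasing binary words\<close>

definition is_bit :: "nat \<Rightarrow> bool" where
  "is_bit x \<longleftrightarrow> x = 1 \<or> x = 2"

definition is_bits :: "nat list \<Rightarrow> bool" where
  "is_bits w \<longleftrightarrow> (\<forall>x\<in>set w. is_bit x)"

lemma not_is_bit [simp]: "\<not> is_bit 0" "\<not> is_bit 3" "\<not> is_bit 4" "\<not> is_bit 5"
  by (simp_all add: is_bit_def)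

definition next_item :: "nat \<Rightarrow> com" where
  "next_item k = Loop (\<lambda>rs. is_bit (rs ! k)) (go k Move_Right) ;; go k Move_Right"

lemma runs_next_item:
  assumes "k < length s" "s ! k = (l, w @ 3 # r)" "is_bits w"
  shows "runs (next_item k) (2 * length w + 3) s (s[k := (3 # rev w @ l, r)])"
proof -
  let ?S = "\<lambda>L R. s[k := (rev L @ l, R @ 3 # r)]"
  have "runs (Loop (\<lambda>rs. is_bit (rs ! k)) (go k Move_Right)) (length w * (1 + 1) + 1) (?S [] w) (?S w [])"
  proof (rule runs_Loop_list)
    fix L x R assume "L @ x # R = w"
    then show "is_bit (reads (?S L (x # R)) ! k)" using assms by (auto simp: is_bits_def)
    show "runs (go k Move_Right) 1 (?S L (x # R)) (?S (L @ [x]) R)"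
      by (rule runs_Transfer) (use assms in simp)
  qed (use assms in simp)
  moreover have "?S [] w = s" using assms(2) by (simp flip: assms(2))
  ultimately have 1: "runs (Loop (\<lambda>rs. is_bit (rs ! k)) (go k Move_Right)) (length w * (1 + 1) + 1) s (?S w [])"
    by simp
  show ?thesis unfolding next_item_def
    by (rule runs_weaken, rule runs_Seq, rule 1, rule runs_Transfer, rule refl) (use assms in auto)
qed

definition scan_left :: "(nat \<Rightarrow> bool) \<Rightarrow> nat \<Rightarrow> com" where
  "scan_left P k = go k Move_Left ;; Loop (\<lambda>rs. P (rs ! k)) (go k Move_Left) ;; go k Move_Right"

text \<open>The head starts just right of \<open>w\<close> and overshoots to \<open>c\<close>, hence
  the moves before and after the loop. The condition on \<open>r\<close> keeps the zipper unchanged: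
  writing back a single stored blank at the end would drop that cell.\<close>

lemma runs_scan_left:
  assumes k: "k < length s" "s ! k = (rev w @ c # l, r)" and P: "\<forall>x\<in>set w. P x \<and> x \<noteq> 0" "\<not> P c" "c \<noteq> 0"
    and r: "r = [] \<or> hd r \<noteq> 0"
  shows "runs (scan_left P k) (2 * length w + 5) s (s[k := (c # l, w @ r)])"
proof -
  \<comment> \<open>\<open>L\<close> lists the cells already passed and \<open>R\<close> those still
    to come, nearest first. The head is on the first cell of \<open>R\<close>, or on
    \<open>c\<close> once \<open>R\<close> is empty.\<close>
  let ?S = "\<lambda>L R. s[k := (tl (R @ c # l), hd (R @ [c]) # rev L @ r)]"
  have 1: "runs (go k Move_Left) 1 s (?S [] (rev w))"
    by (rule runs_Transfer) (use k r P in \<open>cases w rule: rev_cases; simp add: cons_cell_read\<close>)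
  have 2: "runs (Loop (\<lambda>rs. P (rs ! k)) (go k Move_Left)) (length (rev w) * (1 + 1) + 1) (?S [] (rev w)) (?S (rev w) [])"
  proof (rule runs_Loop_list)
    fix L x R assume LxR: "L @ x # R = rev w"
    then have x: "x \<in> set w" by (metis in_set_conv_decomp set_rev)
    then show "P (reads (?S L (x # R)) ! k)" using P k by simp
    show "runs (go k Move_Left) 1 (?S L (x # R)) (?S (L @ [x]) R)"
      by (rule runs_Transfer) (use k P x in \<open>cases R; simp\<close>)
  qed (use k P in simp)
  show ?thesis unfolding scan_left_def
    by (rule runs_weaken, rule runs_Seq, rule 1, rule runs_Seq, rule 2, rule runs_Transfer, rule refl)
      (use k in auto)
qed

definition copy_bits :: "nat \<Rightarrow> nat \<Rightarrow> com" where
  "copy_bits k l = Loop (\<lambda>rs. is_bit (rs ! k)) (Transfer l k Move_Right ;; go k Move_Right)"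

lemma runs_copy_bits:
  assumes "k < length s" "l < length s" "k \<noteq> l" "s ! k = (a, w @ 3 # r)" "s ! l = (b, [])" "is_bits w"
  shows "runs (copy_bits k l) (4 * length w + 1) s (s[k := (rev w @ a, 3 # r), l := (rev w @ b, [])])"
proof -
  let ?S = "\<lambda>L R. s[k := (rev L @ a, R @ 3 # r), l := (rev L @ b, [])]"
  have "runs (copy_bits k l) (length w * (3 + 1) + 1) (?S [] w) (?S w [])"
    unfolding copy_bits_def
  proof (rule runs_Loop_list)
    fix L x R assume LxR: "L @ x # R = w"
    then show "is_bit (reads (?S L (x # R)) ! k)" using assms by (auto simp: is_bits_def)
    show "runs (Transfer l k Move_Right ;; go k Move_Right) 3 (?S L (x # R)) (?S (L @ [x]) R)"
      by (rule runs_weaken, rule runs_Seq, rule runs_Transfer, rule refl, rule runs_Transfer, rule refl)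
        (use assms in \<open>auto simp: list_update_swap[of k l]\<close>)
  qed (use assms in simp)
  moreover have "?S [] w = s" by (simp flip: assms(4,5))
  ultimately show ?thesis by (simp add: mult.commute)
qed

definition take_item :: "nat \<Rightarrow> nat \<Rightarrow> com" where
  "take_item k l = copy_bits k l ;; Transfer l k Move_Right ;; go k Move_Right"

lemma runs_take_item:
  assumes "k < length s" "l < length s" "k \<noteq> l" "s ! k = (a, w @ 3 # r)" "s ! l = (b, [])" "is_bits w"
  shows "runs (take_item k l) (4 * length w + 5) s (s[k := (3 # rev w @ a, r), l := (3 # rev w @ b, [])])"
  unfolding take_item_def
  by (rule runs_weaken, rule runs_Seq, rule runs_copy_bits[OF assms], rule runs_Seq, rule runs_Transfer,
      rule refl, rule runs_Transfer, rule refl)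
    (use assms in \<open>auto simp: list_update_swap[of k l]\<close>)

text \<open>Unlike with \<open>take_item\<close>, the head returns to the start of the item, so the
  item can be read again.\<close>

definition copy_item :: "nat \<Rightarrow> nat \<Rightarrow> com" where
  "copy_item k l = copy_bits k l ;; Transfer l k Move_Right ;; scan_left is_bit k"

lemma runs_copy_item:
  assumes "k < length s" "l < length s" "k \<noteq> l" "s ! k = (c # a, w @ 3 # r)" "s ! l = (b, [])" "is_bits w"
    and "\<not> is_bit c" "c \<noteq> 0"
  shows "runs (copy_item k l) (6 * length w + 9) s (s[l := (3 # rev w @ b, [])])"
  unfolding copy_item_def
  by (rule runs_weaken, rule runs_Seq, rule runs_copy_bits[OF assms(1-6)], rule runs_Seq, rule runs_Transfer,
      rule refl, rule runs_scan_left[where c = c and w = w])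
    (use assms in \<open>auto simp: is_bits_def is_bit_def nth_list_update intro!: nth_equalityI\<close>)

text \<open>A lowered flag is an untouched blank tape, so the flag tapes need no
  initialisation.\<close>

definition flag :: "bool \<Rightarrow> zipper" where
  "flag b = ([], if b then [1] else [])"

lemma zip_read_flag [simp]: "zip_read (flag b) = (if b then 1 else 0)"
  by (simp add: flag_def)

definition set_flag :: "nat \<Rightarrow> (nat list \<Rightarrow> bool) \<Rightarrow> com" where
  "set_flag f b = Cond b (Put f 1 Stay) (Put f 0 Stay)"

lemma runs_set_flag:
  assumes "f < length s" "s ! f = flag b0"
  shows "runs (set_flag f b) 2 s (s[f := flag (b (reads s))])"
  unfolding set_flag_def
  by (rule runs_weaken[where B = "1 + 1"], rule runs_Cond; (rule runs_Put)?)
    (use assms in \<open>auto simp: flag_def cons_cell_def\<close>)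

definition compare :: "nat \<Rightarrow> nat \<Rightarrow> nat \<Rightarrow> com" where
  "compare k l f =
     Loop (\<lambda>rs. rs ! k = rs ! l \<and> is_bit (rs ! k)) (go k Move_Right ;; go l Move_Right) ;;
     set_flag f (\<lambda>rs. rs ! k = rs ! l) ;; scan_left is_bit k ;; scan_left is_bit l"

lemma common_prefix:
  obtains p u v where "w = p @ u" "w' = p @ v" "u = [] \<or> v = [] \<or> hd u \<noteq> hd v"
proof (induction w arbitrary: w' thesis)
  case Nil
  show ?case by (rule Nil[of "[]"]) auto
next
  case (Cons x w)
  show ?case
  proof (cases "w' \<noteq> [] \<and> hd w' = x")
    case True
    then obtain w'' where "w' = x # w''" by (cases w') auto
    moreover obtain p u v where "w = p @ u" "w'' = p @ v" "u = [] \<or> v = [] \<or> hd u \<noteq> hd v"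
      using Cons.IH[of w''] by blast
    ultimately show ?thesis by (intro Cons.prems[of "x # p" u v]) auto
  next
    case False
    then show ?thesis by (intro Cons.prems[of "[]" "x # w" w']) auto
  qed
qed

text \<open>Both heads run over the common prefix. If the symbols found behind it agree, they are
  not bits, so both are the terminating comma and both words are exhausted. The prefix is no longer
  than \<open>w\<close>, which gives a bound in \<open>w\<close> alone.\<close>

lemma runs_compare:
  assumes idx: "k < length s" "l < length s" "f < length s" "k \<noteq> l" "k \<noteq> f" "l \<noteq> f"
    and k: "s ! k = (c # a, w @ 3 # r)" "is_bits w" "\<not> is_bit c" "c \<noteq> 0"
    and l: "s ! l = (c' # a', w' @ 3 # r')" "is_bits w'" "\<not> is_bit c'" "c' \<noteq> 0"
    and f: "s ! f = flag b"
  shows "runs (compare k l f) (8 * length w + 18) s (s[f := flag (w = w')])"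
proof -
  obtain p u v where w: "w = p @ u" "w' = p @ v" and uv: "u = [] \<or> v = [] \<or> hd u \<noteq> hd v"
    by (rule common_prefix)
  let ?S = "\<lambda>L R. s[k := (rev L @ c # a, R @ u @ 3 # r), l := (rev L @ c' # a', R @ v @ 3 # r')]"
  let ?loop = "Loop (\<lambda>rs. rs ! k = rs ! l \<and> is_bit (rs ! k)) (go k Move_Right ;; go l Move_Right)"
  have hd: "(hd (u @ [3]) = hd (v @ [3])) \<longleftrightarrow> u = [] \<and> v = []"
    using uv k(2) l(2) unfolding w by (cases u; cases v) (auto simp: is_bits_def is_bit_def)
  have eq: "(w = w') \<longleftrightarrow> u = [] \<and> v = []" using uv w by auto
  have rd: "zip_read (x, y @ 3 # z) = hd (y @ [3])" for x y z by (cases y) auto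
  have "runs ?loop (length p * (3 + 1) + 1) (?S [] p) (?S p [])"
  proof (rule runs_Loop_list)
    fix L x R assume LxR: "L @ x # R = p"
    then show "reads (?S L (x # R)) ! k = reads (?S L (x # R)) ! l \<and> is_bit (reads (?S L (x # R)) ! k)"
      using idx k w by (auto simp: is_bits_def)
    show "runs (go k Move_Right ;; go l Move_Right) 3 (?S L (x # R)) (?S (L @ [x]) R)"
      by (rule runs_weaken, rule runs_Seq, rule runs_Transfer, rule refl, rule runs_Transfer, rule refl)
        (use idx in \<open>auto simp: list_update_swap[of k l]\<close>)
  next
    show "\<not> (reads (?S p []) ! k = reads (?S p []) ! l \<and> is_bit (reads (?S p []) ! k))"
      using hd idx by (auto simp: rd)
  qed
  moreover have "?S [] p = s[k := s ! k, l := s ! l]" using w k(1) l(1) by simp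
  ultimately have 1: "runs ?loop (4 * length p + 1) s (?S p [])" by (simp add: mult.commute)
  have 2: "runs (set_flag f (\<lambda>rs. rs ! k = rs ! l)) 2 (?S p []) ((?S p [])[f := flag (w = w')])"
    by (rule runs_weaken, rule runs_set_flag) (use idx f hd in \<open>auto simp: rd eq\<close>)
  have bits: "\<forall>x\<in>set p. is_bit x \<and> x \<noteq> 0" using k(2) w by (auto simp: is_bits_def is_bit_def)
  have r: "hd (u @ 3 # r) \<noteq> 0" "hd (v @ 3 # r') \<noteq> 0"
    using k(2) l(2) unfolding w by (cases u; cases v; auto simp: is_bits_def is_bit_def)+
  let ?s = "(?S p [])[f := flag (w = w')]"
  have 3: "runs (scan_left is_bit k) (2 * length p + 5) ?s (?s[k := (c # a, p @ u @ 3 # r)])"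
    by (rule runs_scan_left) (use idx k bits r in auto)
  have 4: "runs (scan_left is_bit l) (2 * length p + 5) (?s[k := (c # a, p @ u @ 3 # r)])
      (?s[k := (c # a, p @ u @ 3 # r), l := (c' # a', p @ v @ 3 # r')])"
    by (rule runs_scan_left) (use idx l bits r in auto)
  have "?s[k := (c # a, p @ u @ 3 # r), l := (c' # a', p @ v @ 3 # r')] = s[f := flag (w = w')]"
    using idx k(1) l(1) w by (intro nth_equalityI) (auto simp: nth_list_update)
  then show ?thesis unfolding compare_def
    by (intro runs_weaken[OF runs_Seq[OF 1 runs_Seq[OF 2 runs_Seq[OF 3 4]]]]) (use w in auto)
qed

definition clear :: "nat \<Rightarrow> com" where
  "clear k = go k Move_Left ;; Loop (\<lambda>rs. rs ! k \<noteq> 5) (Put k 0 Move_Left) ;; go k Move_Right"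

text \<open>Erasing from the right end makes each new blank the last cell, where
  \<open>cons_cell\<close> discards it; so the result is literally the zipper with the marker
  alone.\<close>

lemma runs_clear:
  assumes k: "k < length s" "s ! k = (rev w @ [5], [])" "0 \<notin> set w" "5 \<notin> set w"
  shows "runs (clear k) (2 * length w + 5) s (s[k := ([5], [])])"
proof -
  let ?S = "\<lambda>L R. s[k := (tl (R @ [5]), [hd (R @ [5])])]"
  have 1: "runs (go k Move_Left) 1 s (?S [] (rev w))"
    by (rule runs_Transfer) (use k in \<open>cases w rule: rev_cases; simp add: cons_cell_def\<close>)
  have 2: "runs (Loop (\<lambda>rs. rs ! k \<noteq> 5) (Put k 0 Move_Left)) (length (rev w) * (1 + 1) + 1) (?S [] (rev w)) (?S (rev w) [])"
  proof (rule runs_Loop_list)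
    fix L x R assume LxR: "L @ x # R = rev w"
    then have x: "x \<in> set w" "set R \<subseteq> set w"
      by (metis in_set_conv_decomp set_rev, metis LxR set_append set_rev set_subset_Cons sup.coboundedI2 sup.order_iff sup_ge2)
    then show "reads (?S L (x # R)) ! k \<noteq> 5" using k by auto
    show "runs (Put k 0 Move_Left) 1 (?S L (x # R)) (?S (L @ [x]) R)"
      by (rule runs_Put) (use k x in \<open>cases R; auto simp: cons_cell_def\<close>)
  qed (use k in simp)
  show ?thesis unfolding clear_def
    by (rule runs_weaken, rule runs_Seq, rule 1, rule runs_Seq, rule 2, rule runs_Transfer, rule refl)
      (use k in auto)
qed

text \<open>
  On tapes 2 to 6 the symbol 5 marks cell 0 and each item is a word over the bits 1 and 2 followed by a
  comma, which is the symbol 3; the semicolon is 4. The programs use the tapes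
  0 (input), 1 (output), 2 and 3 (candidates), 4 (vote), 5 (triples of two candidates and a bit),
  6 (the list under construction) and 7 to 9 (flags).
\<close>

definition items :: "nat list list \<Rightarrow> nat list" where
  "items ws = concat (map (\<lambda>w. w @ [3]) ws)"

lemma items_simps [simp]:
  "items [] = []" "items (w # ws) = w @ 3 # items ws" "items (ws @ ws') = items ws @ items ws'"
  by (simp_all add: items_def)

definition item_tape :: "nat list list \<Rightarrow> nat list list \<Rightarrow> zipper" where
  "item_tape L R = (rev (5 # items L), items R)"

text \<open>The single number \<open>N\<close> bounds the number of items as well as the length of
  each, so that every subroutine gets a time bound in \<open>N\<close> alone.\<close>

definition fits :: "nat \<Rightarrow> nat list list \<Rightarrow> bool" where
  "fits N ws \<longleftrightarrow> (\<forall>w\<in>set ws. is_bits w) \<and> length (items ws) \<le> N"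

definition fits1 :: "nat \<Rightarrow> nat list \<Rightarrow> bool" where
  "fits1 N w \<longleftrightarrow> is_bits w \<and> length w \<le> N"

lemma fits_length: "fits N ws \<Longrightarrow> length ws \<le> N"
proof -
  have "length ws \<le> length (items ws)" by (induction ws) auto
  then show "fits N ws \<Longrightarrow> length ws \<le> N" by (simp add: fits_def)
qed

lemma fits_fits1: "fits N ws \<Longrightarrow> w \<in> set ws \<Longrightarrow> fits1 N w"
  by (auto simp: fits_def fits1_def in_set_conv_decomp)

lemma fits_append: "fits N (ws @ ws') \<Longrightarrow> fits N ws \<and> fits N ws'"
  by (auto simp: fits_def)

lemma items_symbols:
  assumes "\<forall>w\<in>set ws. is_bits w"
  shows "0 \<notin> set (items ws)" "5 \<notin> set (items ws)"
  using assms by (induction ws) (auto simp: is_bits_def)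

text \<open>The cell left of an item is the comma of its predecessor or the marker; either one stops
  a leftward scan over bits.\<close>

lemma item_tape_left:
  obtains c a where "rev (5 # items L) = c # a" "\<not> is_bit c" "c \<noteq> 0"
  by (cases L rule: rev_cases) auto

lemma zip_read_item_tape [simp]:
  "zip_read (item_tape L []) = 0" "is_bits w \<Longrightarrow> 0 < zip_read (item_tape L (w # R))"
  by (auto simp: item_tape_def is_bits_def is_bit_def) (cases w; auto)

lemma runs_next_item_tape:
  assumes "k < length s" "s ! k = item_tape L (w # R)" "fits1 N w"
  shows "runs (next_item k) (2 * N + 3) s (s[k := item_tape (L @ [w]) R])"
  by (rule runs_weaken, rule runs_next_item[where w = w and l = "rev (5 # items L)" and r = "items R"])
    (use assms in \<open>auto simp: item_tape_def fits1_def\<close>)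

definition rewind :: "nat \<Rightarrow> com" where
  "rewind k = scan_left (\<lambda>x. x \<noteq> 5) k"

lemma runs_rewind:
  assumes "k < length s" "s ! k = item_tape L R" "fits N (L @ R)"
  shows "runs (rewind k) (2 * N + 5) s (s[k := item_tape [] (L @ R)])"
  unfolding rewind_def
proof (rule runs_weaken, rule runs_scan_left[where w = "items L" and c = 5 and l = "[]" and r = "items R"])
  have bits: "\<forall>w\<in>set L. is_bits w" "\<forall>w\<in>set R. is_bits w"
    using assms by (auto simp: fits_def)
  show "items R = [] \<or> hd (items R) \<noteq> 0"
    using items_symbols(1)[OF bits(2)] hd_in_set[of "items R"] by metis
  show "\<forall>x\<in>set (items L). x \<noteq> 5 \<and> x \<noteq> 0"
    using items_symbols[OF bits(1)] by metis
qed (use assms in \<open>auto simp: item_tape_def fits_def\<close>)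

lemma runs_copy_item_output:
  assumes "k < length s" "l < length s" "k \<noteq> l" "s ! k = item_tape L (w # R)" "s ! l = (rev xs, [])" "fits1 N w"
  shows "runs (copy_item k l) (6 * N + 9) s (s[l := (rev (xs @ w @ [3]), [])])"
proof -
  obtain c a where c: "rev (5 # items L) = c # a" "\<not> is_bit c" "c \<noteq> 0" by (rule item_tape_left)
  show ?thesis
    by (rule runs_weaken, rule runs_copy_item[where w = w and c = c and a = a and r = "items R" and b = "rev xs"])
      (use assms c in \<open>auto simp: item_tape_def fits1_def\<close>)
qed

lemma runs_copy_item_append:
  assumes "k < length s" "l < length s" "k \<noteq> l" "s ! k = item_tape L (w # R)" "s ! l = item_tape ws []" "fits1 N w"
  shows "runs (copy_item k l) (6 * N + 9) s (s[l := item_tape (ws @ [w]) []])"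
  using runs_copy_item_output[of k s l L w R "5 # items ws" N] assms by (simp add: item_tape_def)

lemma runs_compare_items:
  assumes "k < length s" "l < length s" "f < length s" "k \<noteq> l" "k \<noteq> f" "l \<noteq> f"
    and "s ! k = item_tape L (w # R)" "s ! l = item_tape L' (w' # R')" "s ! f = flag b" "fits1 N w" "is_bits w'"
  shows "runs (compare k l f) (8 * N + 18) s (s[f := flag (w = w')])"
proof -
  obtain c a where c: "rev (5 # items L) = c # a" "\<not> is_bit c" "c \<noteq> 0" by (rule item_tape_left)
  obtain c' a' where c': "rev (5 # items L') = c' # a'" "\<not> is_bit c'" "c' \<noteq> 0" by (rule item_tape_left)
  show ?thesis
    by (rule runs_weaken, rule runs_compare[where w = w and c = c and a = a and r = "items R"
          and w' = w' and c' = c' and a' = a' and r' = "items R'"])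
      (use assms c c' in \<open>auto simp: item_tape_def fits1_def\<close>)
qed

lemma runs_clear_items:
  assumes "k < length s" "s ! k = item_tape L []" "fits N L"
  shows "runs (clear k) (2 * N + 5) s (s[k := item_tape [] []])"
  by (rule runs_weaken, rule runs_clear[where w = "items L"])
    (use assms items_symbols[of L] in \<open>auto simp: item_tape_def fits_def\<close>)

section \<open>Iteration over the entries of a tape\<close>

definition foreach :: "nat \<Rightarrow> com \<Rightarrow> com" where
  "foreach k c = rewind k ;; Loop (\<lambda>rs. rs ! k \<noteq> 0) c"

text \<open>The loop accounts for \<open>N * (B + 1) + 1\<close>, the rewinding for
  \<open>2 * N + 5\<close> and the sequencing for 1.\<close>

definition foreach_time :: "nat \<Rightarrow> nat \<Rightarrow> nat" where
  "foreach_time N B = N * (B + 1) + 2 * N + 7"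

text \<open>Because rewinding comes at the start, a traversed tape rests with its head at the right
  end, the position required for appending to it or clearing it. An entry may consist of several
  items; the loop stops at the blank behind the last one.\<close>

lemma runs_foreach:
  assumes k: "k < length s" "s ! k = item_tape pre post" "fits N (pre @ post)"
    and S: "s[k := item_tape [] (pre @ post)] = S [] xs" "length xs \<le> N" "\<And>L R. length (S L R) = length s"
    and more: "\<And>L x R. L @ x # R = xs \<Longrightarrow> 0 < zip_read (S L (x # R) ! k)"
    and body: "\<And>L x R. L @ x # R = xs \<Longrightarrow> runs c B (S L (x # R)) (S (L @ [x]) R)"
    and stop: "zip_read (S xs [] ! k) = 0"
    and s': "S xs [] = s'"
  shows "runs (foreach k c) (foreach_time N B) s s'"
proof -
  have "runs (Loop (\<lambda>rs. rs ! k \<noteq> 0) c) (length xs * (B + 1) + 1) (S [] xs) (S xs [])"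
    by (rule runs_Loop_list) (use assms in auto)
  then have "runs (foreach k c) (2 * N + 5 + (length xs * (B + 1) + 1) + 1) s s'"
    unfolding foreach_def using runs_rewind[OF k] S(1) s' by (metis runs_Seq)
  then show ?thesis
    by (rule runs_weaken) (use mult_le_mono1[OF S(2), of "B + 1"] in \<open>auto simp: foreach_time_def\<close>)
qed

definition take_items :: "nat \<Rightarrow> com" where
  "take_items l = Loop (\<lambda>rs. rs ! 0 \<noteq> 4) (take_item 0 l) ;; go 0 Move_Right"

lemma runs_take_item_tape:
  assumes "0 < length s" "l < length s" "0 \<noteq> l" "s ! 0 = (a, w @ 3 # r)" "s ! l = item_tape L []" "fits1 N w"
  shows "runs (take_item 0 l) (4 * N + 5) s (s[0 := (rev (w @ [3]) @ a, r), l := item_tape (L @ [w]) []])"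
  by (rule runs_weaken, rule runs_take_item[where w = w and a = a and r = r and b = "rev (5 # items L)"])
    (use assms in \<open>auto simp: item_tape_def fits1_def\<close>)

lemma zip_read_item [simp]: "is_bits w \<Longrightarrow> 0 < zip_read (a, w @ 3 # r)" "is_bits w \<Longrightarrow> zip_read (a, w @ 3 # r) \<noteq> 4"
  by (cases w; auto simp: is_bits_def is_bit_def)+

lemma runs_take_items:
  assumes s: "0 < length s" "l < length s" "0 \<noteq> l" "s ! 0 = (a, items ws @ 4 # r)" "s ! l = item_tape L []"
    and ws: "fits N ws"
  shows "runs (take_items l) (N * (4 * N + 6) + 3) s
    (s[0 := (rev (items ws @ [4]) @ a, r), l := item_tape (L @ ws) []])"
proof -
  let ?S = "\<lambda>A B. s[0 := (rev (items A) @ a, items B @ 4 # r), l := item_tape (L @ A) []]"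
  have "runs (Loop (\<lambda>rs. rs ! 0 \<noteq> 4) (take_item 0 l)) (length ws * (4 * N + 5 + 1) + 1) (?S [] ws) (?S ws [])"
  proof (rule runs_Loop_list)
    fix A x B assume AxB: "A @ x # B = ws"
    then have x: "fits1 N x" using fits_fits1[OF ws] by auto
    then show "reads (?S A (x # B)) ! 0 \<noteq> 4" using s by (auto simp: fits1_def)
    show "runs (take_item 0 l) (4 * N + 5) (?S A (x # B)) (?S (A @ [x]) B)"
      by (rule runs_weaken, rule runs_take_item_tape[where w = x and a = "rev (items A) @ a" and r = "items B @ 4 # r"
            and L = "L @ A" and N = N])
        (use s x in \<open>auto simp: list_update_swap[of 0 l]\<close>)
  qed (use s in simp)
  moreover have "?S [] ws = s[0 := s ! 0, l := s ! l]" using s by simp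
  ultimately have 1: "runs (Loop (\<lambda>rs. rs ! 0 \<noteq> 4) (take_item 0 l)) (length ws * (4 * N + 5 + 1) + 1) s (?S ws [])"
    by simp
  have 2: "runs (go 0 Move_Right) 1 (?S ws []) (s[0 := (rev (items ws @ [4]) @ a, r), l := item_tape (L @ ws) []])"
    by (rule runs_Transfer) (use s in \<open>auto simp: list_update_swap[of 0 l]\<close>)
  show ?thesis unfolding take_items_def
    by (rule runs_weaken[OF runs_Seq[OF 1 2]])
      (use mult_le_mono1[OF fits_length[OF ws], of "4 * N + 6"] in \<open>auto simp: algebra_simps\<close>)
qed

section \<open>Candidates and cost triples on tapes\<close>

definition cand :: "nat \<Rightarrow> nat list" where
  "cand c = word_symbols (binary c)"

lemma is_bits_cand [simp]: "is_bits (cand c)"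
proof (induction c rule: binary.induct)
  case (1 n)
  then show ?case
    by (subst cand_def, subst binary.simps) (auto simp: word_symbols_def is_bits_def is_bit_def cand_def)
qed

text \<open>The first digit gives the parity and the remaining digits the half. This is what lets
  equality of candidates be decided by comparing their codes.\<close>

lemma inj_binary: "binary m = binary n \<Longrightarrow> m = n"
proof (induction m arbitrary: n rule: binary.induct)
  case (1 m)
  show ?case
  proof (cases "m = 0 \<or> n = 0")
    case True
    then show ?thesis
      using "1.prems" by (auto simp: binary.simps[of m] binary.simps[of n] binary.simps[of 0] split: if_splits)
  next
    case False
    then have "binary (m div 2) = binary (n div 2)" "odd m = odd n"
      using "1.prems" by (auto simp: binary.simps[of m] binary.simps[of n] split: if_splits)
    with False "1.IH" have "m div 2 = n div 2" "odd m = odd n" by auto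
    then show ?thesis by (metis even_two_times_div_two odd_two_times_div_two_succ)
  qed
qed

lemma inj_letter_symbol: "inj letter_symbol"
proof (rule injI)
  fix x y show "letter_symbol x = letter_symbol y \<Longrightarrow> x = y" by (cases x; cases y) auto
qed

lemma inj_word_symbols: "word_symbols u = word_symbols v \<longleftrightarrow> u = v"
  unfolding word_symbols_def using inj_letter_symbol by (simp add: inj_map_eq_map)

lemma cand_eq_iff [simp]: "cand x = cand y \<longleftrightarrow> x = y"
  using inj_binary by (auto simp: cand_def inj_word_symbols)

lemma cand_image_iff [simp]: "cand x \<in> cand ` A \<longleftrightarrow> x \<in> A"
  by auto

text \<open>The list searched is always the one on tape 6. Flag 7 receives the answer; flag 8 is
  scratch space for the comparison and is lowered again.\<close>

definition member :: "nat \<Rightarrow> com" where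
  "member k = set_flag 7 (\<lambda>_. False) ;; foreach 6
     (compare k 6 8 ;; set_flag 7 (\<lambda>rs. rs ! 7 = 1 \<or> rs ! 8 = 1) ;; set_flag 8 (\<lambda>_. False) ;; next_item 6)"

text \<open>The body takes \<open>8 * N + 18\<close> for the comparison, 2 for each of two flags,
  \<open>2 * N + 3\<close> for the advance and 1 for each of three sequencings. Several later
  constants are rounded up.\<close>

definition member_time :: "nat \<Rightarrow> nat" where
  "member_time N = foreach_time N (10 * N + 28) + 3"

lemma runs_member:
  assumes s: "length s = 10" "k < 6" "s ! k = item_tape L (w # R)" "s ! 6 = item_tape ws []"
    "s ! 7 = flag b" "s ! 8 = flag False" and fits: "fits N ws" "fits1 N w"
  shows "runs (member k) (member_time N) s (s[7 := flag (w \<in> set ws)])"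
proof -
  let ?s = "s[7 := flag False]"
  let ?S = "\<lambda>A B. s[7 := flag (w \<in> set A), 6 := item_tape A B]"
  let ?body = "compare k 6 8 ;; set_flag 7 (\<lambda>rs. rs ! 7 = 1 \<or> rs ! 8 = 1) ;; set_flag 8 (\<lambda>_. False) ;; next_item 6"
  have 1: "runs (set_flag 7 (\<lambda>_. False)) 2 s ?s"
    by (rule runs_set_flag) (use s in auto)
  have 2: "runs (foreach 6 ?body) (foreach_time N (10 * N + 28)) ?s (s[7 := flag (w \<in> set ws)])"
  proof (rule runs_foreach[where S = ?S and xs = ws and pre = ws and post = "[]"])
    fix A x B assume AxB: "A @ x # B = ws"
    then have x: "fits1 N x" using fits_fits1[OF fits(1)] by auto
    then show "0 < zip_read (?S A (x # B) ! 6)" using s by (auto simp: fits1_def)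
    let ?s1 = "(?S A (x # B))[8 := flag (w = x)]"
    let ?s2 = "?s1[7 := flag (w = x \<or> w \<in> set A)]"
    let ?s3 = "?s2[8 := flag False]"
    have "runs (compare k 6 8) (8 * N + 18) (?S A (x # B)) ?s1"
      by (rule runs_compare_items[where L = L and R = R and L' = A and R' = B and b = False])
        (use s fits x in \<open>auto simp: fits1_def\<close>)
    moreover have "runs (set_flag 7 (\<lambda>rs. rs ! 7 = 1 \<or> rs ! 8 = 1)) 2 ?s1 ?s2"
      by (rule runs_weaken, rule runs_set_flag[where ?b0.0 = "w \<in> set A"]) (use s in auto)
    moreover have "runs (set_flag 8 (\<lambda>_. False)) 2 ?s2 ?s3"
      by (rule runs_set_flag[where ?b0.0 = "w = x"]) (use s in auto)
    moreover have "runs (next_item 6) (2 * N + 3) ?s3 (?S (A @ [x]) B)"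
      by (rule runs_weaken, rule runs_next_item_tape[where w = x and L = A and R = B and N = N])
        (use s x in \<open>auto intro!: nth_equalityI simp: nth_list_update\<close>)
    ultimately have "runs ?body (8 * N + 18 + (2 + (2 + (2 * N + 3) + 1) + 1) + 1) (?S A (x # B)) (?S (A @ [x]) B)"
      by (intro runs_Seq)
    then show "runs ?body (10 * N + 28) (?S A (x # B)) (?S (A @ [x]) B)"
      by (rule runs_weaken) auto
  qed (use s fits fits_length in \<open>auto intro!: nth_equalityI simp: nth_list_update\<close>)
  show ?thesis unfolding member_def
    by (rule runs_weaken[OF runs_Seq[OF 1 2]]) (auto simp: member_time_def)
qed

text \<open>Symbol 2 is the digit with which \<open>encode_amount\<close> writes a nonzero cost, so
  the cost list of an input block can be copied to tape 5 as it stands.\<close>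

fun edge_items :: "nat \<times> nat \<times> bool \<Rightarrow> nat list list" where
  "edge_items (y, x, b) = [cand y, cand x, [if b then 2 else 1]]"

abbreviation cand_tape :: "nat list \<Rightarrow> nat list \<Rightarrow> zipper" where
  "cand_tape L R \<equiv> item_tape (map cand L) (map cand R)"

abbreviation edge_tape :: "(nat \<times> nat \<times> bool) list \<Rightarrow> (nat \<times> nat \<times> bool) list \<Rightarrow> zipper" where
  "edge_tape L R \<equiv> item_tape (concat (map edge_items L)) (concat (map edge_items R))"

text \<open>When flag 9 is updated, the head of tape 5 has passed both candidates of the triple and
  stands on its bit.\<close>

definition scan :: "bool \<Rightarrow> nat \<Rightarrow> com" where
  "scan p k = set_flag 9 (\<lambda>_. False) ;; foreach 5
     (member 5 ;; next_item 5 ;; compare 5 k 8 ;; next_item 5 ;;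
      set_flag 9 (\<lambda>rs. rs ! 9 = 1 \<or> (rs ! 7 = 1) = p \<and> rs ! 8 = 1 \<and> rs ! 5 = 2) ;;
      set_flag 7 (\<lambda>_. False) ;; set_flag 8 (\<lambda>_. False) ;; next_item 5)"

definition scan_time :: "nat \<Rightarrow> nat" where
  "scan_time N = foreach_time N (member_time N + 14 * N + 40) + 3"

text \<open>One query serves three purposes. With \<open>p\<close> true it drives reachability from
  the listed candidates; with \<open>p\<close> false it detects a predecessor not yet listed, which
  blocks \<open>x\<close> in the topological sort; with \<open>p\<close> true and
  \<open>ys = [a]\<close> it looks up the single pair \<open>(a, x)\<close>.\<close>

definition hit :: "bool \<Rightarrow> (nat \<times> nat \<times> bool) list \<Rightarrow> nat list \<Rightarrow> nat \<Rightarrow> bool" where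
  "hit p es ys x \<longleftrightarrow> (\<exists>y. (y \<in> set ys) = p \<and> (y, x, True) \<in> set es)"

lemma hit_append [simp]:
  "hit p (es @ [(y, x', b)]) ys x \<longleftrightarrow> hit p es ys x \<or> (y \<in> set ys) = p \<and> x' = x \<and> b"
  "\<not> hit p [] ys x"
  by (auto simp: hit_def)

lemma length_edges: "length es \<le> length (concat (map edge_items es))"
  by (induction es) auto

lemma runs_scan:
  assumes s: "length s = 10" "k < 5" "s ! k = item_tape A0 (cand x # B0)" "s ! 5 = edge_tape es []"
      "s ! 6 = cand_tape ys []" "s ! 7 = flag False" "s ! 8 = flag False" "s ! 9 = flag b"
    and fits: "fits N (concat (map edge_items es))" "fits N (map cand ys)" "fits1 N (cand x)"
  shows "runs (scan p k) (scan_time N) s (s[9 := flag (hit p es ys x)])"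
proof -
  let ?s = "s[9 := flag False]"
  let ?S = "\<lambda>A B. s[9 := flag (hit p A ys x), 5 := edge_tape A B]"
  let ?set = "\<lambda>rs. rs ! 9 = 1 \<or> (rs ! 7 = 1) = p \<and> rs ! 8 = 1 \<and> rs ! (5::nat) = (2::nat)"
  let ?body = "member 5 ;; next_item 5 ;; compare 5 k 8 ;; next_item 5 ;; set_flag 9 ?set ;;
      set_flag 7 (\<lambda>_. False) ;; set_flag 8 (\<lambda>_. False) ;; next_item 5"
  have 1: "runs (set_flag 9 (\<lambda>_. False)) 2 s ?s"
    by (rule runs_set_flag) (use s in auto)
  have 2: "runs (foreach 5 ?body) (foreach_time N (member_time N + 14 * N + 40)) ?s (s[9 := flag (hit p es ys x)])"
  proof (rule runs_foreach[where S = ?S and xs = es and pre = "concat (map edge_items es)" and post = "[]"])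
    fix A e B assume AeB: "A @ e # B = es"
    obtain y z c where e: "e = (y, z, c)" by (cases e)
    show "0 < zip_read (?S A (e # B) ! 5)" using s by (auto simp: e)
    have f: "fits1 N (cand y)" "fits1 N (cand z)" "fits1 N [if c then 2 else 1]"
      using AeB e by (auto intro!: fits_fits1[OF fits(1)])
    let ?L = "concat (map edge_items A)" and ?R = "concat (map edge_items B)"
    let ?b = "[if c then 2 else 1]"
    let ?s0 = "?S A (e # B)"
    let ?s1 = "?s0[7 := flag (y \<in> set ys)]"
    let ?s2 = "?s1[5 := item_tape (?L @ [cand y]) (cand z # ?b # ?R)]"
    let ?s3 = "?s2[8 := flag (z = x)]"
    let ?s4 = "?s3[5 := item_tape (?L @ [cand y, cand z]) (?b # ?R)]"
    let ?s5 = "?s4[9 := flag (hit p (A @ [e]) ys x)]"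
    let ?s6 = "?s5[7 := flag False]"
    let ?s7 = "?s6[8 := flag False]"
    have "runs (member 5) (member_time N) ?s0 ?s1"
      by (rule runs_weaken, rule runs_member[where w = "cand y" and ws = "map cand ys" and b = False and N = N
            and L = ?L and R = "cand z # ?b # ?R"])
        (use s fits f in \<open>auto simp: e\<close>)
    moreover have "runs (next_item 5) (2 * N + 3) ?s1 ?s2"
      by (rule runs_next_item_tape) (use s f in \<open>auto simp: e\<close>)
    moreover have "runs (compare 5 k 8) (8 * N + 18) ?s2 ?s3"
      by (rule runs_weaken, rule runs_compare_items[where w = "cand z" and w' = "cand x" and b = False and N = N
            and L = "?L @ [cand y]" and R = "?b # ?R" and L' = A0 and R' = B0])
        (use s fits f in auto)
    moreover have "runs (next_item 5) (2 * N + 3) ?s3 ?s4"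
      by (rule runs_weaken, rule runs_next_item_tape[where w = "cand z" and L = "?L @ [cand y]" and R = "?b # ?R" and N = N])
        (use s f in auto)
    moreover have "runs (set_flag 9 ?set) 2 ?s4 ?s5"
      by (rule runs_weaken, rule runs_set_flag[where ?b0.0 = "hit p A ys x"])
        (use s in \<open>auto simp: e item_tape_def\<close>)
    moreover have "runs (set_flag 7 (\<lambda>_. False)) 2 ?s5 ?s6"
      by (rule runs_set_flag[where ?b0.0 = "y \<in> set ys"]) (use s in auto)
    moreover have "runs (set_flag 8 (\<lambda>_. False)) 2 ?s6 ?s7"
      by (rule runs_set_flag[where ?b0.0 = "z = x"]) (use s in auto)
    moreover have "runs (next_item 5) (2 * N + 3) ?s7 (?S (A @ [e]) B)"
      by (rule runs_weaken, rule runs_next_item_tape[where w = ?b and L = "?L @ [cand y, cand z]" and R = ?R and N = N])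
        (use s f in \<open>auto intro!: nth_equalityI simp: nth_list_update e\<close>)
    ultimately have "runs ?body (member_time N + (2 * N + 3 + (8 * N + 18 + (2 * N + 3 + (2 + (2 +
        (2 + (2 * N + 3) + 1) + 1) + 1) + 1) + 1) + 1) + 1) ?s0 (?S (A @ [e]) B)"
      by (intro runs_Seq)
    then show "runs ?body (member_time N + 14 * N + 40) ?s0 (?S (A @ [e]) B)"
      by (rule runs_weaken) auto
  qed (use s fits le_trans[OF length_edges fits_length[OF fits(1)]] in \<open>auto intro!: nth_equalityI simp: nth_list_update\<close>)
  show ?thesis unfolding scan_def
    by (rule runs_weaken[OF runs_Seq[OF 1 2]]) (auto simp: scan_time_def)
qed

section \<open>The two Turing machine programs\<close>

text \<open>States are written as explicit lists of ten tapes; with this rule the simplifier carries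
  out updates at numeral indices.\<close>

lemma list_update_numeral [simp]: "(x # xs)[numeral v := y] = x # xs[pred_numeral v := y]"
  by (simp add: numeral_eq_Suc)

declare list_update_code [simp]

lemma runs_when:
  assumes "b (reads s) \<Longrightarrow> runs c B s s'" and "\<not> b (reads s) \<Longrightarrow> s = s'"
  shows "runs (Cond b c skip) (B + 2) s s'"
proof -
  have "runs (Cond b c skip) (B + 1 + 1) s s'"
    by (rule runs_Cond) (auto intro: runs_weaken[OF assms(1)] runs_weaken[OF runs_skip] dest: assms(2))
  then show ?thesis by simp
qed

abbreviation conf :: "zipper \<Rightarrow> nat list \<Rightarrow> zipper \<Rightarrow> zipper \<Rightarrow> zipper \<Rightarrow> zipper \<Rightarrow> zipper \<Rightarrow> state" where
  "conf i out c d v e t \<equiv> [i, (rev out, []), c, d, v, e, t, flag False, flag False, flag False]"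

abbreviation empty_tape :: zipper where
  "empty_tape \<equiv> item_tape [] []"

lemma flag_False: "flag False = ([], [])"
  by (simp add: flag_def)

lemma empty_tape: "empty_tape = ([5], [])"
  by (simp add: item_tape_def)

text \<open>Both encodings begin with the candidates and the preferred candidate, so both programs
  share this prefix. Loops over pairs of candidates need two heads, hence two copies of the list.
  The semicolon is written separately because \<open>take_items\<close> skips it without
  copying.\<close>

definition header :: com where
  "header = Put 2 5 Move_Right ;; Put 3 5 Move_Right ;; Put 4 5 Move_Right ;; Put 5 5 Move_Right ;;
     Put 6 5 Move_Right ;; take_items 2 ;;
     foreach 2 (copy_item 2 3 ;; copy_item 2 1 ;; next_item 2) ;; Put 1 4 Move_Right ;; take_item 0 1"

definition header_word :: "nat list \<Rightarrow> nat \<Rightarrow> nat list" where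
  "header_word cs p = items (map cand cs) @ [4] @ cand p @ [3]"

definition header_time :: "nat \<Rightarrow> nat" where
  "header_time N = N * (4 * N + 6) + foreach_time N (14 * N + 30) + 4 * N + 30"

lemma runs_header:
  assumes w: "word_symbols w = header_word cs p @ r"
    and fits: "fits N (map cand cs)" "fits1 N (cand p)"
  shows "runs header (header_time N) (initial_state 10 w)
    (conf (rev (header_word cs p), r) (header_word cs p) (cand_tape cs []) (cand_tape cs [])
      empty_tape empty_tape empty_tape)"
proof -
  let ?i0 = "([], word_symbols w)" and ?z = "([], []) :: zipper"
  let ?i1 = "(rev (items (map cand cs) @ [4]), cand p @ 3 # r)"
  have init: "initial_state 10 w = [?i0, ?z, ?z, ?z, ?z, ?z, ?z, ?z, ?z, ?z]"
    by (simp add: initial_state_def numeral_eq_Suc)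
  have "runs (Put 2 5 Move_Right) 1 [?i0, ?z, ?z, ?z, ?z, ?z, ?z, ?z, ?z, ?z]
      [?i0, ?z, empty_tape, ?z, ?z, ?z, ?z, ?z, ?z, ?z]"
    by (rule runs_Put) (simp add: empty_tape)
  moreover have "runs (Put 3 5 Move_Right) 1 [?i0, ?z, empty_tape, ?z, ?z, ?z, ?z, ?z, ?z, ?z]
      [?i0, ?z, empty_tape, empty_tape, ?z, ?z, ?z, ?z, ?z, ?z]"
    by (rule runs_Put) (simp add: empty_tape)
  moreover have "runs (Put 4 5 Move_Right) 1 [?i0, ?z, empty_tape, empty_tape, ?z, ?z, ?z, ?z, ?z, ?z]
      [?i0, ?z, empty_tape, empty_tape, empty_tape, ?z, ?z, ?z, ?z, ?z]"
    by (rule runs_Put) (simp add: empty_tape)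
  moreover have "runs (Put 5 5 Move_Right) 1 [?i0, ?z, empty_tape, empty_tape, empty_tape, ?z, ?z, ?z, ?z, ?z]
      [?i0, ?z, empty_tape, empty_tape, empty_tape, empty_tape, ?z, ?z, ?z, ?z]"
    by (rule runs_Put) (simp add: empty_tape)
  moreover have "runs (Put 6 5 Move_Right) 1 [?i0, ?z, empty_tape, empty_tape, empty_tape, empty_tape, ?z, ?z, ?z, ?z]
      (conf ?i0 [] empty_tape empty_tape empty_tape empty_tape empty_tape)"
    by (rule runs_Put) (simp add: empty_tape flag_False)
  moreover have "runs (take_items 2) (N * (4 * N + 6) + 3) (conf ?i0 [] empty_tape empty_tape empty_tape empty_tape empty_tape)
      (conf ?i1 [] (cand_tape cs []) empty_tape empty_tape empty_tape empty_tape)"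
    by (rule runs_weaken, rule runs_take_items[where ws = "map cand cs" and a = "[]" and r = "cand p @ 3 # r" and L = "[]" and N = N])
      (use fits w in \<open>auto simp: header_word_def\<close>)
  moreover have "runs (foreach 2 (copy_item 2 3 ;; copy_item 2 1 ;; next_item 2)) (foreach_time N (14 * N + 30))
      (conf ?i1 [] (cand_tape cs []) empty_tape empty_tape empty_tape empty_tape)
      (conf ?i1 (items (map cand cs)) (cand_tape cs []) (cand_tape cs []) empty_tape empty_tape empty_tape)"
  proof (rule runs_foreach[where xs = cs and pre = "map cand cs" and post = "[]" and
      S = "\<lambda>L R. conf ?i1 (items (map cand L)) (cand_tape L R) (cand_tape L []) empty_tape empty_tape empty_tape"])
    fix L x R assume "L @ x # R = cs"
    then have x: "fits1 N (cand x)" using fits_fits1[OF fits(1)] by auto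
    have "runs (copy_item 2 3) (6 * N + 9)
        (conf ?i1 (items (map cand L)) (cand_tape L (x # R)) (cand_tape L []) empty_tape empty_tape empty_tape)
        (conf ?i1 (items (map cand L)) (cand_tape L (x # R)) (cand_tape (L @ [x]) []) empty_tape empty_tape empty_tape)"
      by (rule runs_weaken, rule runs_copy_item_append[where L = "map cand L" and w = "cand x" and R = "map cand R" and ws = "map cand L" and N = N])
        (use x in auto)
    moreover have "runs (copy_item 2 1) (6 * N + 9)
        (conf ?i1 (items (map cand L)) (cand_tape L (x # R)) (cand_tape (L @ [x]) []) empty_tape empty_tape empty_tape)
        (conf ?i1 (items (map cand (L @ [x]))) (cand_tape L (x # R)) (cand_tape (L @ [x]) []) empty_tape empty_tape empty_tape)"
      by (rule runs_weaken, rule runs_copy_item_output[where L = "map cand L" and w = "cand x" and R = "map cand R"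
            and xs = "items (map cand L)" and N = N])
        (use x in auto)
    moreover have "runs (next_item 2) (2 * N + 3)
        (conf ?i1 (items (map cand (L @ [x]))) (cand_tape L (x # R)) (cand_tape (L @ [x]) []) empty_tape empty_tape empty_tape)
        (conf ?i1 (items (map cand (L @ [x]))) (cand_tape (L @ [x]) R) (cand_tape (L @ [x]) []) empty_tape empty_tape empty_tape)"
      by (rule runs_weaken, rule runs_next_item_tape[where L = "map cand L" and w = "cand x" and R = "map cand R" and N = N])
        (use x in auto)
    ultimately have "runs (copy_item 2 3 ;; copy_item 2 1 ;; next_item 2) (6 * N + 9 + (6 * N + 9 + (2 * N + 3) + 1) + 1)
        (conf ?i1 (items (map cand L)) (cand_tape L (x # R)) (cand_tape L []) empty_tape empty_tape empty_tape)
        (conf ?i1 (items (map cand (L @ [x]))) (cand_tape (L @ [x]) R) (cand_tape (L @ [x]) []) empty_tape empty_tape empty_tape)"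
      by (intro runs_Seq)
    then show "runs (copy_item 2 3 ;; copy_item 2 1 ;; next_item 2) (14 * N + 30)
        (conf ?i1 (items (map cand L)) (cand_tape L (x # R)) (cand_tape L []) empty_tape empty_tape empty_tape)
        (conf ?i1 (items (map cand (L @ [x]))) (cand_tape (L @ [x]) R) (cand_tape (L @ [x]) []) empty_tape empty_tape empty_tape)"
      by (rule runs_weaken) auto
  qed (use fits fits_length[OF fits(1)] in auto)
  moreover have "runs (Put 1 4 Move_Right) 1
      (conf ?i1 (items (map cand cs)) (cand_tape cs []) (cand_tape cs []) empty_tape empty_tape empty_tape)
      (conf ?i1 (items (map cand cs) @ [4]) (cand_tape cs []) (cand_tape cs []) empty_tape empty_tape empty_tape)"
    by (rule runs_Put) simp
  moreover have "runs (take_item 0 1) (4 * N + 5)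
      (conf ?i1 (items (map cand cs) @ [4]) (cand_tape cs []) (cand_tape cs []) empty_tape empty_tape empty_tape)
      (conf (rev (header_word cs p), r) (header_word cs p) (cand_tape cs []) (cand_tape cs []) empty_tape empty_tape empty_tape)"
    by (rule runs_weaken, rule runs_take_item[where w = "cand p" and a = "rev (items (map cand cs) @ [4])" and r = r and b = "rev (items (map cand cs) @ [4])"])
      (use fits in \<open>auto simp: header_word_def fits1_def\<close>)
  ultimately have "runs header (1 + (1 + (1 + (1 + (1 + (N * (4 * N + 6) + 3 + (foreach_time N (14 * N + 30) + (1 + (4 * N + 5) + 1)
      + 1) + 1) + 1) + 1) + 1) + 1) + 1)
      (initial_state 10 w)
      (conf (rev (header_word cs p), r) (header_word cs p) (cand_tape cs []) (cand_tape cs []) empty_tape empty_tape empty_tape)"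
    unfolding init header_def by (intro runs_Seq)
  then show ?thesis
    by (rule runs_weaken) (auto simp: header_time_def)
qed

section \<open>The program for the transitive closure\<close>

definition pair_word :: "(nat \<times> nat) list \<Rightarrow> nat list" where
  "pair_word ps = items (concat (map (\<lambda>(a, b). [cand a, cand b]) ps))"

lemma pair_word_append [simp]:
  "pair_word (ps @ qs) = pair_word ps @ pair_word qs" "pair_word [] = []"
  "pair_word ((a, b) # ps) = cand a @ 3 # cand b @ 3 # pair_word ps"
  by (simp_all add: pair_word_def)

text \<open>An edge is followed only if its source was visited earlier in \<open>v\<close>. This
  restricts the constraints to pairs that \<open>v\<close> ranks in the direction of the edge,
  without any comparison of ranks.\<close>

definition reach :: "(nat \<times> nat \<times> bool) list \<Rightarrow> nat \<Rightarrow> nat list \<Rightarrow> nat list" where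
  "reach es a v = foldl (\<lambda>ys x. if x = a \<or> hit True es ys x then ys @ [x] else ys) [] v"

text \<open>The candidates found form a subsequence of \<open>v\<close>.\<close>

lemma fits_reach: "fits N (map cand v) \<Longrightarrow> fits N (map cand (reach es a v))"
proof -
  have "length (items (map cand (reach es a v))) \<le> length (items (map cand v))"
    by (induction v rule: rev_induct) (auto simp: reach_def)
  then show "fits N (map cand v) \<Longrightarrow> fits N (map cand (reach es a v))"
    by (auto simp: fits_def)
qed

definition reach_step :: com where
  "reach_step = scan True 4 ;; compare 4 2 8 ;;
     Cond (\<lambda>rs. rs ! 8 = 1 \<or> rs ! 9 = 1) (copy_item 4 6) skip ;;
     set_flag 8 (\<lambda>_. False) ;; set_flag 9 (\<lambda>_. False) ;; next_item 4"

definition reach_time :: "nat \<Rightarrow> nat" where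
  "reach_time N = foreach_time N (scan_time N + 16 * N + 50)"

lemma runs_reach:
  assumes a: "fits1 N (cand a)" and v: "fits N (map cand v)" and es: "fits N (concat (map edge_items es))"
  shows "runs (foreach 4 reach_step) (reach_time N)
    (conf i out (cand_tape A (a # B)) d (cand_tape v []) (edge_tape es []) empty_tape)
    (conf i out (cand_tape A (a # B)) d (cand_tape v []) (edge_tape es []) (cand_tape (reach es a v) []))"
  unfolding reach_time_def
proof (rule runs_foreach[where xs = v and pre = "map cand v" and post = "[]" and
    S = "\<lambda>L R. conf i out (cand_tape A (a # B)) d (cand_tape L R) (edge_tape es []) (cand_tape (reach es a L) [])"])
  fix L x R assume LxR: "L @ x # R = v"
  then have x: "fits1 N (cand x)" using fits_fits1[OF v] by auto
  let ?ys = "reach es a L"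
  have ys: "fits N (map cand ?ys)" by (rule fits_reach) (use LxR v fits_append[of N "map cand L" "map cand (x # R)"] in auto)
  let ?s = "\<lambda>V t f g. [i, (rev out, []), cand_tape A (a # B), d, V, edge_tape es [], cand_tape t [], flag False, flag f, flag g]"
  let ?h = "hit True es ?ys x"
  have "runs (scan True 4) (scan_time N) (?s (cand_tape L (x # R)) ?ys False False) (?s (cand_tape L (x # R)) ?ys False ?h)"
    by (rule runs_weaken, rule runs_scan[where ?A0.0 = "map cand L" and x = x and ?B0.0 = "map cand R" and es = es and ys = ?ys and b = False and N = N])
      (use x ys es in auto)
  moreover have "runs (compare 4 2 8) (8 * N + 18) (?s (cand_tape L (x # R)) ?ys False ?h) (?s (cand_tape L (x # R)) ?ys (x = a) ?h)"
    by (rule runs_weaken, rule runs_compare_items[where w = "cand x" and w' = "cand a" and L = "map cand L" and R = "map cand R"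
          and L' = "map cand A" and R' = "map cand B" and N = N and b = False])
      (use x a in auto)
  moreover have "runs (Cond (\<lambda>rs. rs ! 8 = 1 \<or> rs ! 9 = 1) (copy_item 4 6) skip) (6 * N + 9 + 2)
      (?s (cand_tape L (x # R)) ?ys (x = a) ?h) (?s (cand_tape L (x # R)) (reach es a (L @ [x])) (x = a) ?h)"
  proof (rule runs_when)
    assume "reads (?s (cand_tape L (x # R)) ?ys (x = a) ?h) ! 8 = 1 \<or> reads (?s (cand_tape L (x # R)) ?ys (x = a) ?h) ! 9 = 1"
    then have "x = a \<or> ?h" by (auto split: if_splits)
    then have "reach es a (L @ [x]) = ?ys @ [x]" by (auto simp: reach_def)
    then show "runs (copy_item 4 6) (6 * N + 9)
        (?s (cand_tape L (x # R)) ?ys (x = a) ?h) (?s (cand_tape L (x # R)) (reach es a (L @ [x])) (x = a) ?h)"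
      by (intro runs_weaken[OF runs_copy_item_append[where w = "cand x" and L = "map cand L" and R = "map cand R" and ws = "map cand ?ys" and N = N]])
        (use x in auto)
  next
    assume "\<not> (reads (?s (cand_tape L (x # R)) ?ys (x = a) ?h) ! 8 = 1 \<or> reads (?s (cand_tape L (x # R)) ?ys (x = a) ?h) ! 9 = 1)"
    then have "\<not> (x = a \<or> ?h)" by (auto split: if_splits)
    then show "?s (cand_tape L (x # R)) ?ys (x = a) ?h = ?s (cand_tape L (x # R)) (reach es a (L @ [x])) (x = a) ?h"
      by (auto simp: reach_def)
  qed
  moreover have "runs (set_flag 8 (\<lambda>_. False)) 2 (?s (cand_tape L (x # R)) (reach es a (L @ [x])) (x = a) ?h)
      (?s (cand_tape L (x # R)) (reach es a (L @ [x])) False ?h)"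
    by (rule runs_weaken, rule runs_set_flag[where ?b0.0 = "x = a"]) auto
  moreover have "runs (set_flag 9 (\<lambda>_. False)) 2 (?s (cand_tape L (x # R)) (reach es a (L @ [x])) False ?h)
      (?s (cand_tape L (x # R)) (reach es a (L @ [x])) False False)"
    by (rule runs_weaken, rule runs_set_flag[where ?b0.0 = ?h]) auto
  moreover have "runs (next_item 4) (2 * N + 3) (?s (cand_tape L (x # R)) (reach es a (L @ [x])) False False)
      (?s (cand_tape (L @ [x]) R) (reach es a (L @ [x])) False False)"
    by (rule runs_weaken, rule runs_next_item_tape[where L = "map cand L" and w = "cand x" and R = "map cand R" and N = N])
      (use x in auto)
  ultimately have "runs reach_step (scan_time N + (8 * N + 18 + (6 * N + 9 + 2 + (2 + (2 + (2 * N + 3) + 1) + 1) + 1) + 1) + 1)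
      (?s (cand_tape L (x # R)) ?ys False False) (?s (cand_tape (L @ [x]) R) (reach es a (L @ [x])) False False)"
    unfolding reach_step_def by (intro runs_Seq)
  then show "runs reach_step (scan_time N + 16 * N + 50)
      (?s (cand_tape L (x # R)) ?ys False False) (?s (cand_tape (L @ [x]) R) (reach es a (L @ [x])) False False)"
    by (rule runs_weaken) auto
qed (use v fits_length[OF v] in \<open>auto simp: reach_def\<close>)

text \<open>\<open>reach\<close> also lists \<open>a\<close> itself; excluding it turns the
  reflexive transitive closure into the transitive one, since the constraints are acyclic.\<close>

definition row :: "nat list \<Rightarrow> nat \<Rightarrow> nat list \<Rightarrow> (nat \<times> nat) list" where
  "row ys a cs = concat (map (\<lambda>b. if b \<in> set ys \<and> b \<noteq> a then [(a, b)] else []) cs)"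

definition row_step :: com where
  "row_step = member 3 ;; compare 3 2 8 ;;
     Cond (\<lambda>rs. rs ! 7 = 1 \<and> rs ! 8 \<noteq> 1) (copy_item 2 1 ;; copy_item 3 1) skip ;;
     set_flag 7 (\<lambda>_. False) ;; set_flag 8 (\<lambda>_. False) ;; next_item 3"

definition row_time :: "nat \<Rightarrow> nat" where
  "row_time N = foreach_time N (member_time N + 22 * N + 60)"

lemma runs_row:
  assumes a: "fits1 N (cand a)" and cs: "fits N (map cand cs)" and ys: "fits N (map cand ys)"
  shows "runs (foreach 3 row_step) (row_time N)
    (conf i out (cand_tape A (a # B)) (cand_tape cs []) v e (cand_tape ys []))
    (conf i (out @ pair_word (row ys a cs)) (cand_tape A (a # B)) (cand_tape cs []) v e (cand_tape ys []))"
  unfolding row_time_def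
proof (rule runs_foreach[where xs = cs and pre = "map cand cs" and post = "[]" and
    S = "\<lambda>L R. conf i (out @ pair_word (row ys a L)) (cand_tape A (a # B)) (cand_tape L R) v e (cand_tape ys [])"])
  fix L x R assume LxR: "L @ x # R = cs"
  then have x: "fits1 N (cand x)" using fits_fits1[OF cs] by auto
  let ?s = "\<lambda>p D f g. [i, (rev (out @ p), []), cand_tape A (a # B), D, v, e, cand_tape ys [], flag f, flag g, flag False]"
  let ?D = "cand_tape L (x # R)" and ?D' = "cand_tape (L @ [x]) R"
  let ?p = "pair_word (row ys a L)" and ?p' = "pair_word (row ys a (L @ [x]))"
  let ?f = "x \<in> set ys" and ?g = "x = a"
  have "runs (member 3) (member_time N) (?s ?p ?D False False) (?s ?p ?D ?f False)"
    by (rule runs_weaken, rule runs_member[where L = "map cand L" and w = "cand x" and R = "map cand R" and ws = "map cand ys" and b = False and N = N])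
      (use x ys in auto)
  moreover have "runs (compare 3 2 8) (8 * N + 18) (?s ?p ?D ?f False) (?s ?p ?D ?f ?g)"
    by (rule runs_weaken, rule runs_compare_items[where w = "cand x" and w' = "cand a" and L = "map cand L" and R = "map cand R"
          and L' = "map cand A" and R' = "map cand B" and N = N and b = False])
      (use x a in auto)
  moreover have "runs (Cond (\<lambda>rs. rs ! 7 = 1 \<and> rs ! 8 \<noteq> 1) (copy_item 2 1 ;; copy_item 3 1) skip) (6 * N + 9 + (6 * N + 9) + 1 + 2)
      (?s ?p ?D ?f ?g) (?s ?p' ?D ?f ?g)"
  proof (rule runs_when)
    assume "reads (?s ?p ?D ?f ?g) ! 7 = 1 \<and> reads (?s ?p ?D ?f ?g) ! 8 \<noteq> 1"
    then have "?f \<and> \<not> ?g" by (auto split: if_splits)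
    then have p': "?p' = ?p @ cand a @ [3] @ cand x @ [3]" by (auto simp: row_def)
    have "runs (copy_item 2 1) (6 * N + 9) (?s ?p ?D ?f ?g) (?s (?p @ cand a @ [3]) ?D ?f ?g)"
      by (rule runs_weaken, rule runs_copy_item_output[where w = "cand a" and L = "map cand A" and R = "map cand B" and xs = "out @ ?p" and N = N])
        (use a in auto)
    moreover have "runs (copy_item 3 1) (6 * N + 9) (?s (?p @ cand a @ [3]) ?D ?f ?g) (?s ?p' ?D ?f ?g)"
      by (rule runs_weaken, rule runs_copy_item_output[where w = "cand x" and L = "map cand L" and R = "map cand R"
            and xs = "out @ ?p @ cand a @ [3]" and N = N])
        (use x in \<open>auto simp: p'\<close>)
    ultimately show "runs (copy_item 2 1 ;; copy_item 3 1) (6 * N + 9 + (6 * N + 9) + 1) (?s ?p ?D ?f ?g) (?s ?p' ?D ?f ?g)"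
      by (rule runs_Seq)
  next
    assume "\<not> (reads (?s ?p ?D ?f ?g) ! 7 = 1 \<and> reads (?s ?p ?D ?f ?g) ! 8 \<noteq> 1)"
    then have "\<not> (?f \<and> \<not> ?g)" by (auto split: if_splits)
    then show "?s ?p ?D ?f ?g = ?s ?p' ?D ?f ?g" by (auto simp: row_def)
  qed
  moreover have "runs (set_flag 7 (\<lambda>_. False)) 2 (?s ?p' ?D ?f ?g) (?s ?p' ?D False ?g)"
    by (rule runs_weaken, rule runs_set_flag[where ?b0.0 = ?f]) auto
  moreover have "runs (set_flag 8 (\<lambda>_. False)) 2 (?s ?p' ?D False ?g) (?s ?p' ?D False False)"
    by (rule runs_weaken, rule runs_set_flag[where ?b0.0 = ?g]) auto
  moreover have "runs (next_item 3) (2 * N + 3) (?s ?p' ?D False False) (?s ?p' ?D' False False)"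
    by (rule runs_weaken, rule runs_next_item_tape[where L = "map cand L" and w = "cand x" and R = "map cand R" and N = N])
      (use x in auto)
  ultimately have "runs row_step (member_time N + (8 * N + 18 + (6 * N + 9 + (6 * N + 9) + 1 + 2 + (2 + (2 + (2 * N + 3) + 1) + 1) + 1) + 1) + 1)
      (?s ?p ?D False False) (?s ?p' ?D' False False)"
    unfolding row_step_def by (intro runs_Seq)
  then show "runs row_step (member_time N + 22 * N + 60) (?s ?p ?D False False) (?s ?p' ?D' False False)"
    by (rule runs_weaken) auto
qed (use cs fits_length[OF cs] in \<open>auto simp: row_def\<close>)

definition closure_word :: "nat list \<Rightarrow> nat list \<Rightarrow> (nat \<times> nat \<times> bool) list \<Rightarrow> nat list" where
  "closure_word cs v es = pair_word (concat (map (\<lambda>a. row (reach es a v) a cs) cs)) @ [4]"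

definition closure_input :: "nat list \<times> (nat \<times> nat \<times> bool) list \<Rightarrow> nat list" where
  "closure_input b = (case b of (v, es) \<Rightarrow> items (map cand v) @ 4 # items (concat (map edge_items es)) @ [4])"

text \<open>The vote goes to tape 4 and the cost triples to tape 5. The loops over tapes 2 and 3
  follow the candidate list, so the pairs come out in the order of \<open>candidate_pairs\<close>,
  as the encoding demands.\<close>

definition closure_block :: com where
  "closure_block = take_items 4 ;; take_items 5 ;;
     foreach 2 (foreach 4 reach_step ;; foreach 3 row_step ;; clear 6 ;; next_item 2) ;;
     Put 1 4 Move_Right ;; clear 4 ;; clear 5"

definition closure_time :: "nat \<Rightarrow> nat" where
  "closure_time N = 2 * (N * (4 * N + 6)) + foreach_time N (reach_time N + row_time N + 4 * N + 20) + 4 * N + 30"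

lemma runs_closure_block:
  assumes cs: "fits N (map cand cs)" and v: "fits N (map cand v)" and es: "fits N (concat (map edge_items es))"
  shows "runs closure_block (closure_time N)
    (conf (il, closure_input (v, es) @ r) out (cand_tape cs []) (cand_tape cs []) empty_tape empty_tape empty_tape)
    (conf (rev (closure_input (v, es)) @ il, r) (out @ closure_word cs v es) (cand_tape cs []) (cand_tape cs []) empty_tape empty_tape empty_tape)"
proof -
  let ?C = "cand_tape cs []" and ?V = "cand_tape v []" and ?E = "edge_tape es []"
  let ?vi = "items (map cand v) @ [4]" and ?ei = "items (concat (map edge_items es)) @ [4]"
  let ?i0 = "(il, closure_input (v, es) @ r)"
  let ?i1 = "(rev ?vi @ il, ?ei @ r)"
  let ?i2 = "(rev ?ei @ rev ?vi @ il, r)"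
  let ?p = "\<lambda>L. pair_word (concat (map (\<lambda>a. row (reach es a v) a cs) L))"
  have "runs (take_items 4) (N * (4 * N + 6) + 3) (conf ?i0 out ?C ?C empty_tape empty_tape empty_tape)
      (conf ?i1 out ?C ?C ?V empty_tape empty_tape)"
    by (rule runs_weaken, rule runs_take_items[where ws = "map cand v" and a = il and r = "?ei @ r" and L = "[]" and N = N])
      (use v in \<open>auto simp: closure_input_def\<close>)
  moreover have "runs (take_items 5) (N * (4 * N + 6) + 3) (conf ?i1 out ?C ?C ?V empty_tape empty_tape)
      (conf ?i2 out ?C ?C ?V ?E empty_tape)"
    by (rule runs_weaken, rule runs_take_items[where ws = "concat (map edge_items es)" and a = "rev ?vi @ il" and r = r and L = "[]" and N = N])
      (use es in auto)
  moreover have "runs (foreach 2 (foreach 4 reach_step ;; foreach 3 row_step ;; clear 6 ;; next_item 2))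
      (foreach_time N (reach_time N + row_time N + 4 * N + 20))
      (conf ?i2 out ?C ?C ?V ?E empty_tape) (conf ?i2 (out @ ?p cs) ?C ?C ?V ?E empty_tape)"
  proof (rule runs_foreach[where xs = cs and pre = "map cand cs" and post = "[]" and
      S = "\<lambda>L R. conf ?i2 (out @ ?p L) (cand_tape L R) ?C ?V ?E empty_tape"])
    fix L a R assume LxR: "L @ a # R = cs"
    then have a: "fits1 N (cand a)" using fits_fits1[OF cs] by auto
    let ?A = "cand_tape L (a # R)" and ?Y = "cand_tape (reach es a v) []"
    have ys: "fits N (map cand (reach es a v))" by (rule fits_reach[OF v])
    have "runs (foreach 4 reach_step) (reach_time N) (conf ?i2 (out @ ?p L) ?A ?C ?V ?E empty_tape)
        (conf ?i2 (out @ ?p L) ?A ?C ?V ?E ?Y)"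
      by (rule runs_reach[OF a v es])
    moreover have "runs (foreach 3 row_step) (row_time N) (conf ?i2 (out @ ?p L) ?A ?C ?V ?E ?Y)
        (conf ?i2 (out @ ?p (L @ [a])) ?A ?C ?V ?E ?Y)"
      using runs_row[OF a cs ys, of ?i2 "out @ ?p L" L R ?V ?E] by simp
    moreover have "runs (clear 6) (2 * N + 5) (conf ?i2 (out @ ?p (L @ [a])) ?A ?C ?V ?E ?Y)
        (conf ?i2 (out @ ?p (L @ [a])) ?A ?C ?V ?E empty_tape)"
      by (rule runs_weaken, rule runs_clear_items[OF _ _ ys]) auto
    moreover have "runs (next_item 2) (2 * N + 3) (conf ?i2 (out @ ?p (L @ [a])) ?A ?C ?V ?E empty_tape)
        (conf ?i2 (out @ ?p (L @ [a])) (cand_tape (L @ [a]) R) ?C ?V ?E empty_tape)"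
      by (rule runs_weaken, rule runs_next_item_tape[where L = "map cand L" and w = "cand a" and R = "map cand R" and N = N])
        (use a in auto)
    ultimately have "runs (foreach 4 reach_step ;; foreach 3 row_step ;; clear 6 ;; next_item 2)
        (reach_time N + (row_time N + (2 * N + 5 + (2 * N + 3) + 1) + 1) + 1)
        (conf ?i2 (out @ ?p L) ?A ?C ?V ?E empty_tape)
        (conf ?i2 (out @ ?p (L @ [a])) (cand_tape (L @ [a]) R) ?C ?V ?E empty_tape)"
      by (intro runs_Seq)
    then show "runs (foreach 4 reach_step ;; foreach 3 row_step ;; clear 6 ;; next_item 2)
        (reach_time N + row_time N + 4 * N + 20)
        (conf ?i2 (out @ ?p L) ?A ?C ?V ?E empty_tape)
        (conf ?i2 (out @ ?p (L @ [a])) (cand_tape (L @ [a]) R) ?C ?V ?E empty_tape)"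
      by (rule runs_weaken) auto
  qed (use cs fits_length[OF cs] in auto)
  moreover have "runs (Put 1 4 Move_Right) 1 (conf ?i2 (out @ ?p cs) ?C ?C ?V ?E empty_tape)
      (conf ?i2 (out @ closure_word cs v es) ?C ?C ?V ?E empty_tape)"
    by (rule runs_Put) (simp add: closure_word_def)
  moreover have "runs (clear 4) (2 * N + 5) (conf ?i2 (out @ closure_word cs v es) ?C ?C ?V ?E empty_tape)
      (conf ?i2 (out @ closure_word cs v es) ?C ?C empty_tape ?E empty_tape)"
    by (rule runs_weaken, rule runs_clear_items[OF _ _ v]) auto
  moreover have "runs (clear 5) (2 * N + 5) (conf ?i2 (out @ closure_word cs v es) ?C ?C empty_tape ?E empty_tape)
      (conf ?i2 (out @ closure_word cs v es) ?C ?C empty_tape empty_tape empty_tape)"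
    by (rule runs_weaken, rule runs_clear_items[OF _ _ es]) auto
  ultimately have "runs closure_block (N * (4 * N + 6) + 3 + (N * (4 * N + 6) + 3 +
      (foreach_time N (reach_time N + row_time N + 4 * N + 20) + (1 + (2 * N + 5 + (2 * N + 5) + 1) + 1) + 1) + 1) + 1)
      (conf ?i0 out ?C ?C empty_tape empty_tape empty_tape)
      (conf ?i2 (out @ closure_word cs v es) ?C ?C empty_tape empty_tape empty_tape)"
    unfolding closure_block_def by (intro runs_Seq)
  then show ?thesis
    by (rule runs_weaken) (auto simp: closure_time_def closure_input_def)
qed

text \<open>The two moves skip the bit and the comma of the budget, which have no counterpart in the
  output.\<close>

definition closure_program :: com where
  "closure_program = header ;; go 0 Move_Right ;; go 0 Move_Right ;; Loop (\<lambda>rs. rs ! 0 \<noteq> 0) closure_block"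

definition closure_program_time :: "nat \<Rightarrow> nat" where
  "closure_program_time N = header_time N + N * (closure_time N + 1) + 10"

text \<open>Even an empty vote leaves its semicolon, so no block starts with a blank and the blank
  behind the input reliably ends the loop.\<close>

lemma closure_input_read: "0 < zip_read (l, closure_input b @ r)"
proof -
  obtain v es where b: "b = (v, es)" by (cases b)
  show ?thesis using zip_read_item(1)[of "cand (hd v)" l] by (cases v) (auto simp: b closure_input_def)
qed

lemma runs_closure_program:
  assumes w: "word_symbols w = header_word cs p @ [x, y] @ concat (map closure_input bs)"
    and fits: "fits N (map cand cs)" "fits1 N (cand p)" "length bs \<le> N"
    and blocks: "\<And>v es. (v, es) \<in> set bs \<Longrightarrow> fits N (map cand v) \<and> fits N (concat (map edge_items es))"
  shows "\<exists>s. runs closure_program (closure_program_time N) (initial_state 10 w) s \<and>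
    s ! 1 = (rev (header_word cs p @ concat (map (\<lambda>(v, es). closure_word cs v es) bs)), [])"
proof -
  let ?C = "cand_tape cs []"
  let ?h = "header_word cs p"
  let ?in = "\<lambda>bs. concat (map closure_input bs)"
  let ?out = "\<lambda>bs. ?h @ concat (map (\<lambda>(v, es). closure_word cs v es) bs)"
  let ?S = "\<lambda>L R. conf (rev (?in L) @ y # x # rev ?h, ?in R) (?out L) ?C ?C empty_tape empty_tape empty_tape"
  have "runs header (header_time N) (initial_state 10 w)
      (conf (rev ?h, [x, y] @ ?in bs) ?h ?C ?C empty_tape empty_tape empty_tape)"
    by (rule runs_header[OF w fits(1,2)])
  moreover have "runs (go 0 Move_Right) 1 (conf (rev ?h, [x, y] @ ?in bs) ?h ?C ?C empty_tape empty_tape empty_tape)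
      (conf (x # rev ?h, y # ?in bs) ?h ?C ?C empty_tape empty_tape empty_tape)"
    by (rule runs_Transfer) simp
  moreover have "runs (go 0 Move_Right) 1 (conf (x # rev ?h, y # ?in bs) ?h ?C ?C empty_tape empty_tape empty_tape)
      (?S [] bs)"
    by (rule runs_Transfer) simp
  moreover have "runs (Loop (\<lambda>rs. rs ! 0 \<noteq> 0) closure_block) (length bs * (closure_time N + 1) + 1) (?S [] bs) (?S bs [])"
  proof (rule runs_Loop_list)
    fix L b R assume LbR: "L @ b # R = bs"
    obtain v es where b: "b = (v, es)" by (cases b)
    have "fits N (map cand v)" "fits N (concat (map edge_items es))" using blocks[of v es] LbR b by auto
    from runs_closure_block[OF fits(1) this, of "rev (?in L) @ y # x # rev ?h" "?in R" "?out L"]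
    show "runs closure_block (closure_time N) (?S L (b # R)) (?S (L @ [b]) R)"
      by (simp add: b)
    show "reads (?S L (b # R)) ! 0 \<noteq> 0" using closure_input_read[of _ b "?in R"] by simp
  qed simp
  ultimately have "runs closure_program (header_time N + (1 + (1 + (length bs * (closure_time N + 1) + 1) + 1) + 1) + 1)
      (initial_state 10 w) (?S bs [])"
    unfolding closure_program_def by (intro runs_Seq)
  then have "runs closure_program (closure_program_time N) (initial_state 10 w) (?S bs [])"
    by (rule runs_weaken)
      (use mult_le_mono1[OF fits(3), of "closure_time N + 1"] in \<open>auto simp: closure_program_time_def\<close>)
  then show ?thesis by (intro exI[of _ "?S bs []"]) simp
qed

section \<open>The program for the topological sort\<close>

lemma length_items: "length (items ws) = (\<Sum>w\<leftarrow>ws. length w + 1)"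
  by (induction ws) auto

text \<open>The list built by the sort need not be a subsequence of \<open>cs\<close>; both lengths
  are therefore compared as sums over sets of candidates.\<close>

lemma fits_distinct_subset:
  assumes "fits N (map cand cs)" "distinct cs" "distinct ys" "set ys \<subseteq> set cs"
  shows "fits N (map cand ys)"
proof -
  let ?f = "\<lambda>c. length (cand c) + 1"
  have "length (items (map cand ys)) = sum ?f (set ys)"
    using assms(3) by (simp add: length_items comp_def flip: sum_list_distinct_conv_sum_set)
  also have "\<dots> \<le> sum ?f (set cs)"
    using assms(4) by (intro sum_mono2) auto
  also have "\<dots> = length (items (map cand cs))"
    using assms(2) by (simp add: length_items comp_def flip: sum_list_distinct_conv_sum_set)
  finally show ?thesis using assms(1) by (auto simp: fits_def)
qed

definition sort_round :: "(nat \<times> nat \<times> bool) list \<Rightarrow> nat list \<Rightarrow> nat list \<Rightarrow> nat list" where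
  "sort_round es cs ys = foldl (\<lambda>ys x. if x \<notin> set ys \<and> \<not> hit False es ys x then ys @ [x] else ys) ys cs"

text \<open>The entries of \<open>ds\<close> only count the rounds; the program uses the candidate
  list on tape 3 as this counter.\<close>

definition sort_rounds :: "(nat \<times> nat \<times> bool) list \<Rightarrow> nat list \<Rightarrow> nat list \<Rightarrow> nat list" where
  "sort_rounds es cs ds = foldl (\<lambda>ys _. sort_round es cs ys) [] ds"

lemma sort_round_subset: "distinct ys \<Longrightarrow> set ys \<subseteq> A \<Longrightarrow> set cs \<subseteq> A \<Longrightarrow>
    distinct (sort_round es cs ys) \<and> set (sort_round es cs ys) \<subseteq> A"
  by (induction cs rule: rev_induct) (auto simp: sort_round_def)

lemma sort_rounds_subset: "distinct (sort_rounds es cs ds) \<and> set (sort_rounds es cs ds) \<subseteq> set cs"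
  using sort_round_subset[where A = "set cs" and cs = cs and es = es]
  by (induction ds rule: rev_induct) (auto simp: sort_rounds_def)

definition sort_step :: com where
  "sort_step = scan False 2 ;; member 2 ;;
     Cond (\<lambda>rs. rs ! 7 \<noteq> 1 \<and> rs ! 9 \<noteq> 1) (copy_item 2 6) skip ;;
     set_flag 7 (\<lambda>_. False) ;; set_flag 9 (\<lambda>_. False) ;; next_item 2"

definition sort_time :: "nat \<Rightarrow> nat" where
  "sort_time N = foreach_time N (scan_time N + member_time N + 8 * N + 50)"

lemma runs_sort_round:
  assumes cs: "fits N (map cand cs)" "distinct cs" and ys: "distinct ys" "set ys \<subseteq> set cs"
    and es: "fits N (concat (map edge_items es))"
  shows "runs (foreach 2 sort_step) (sort_time N)
    (conf i out (cand_tape cs []) d v (edge_tape es []) (cand_tape ys []))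
    (conf i out (cand_tape cs []) d v (edge_tape es []) (cand_tape (sort_round es cs ys) []))"
  unfolding sort_time_def
proof (rule runs_foreach[where xs = cs and pre = "map cand cs" and post = "[]" and
    S = "\<lambda>L R. conf i out (cand_tape L R) d v (edge_tape es []) (cand_tape (sort_round es L ys) [])"])
  fix L x R assume LxR: "L @ x # R = cs"
  then have x: "fits1 N (cand x)" using fits_fits1[OF cs(1)] by auto
  let ?ys = "sort_round es L ys" and ?ys' = "sort_round es (L @ [x]) ys"
  have "distinct ?ys \<and> set ?ys \<subseteq> set cs"
    by (rule sort_round_subset) (use ys LxR in auto)
  then have zs: "fits N (map cand ?ys)" by (intro fits_distinct_subset[OF cs]) auto
  let ?s = "\<lambda>C t f g. [i, (rev out, []), C, d, v, edge_tape es [], cand_tape t [], flag f, flag False, flag g]"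
  let ?h = "hit False es ?ys x" and ?m = "x \<in> set ?ys"
  let ?C = "cand_tape L (x # R)" and ?C' = "cand_tape (L @ [x]) R"
  have "runs (scan False 2) (scan_time N) (?s ?C ?ys False False) (?s ?C ?ys False ?h)"
    by (rule runs_weaken, rule runs_scan[where ?A0.0 = "map cand L" and x = x and ?B0.0 = "map cand R" and es = es and ys = ?ys and b = False and N = N])
      (use x zs es in auto)
  moreover have "runs (member 2) (member_time N) (?s ?C ?ys False ?h) (?s ?C ?ys ?m ?h)"
    by (rule runs_weaken, rule runs_member[where L = "map cand L" and w = "cand x" and R = "map cand R" and ws = "map cand ?ys" and b = False and N = N])
      (use x zs in auto)
  moreover have "runs (Cond (\<lambda>rs. rs ! 7 \<noteq> 1 \<and> rs ! 9 \<noteq> 1) (copy_item 2 6) skip) (6 * N + 9 + 2)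
      (?s ?C ?ys ?m ?h) (?s ?C ?ys' ?m ?h)"
  proof (rule runs_when)
    assume "reads (?s ?C ?ys ?m ?h) ! 7 \<noteq> 1 \<and> reads (?s ?C ?ys ?m ?h) ! 9 \<noteq> 1"
    then have "\<not> ?m \<and> \<not> ?h" by (auto split: if_splits)
    then have "?ys' = ?ys @ [x]" by (auto simp: sort_round_def)
    then show "runs (copy_item 2 6) (6 * N + 9) (?s ?C ?ys ?m ?h) (?s ?C ?ys' ?m ?h)"
      by (intro runs_weaken[OF runs_copy_item_append[where w = "cand x" and L = "map cand L" and R = "map cand R" and ws = "map cand ?ys" and N = N]])
        (use x in auto)
  next
    assume "\<not> (reads (?s ?C ?ys ?m ?h) ! 7 \<noteq> 1 \<and> reads (?s ?C ?ys ?m ?h) ! 9 \<noteq> 1)"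
    then have "\<not> (\<not> ?m \<and> \<not> ?h)" by (auto split: if_splits)
    then have "?ys' = ?ys" by (auto simp: sort_round_def)
    then show "?s ?C ?ys ?m ?h = ?s ?C ?ys' ?m ?h" by simp
  qed
  moreover have "runs (set_flag 7 (\<lambda>_. False)) 2 (?s ?C ?ys' ?m ?h) (?s ?C ?ys' False ?h)"
    by (rule runs_weaken, rule runs_set_flag[where ?b0.0 = ?m]) auto
  moreover have "runs (set_flag 9 (\<lambda>_. False)) 2 (?s ?C ?ys' False ?h) (?s ?C ?ys' False False)"
    by (rule runs_weaken, rule runs_set_flag[where ?b0.0 = ?h]) auto
  moreover have "runs (next_item 2) (2 * N + 3) (?s ?C ?ys' False False) (?s ?C' ?ys' False False)"
    by (rule runs_weaken, rule runs_next_item_tape[where L = "map cand L" and w = "cand x" and R = "map cand R" and N = N])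
      (use x in auto)
  ultimately have "runs sort_step (scan_time N + (member_time N + (6 * N + 9 + 2 + (2 + (2 + (2 * N + 3) + 1) + 1) + 1) + 1) + 1)
      (?s ?C ?ys False False) (?s ?C' ?ys' False False)"
    unfolding sort_step_def by (intro runs_Seq)
  then show "runs sort_step (scan_time N + member_time N + 8 * N + 50) (?s ?C ?ys False False) (?s ?C' ?ys' False False)"
    by (rule runs_weaken) auto
qed (use cs fits_length[OF cs(1)] in \<open>auto simp: sort_round_def\<close>)

lemma runs_sort_rounds:
  assumes cs: "fits N (map cand cs)" "distinct cs" and es: "fits N (concat (map edge_items es))"
  shows "runs (foreach 3 (foreach 2 sort_step ;; next_item 3)) (foreach_time N (sort_time N + 2 * N + 10))
    (conf i out (cand_tape cs []) (cand_tape cs []) v (edge_tape es []) empty_tape)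
    (conf i out (cand_tape cs []) (cand_tape cs []) v (edge_tape es []) (cand_tape (sort_rounds es cs cs) []))"
proof (rule runs_foreach[where xs = cs and pre = "map cand cs" and post = "[]" and
    S = "\<lambda>L R. conf i out (cand_tape cs []) (cand_tape L R) v (edge_tape es []) (cand_tape (sort_rounds es cs L) [])"])
  fix L x R assume LxR: "L @ x # R = cs"
  then have x: "fits1 N (cand x)" using fits_fits1[OF cs(1)] by auto
  let ?ys = "sort_rounds es cs L" and ?ys' = "sort_rounds es cs (L @ [x])"
  let ?s = "\<lambda>D ys. conf i out (cand_tape cs []) D v (edge_tape es []) (cand_tape ys [])"
  have "runs (foreach 2 sort_step) (sort_time N) (?s (cand_tape L (x # R)) ?ys) (?s (cand_tape L (x # R)) ?ys')"
    using runs_sort_round[OF cs _ _ es, of ?ys i out "cand_tape L (x # R)" v] sort_rounds_subset[of es cs L]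
    by (simp add: sort_rounds_def)
  moreover have "runs (next_item 3) (2 * N + 3) (?s (cand_tape L (x # R)) ?ys') (?s (cand_tape (L @ [x]) R) ?ys')"
    by (rule runs_weaken, rule runs_next_item_tape[where L = "map cand L" and w = "cand x" and R = "map cand R" and N = N])
      (use x in auto)
  ultimately have "runs (foreach 2 sort_step ;; next_item 3) (sort_time N + (2 * N + 3) + 1)
      (?s (cand_tape L (x # R)) ?ys) (?s (cand_tape (L @ [x]) R) ?ys')"
    by (rule runs_Seq)
  then show "runs (foreach 2 sort_step ;; next_item 3) (sort_time N + 2 * N + 10)
      (?s (cand_tape L (x # R)) ?ys) (?s (cand_tape (L @ [x]) R) ?ys')"
    by (rule runs_weaken) auto
qed (use cs fits_length[OF cs(1)] in \<open>auto simp: sort_rounds_def\<close>)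

lemma runs_output_items:
  assumes ys: "fits N (map cand ys)"
  shows "runs (foreach 6 (copy_item 6 1 ;; next_item 6)) (foreach_time N (8 * N + 20))
    (conf i out c d v e (cand_tape ys [])) (conf i (out @ items (map cand ys)) c d v e (cand_tape ys []))"
proof (rule runs_foreach[where xs = ys and pre = "map cand ys" and post = "[]" and
    S = "\<lambda>L R. conf i (out @ items (map cand L)) c d v e (cand_tape L R)"])
  fix L x R assume LxR: "L @ x # R = ys"
  then have x: "fits1 N (cand x)" using fits_fits1[OF ys] by auto
  let ?s = "\<lambda>xs t. conf i (out @ items (map cand xs)) c d v e t"
  have "runs (copy_item 6 1) (6 * N + 9) (?s L (cand_tape L (x # R))) (?s (L @ [x]) (cand_tape L (x # R)))"
    by (rule runs_weaken, rule runs_copy_item_output[where w = "cand x" and L = "map cand L" and R = "map cand R"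
          and xs = "out @ items (map cand L)" and N = N])
      (use x in auto)
  moreover have "runs (next_item 6) (2 * N + 3) (?s (L @ [x]) (cand_tape L (x # R))) (?s (L @ [x]) (cand_tape (L @ [x]) R))"
    by (rule runs_weaken, rule runs_next_item_tape[where L = "map cand L" and w = "cand x" and R = "map cand R" and N = N])
      (use x in auto)
  ultimately have "runs (copy_item 6 1 ;; next_item 6) (6 * N + 9 + (2 * N + 3) + 1)
      (?s L (cand_tape L (x # R))) (?s (L @ [x]) (cand_tape (L @ [x]) R))"
    by (rule runs_Seq)
  then show "runs (copy_item 6 1 ;; next_item 6) (8 * N + 20)
      (?s L (cand_tape L (x # R))) (?s (L @ [x]) (cand_tape (L @ [x]) R))"
    by (rule runs_weaken) auto
qed (use ys fits_length[OF ys] in auto)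

section \<open>The cost table of a partial vote\<close>

definition edge_word :: "(nat \<times> nat \<times> bool) list \<Rightarrow> nat list" where
  "edge_word es = items (concat (map edge_items es))"

lemma edge_word_append [simp]:
  "edge_word [] = []" "edge_word (es @ es') = edge_word es @ edge_word es'"
  "edge_word ((a, b, c) # es) = cand a @ 3 # cand b @ 3 # (if c then 2 else 1) # 3 # edge_word es"
  by (simp_all add: edge_word_def)

definition cost_row :: "(nat \<times> nat \<times> bool) list \<Rightarrow> nat \<Rightarrow> nat list \<Rightarrow> (nat \<times> nat \<times> bool) list" where
  "cost_row es a cs = concat (map (\<lambda>b. if a = b then [] else [(a, b, hit True es [a] b)]) cs)"

text \<open>The lookup of the pair reuses \<open>scan\<close>: tape 6, already emptied of the linear
  order, holds just the candidate under the head of tape 2 during the search.\<close>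

definition cost_entry :: com where
  "cost_entry = copy_item 2 1 ;; copy_item 3 1 ;; copy_item 2 6 ;; scan True 3 ;;
     Cond (\<lambda>rs. rs ! 9 = 1) (Put 1 2 Move_Right) (Put 1 1 Move_Right) ;; Put 1 3 Move_Right ;;
     clear 6 ;; set_flag 9 (\<lambda>_. False)"

definition cost_step :: com where
  "cost_step = compare 2 3 8 ;; Cond (\<lambda>rs. rs ! 8 \<noteq> 1) cost_entry skip ;;
     set_flag 8 (\<lambda>_. False) ;; next_item 3"

definition cost_time :: "nat \<Rightarrow> nat" where
  "cost_time N = foreach_time N (scan_time N + 30 * N + 100)"

lemma runs_cost_row:
  assumes a: "fits N [cand a]" and cs: "fits N (map cand cs)" and es: "fits N (concat (map edge_items es))"
  shows "runs (foreach 3 cost_step) (cost_time N)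
    (conf i out (cand_tape A (a # B)) (cand_tape cs []) v (edge_tape es []) empty_tape)
    (conf i (out @ edge_word (cost_row es a cs)) (cand_tape A (a # B)) (cand_tape cs []) v (edge_tape es []) empty_tape)"
  unfolding cost_time_def
proof (rule runs_foreach[where xs = cs and pre = "map cand cs" and post = "[]" and
    S = "\<lambda>L R. conf i (out @ edge_word (cost_row es a L)) (cand_tape A (a # B)) (cand_tape L R) v (edge_tape es []) empty_tape"])
  fix L x R assume LxR: "L @ x # R = cs"
  then have x: "fits1 N (cand x)" using fits_fits1[OF cs(1)] by auto
  have a1: "fits1 N (cand a)" using fits_fits1[OF a] by auto
  let ?s = "\<lambda>p D t f g. [i, (rev (out @ p), []), cand_tape A (a # B), D, v, edge_tape es [], t, flag False, flag f, flag g]"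
  let ?D = "cand_tape L (x # R)" and ?D' = "cand_tape (L @ [x]) R"
  let ?p = "edge_word (cost_row es a L)" and ?p' = "edge_word (cost_row es a (L @ [x]))"
  let ?h = "hit True es [a] x"
  have "runs (compare 2 3 8) (8 * N + 18) (?s ?p ?D empty_tape False False) (?s ?p ?D empty_tape (a = x) False)"
    by (rule runs_weaken, rule runs_compare_items[where w = "cand a" and w' = "cand x" and L = "map cand A" and R = "map cand B"
          and L' = "map cand L" and R' = "map cand R" and N = N and b = False])
      (use x a1 in auto)
  moreover have "runs (Cond (\<lambda>rs. rs ! 8 \<noteq> 1) cost_entry skip) (scan_time N + 20 * N + 60 + 2)
      (?s ?p ?D empty_tape (a = x) False) (?s ?p' ?D empty_tape (a = x) False)"
  proof (rule runs_when)
    assume "reads (?s ?p ?D empty_tape (a = x) False) ! 8 \<noteq> 1"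
    then have ax: "a \<noteq> x" by (auto split: if_splits)
    then have eq: "(a = x) = False" by simp
    let ?q = "?p @ cand a @ [3]"
    let ?r = "?q @ cand x @ [3]"
    have p': "?p' = ?r @ [if ?h then 2 else 1, 3]" using ax by (auto simp: cost_row_def)
    have "runs (copy_item 2 1) (6 * N + 9) (?s ?p ?D empty_tape False False) (?s ?q ?D empty_tape False False)"
      by (rule runs_weaken, rule runs_copy_item_output[where w = "cand a" and L = "map cand A" and R = "map cand B" and xs = "out @ ?p" and N = N])
        (use a1 in auto)
    moreover have "runs (copy_item 3 1) (6 * N + 9) (?s ?q ?D empty_tape False False) (?s ?r ?D empty_tape False False)"
      by (rule runs_weaken, rule runs_copy_item_output[where w = "cand x" and L = "map cand L" and R = "map cand R" and xs = "out @ ?q" and N = N])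
        (use x in auto)
    moreover have "runs (copy_item 2 6) (6 * N + 9) (?s ?r ?D empty_tape False False) (?s ?r ?D (cand_tape [a] []) False False)"
      by (rule runs_weaken, rule runs_copy_item_append[where w = "cand a" and L = "map cand A" and R = "map cand B" and ws = "[]" and N = N])
        (use a1 in auto)
    moreover have "runs (scan True 3) (scan_time N) (?s ?r ?D (cand_tape [a] []) False False) (?s ?r ?D (cand_tape [a] []) False ?h)"
      by (rule runs_weaken, rule runs_scan[where ?A0.0 = "map cand L" and x = x and ?B0.0 = "map cand R" and es = es and ys = "[a]" and b = False and N = N])
        (use x a es in auto)
    moreover have "runs (Cond (\<lambda>rs. rs ! 9 = 1) (Put 1 2 Move_Right) (Put 1 1 Move_Right)) (1 + 1)
        (?s ?r ?D (cand_tape [a] []) False ?h) (?s (?r @ [if ?h then 2 else 1]) ?D (cand_tape [a] []) False ?h)"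
      by (rule runs_Cond; rule runs_Put) (auto split: if_splits)
    moreover have "runs (Put 1 3 Move_Right) 1
        (?s (?r @ [if ?h then 2 else 1]) ?D (cand_tape [a] []) False ?h) (?s ?p' ?D (cand_tape [a] []) False ?h)"
      by (rule runs_Put) (simp add: p')
    moreover have "runs (clear 6) (2 * N + 5) (?s ?p' ?D (cand_tape [a] []) False ?h) (?s ?p' ?D empty_tape False ?h)"
      by (rule runs_weaken, rule runs_clear_items[OF _ _ a]) auto
    moreover have "runs (set_flag 9 (\<lambda>_. False)) 2 (?s ?p' ?D empty_tape False ?h) (?s ?p' ?D empty_tape False False)"
      by (rule runs_weaken, rule runs_set_flag[where ?b0.0 = ?h]) auto
    ultimately have "runs cost_entry (6 * N + 9 + (6 * N + 9 + (6 * N + 9 + (scan_time N + (1 + 1 + (1 + (2 * N + 5 + 2 + 1) + 1) + 1) + 1) + 1) + 1) + 1)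
        (?s ?p ?D empty_tape False False) (?s ?p' ?D empty_tape False False)"
      unfolding cost_entry_def by (intro runs_Seq)
    then show "runs cost_entry (scan_time N + 20 * N + 60) (?s ?p ?D empty_tape (a = x) False) (?s ?p' ?D empty_tape (a = x) False)"
      unfolding eq by (rule runs_weaken) auto
  next
    assume "\<not> reads (?s ?p ?D empty_tape (a = x) False) ! 8 \<noteq> 1"
    then have "a = x" by (auto split: if_splits)
    then have "?p' = ?p" by (auto simp: cost_row_def)
    then show "?s ?p ?D empty_tape (a = x) False = ?s ?p' ?D empty_tape (a = x) False" by simp
  qed
  moreover have "runs (set_flag 8 (\<lambda>_. False)) 2 (?s ?p' ?D empty_tape (a = x) False) (?s ?p' ?D empty_tape False False)"
    by (rule runs_weaken, rule runs_set_flag[where ?b0.0 = "a = x"]) auto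
  moreover have "runs (next_item 3) (2 * N + 3) (?s ?p' ?D empty_tape False False) (?s ?p' ?D' empty_tape False False)"
    by (rule runs_weaken, rule runs_next_item_tape[where L = "map cand L" and w = "cand x" and R = "map cand R" and N = N])
      (use x in auto)
  ultimately have "runs cost_step (8 * N + 18 + (scan_time N + 20 * N + 60 + 2 + (2 + (2 * N + 3) + 1) + 1) + 1)
      (?s ?p ?D empty_tape False False) (?s ?p' ?D' empty_tape False False)"
    unfolding cost_step_def by (intro runs_Seq)
  then show "runs cost_step (scan_time N + 30 * N + 100) (?s ?p ?D empty_tape False False) (?s ?p' ?D' empty_tape False False)"
    by (rule runs_weaken) auto
qed (use cs fits_length[OF cs] in \<open>auto simp: cost_row_def\<close>)

definition cost_rows :: "(nat \<times> nat \<times> bool) list \<Rightarrow> nat list \<Rightarrow> nat list \<Rightarrow> (nat \<times> nat \<times> bool) list" where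
  "cost_rows es cs ds = concat (map (\<lambda>a. cost_row es a cs) ds)"

lemma runs_cost_rows:
  assumes cs: "fits N (map cand cs)" and es: "fits N (concat (map edge_items es))"
  shows "runs (foreach 2 (foreach 3 cost_step ;; next_item 2)) (foreach_time N (cost_time N + 2 * N + 10))
    (conf i out (cand_tape cs []) (cand_tape cs []) v (edge_tape es []) empty_tape)
    (conf i (out @ edge_word (cost_rows es cs cs)) (cand_tape cs []) (cand_tape cs []) v (edge_tape es []) empty_tape)"
proof (rule runs_foreach[where xs = cs and pre = "map cand cs" and post = "[]" and
    S = "\<lambda>L R. conf i (out @ edge_word (cost_rows es cs L)) (cand_tape L R) (cand_tape cs []) v (edge_tape es []) empty_tape"])
  fix L x R assume LxR: "L @ x # R = cs"
  then have x: "fits1 N (cand x)" using fits_fits1[OF cs(1)] by auto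
  have x': "fits N [cand x]" using cs LxR by (auto simp: fits_def)
  let ?s = "\<lambda>C xs. conf i (out @ edge_word (cost_rows es cs xs)) C (cand_tape cs []) v (edge_tape es []) empty_tape"
  have "runs (foreach 3 cost_step) (cost_time N) (?s (cand_tape L (x # R)) L) (?s (cand_tape L (x # R)) (L @ [x]))"
    using runs_cost_row[OF x' cs es, of i "out @ edge_word (cost_rows es cs L)" L R v]
    by (simp add: cost_rows_def)
  moreover have "runs (next_item 2) (2 * N + 3) (?s (cand_tape L (x # R)) (L @ [x])) (?s (cand_tape (L @ [x]) R) (L @ [x]))"
    by (rule runs_weaken, rule runs_next_item_tape[where L = "map cand L" and w = "cand x" and R = "map cand R" and N = N])
      (use x in auto)
  ultimately have "runs (foreach 3 cost_step ;; next_item 2) (cost_time N + (2 * N + 3) + 1)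
      (?s (cand_tape L (x # R)) L) (?s (cand_tape (L @ [x]) R) (L @ [x]))"
    by (rule runs_Seq)
  then show "runs (foreach 3 cost_step ;; next_item 2) (cost_time N + 2 * N + 10)
      (?s (cand_tape L (x # R)) L) (?s (cand_tape (L @ [x]) R) (L @ [x]))"
    by (rule runs_weaken) auto
qed (use cs fits_length[OF cs] in \<open>auto simp: cost_rows_def\<close>)

text \<open>Storing the pairs of a partial vote as triples with a raised bit lets
  \<open>scan\<close> serve both programs.\<close>

definition edges :: "(nat \<times> nat) list \<Rightarrow> (nat \<times> nat \<times> bool) list" where
  "edges ps = map (\<lambda>(a, b). (a, b, True)) ps"

definition take_pair :: com where
  "take_pair = take_item 0 5 ;; take_item 0 5 ;; Put 5 2 Move_Right ;; Put 5 3 Move_Right"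

text \<open>A pair starts with a bit, or with a comma if its first candidate is 0, whose code is
  empty. Either way it is told apart from the semicolon that ends the block.\<close>

lemma pair_word_read: "0 < zip_read (l, pair_word ps @ 4 # r) \<and> (zip_read (l, pair_word ps @ 4 # r) \<noteq> 4 \<longleftrightarrow> ps \<noteq> [])"
  using zip_read_item[of "cand (fst (hd ps))" l "cand (snd (hd ps)) @ 3 # pair_word (tl ps) @ 4 # r"]
  by (cases ps) auto

lemma runs_take_pairs:
  assumes ps: "fits N (concat (map edge_items (edges ps)))"
  shows "runs (Loop (\<lambda>rs. rs ! 0 \<noteq> 4) take_pair ;; go 0 Move_Right) (N * (8 * N + 20) + 3)
    (conf (il, pair_word ps @ 4 # r) out c d v empty_tape t)
    (conf (rev (pair_word ps @ [4]) @ il, r) out c d v (edge_tape (edges ps) []) t)"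
proof -
  let ?S = "\<lambda>L R. conf (rev (pair_word L) @ il, pair_word R @ 4 # r) out c d v (edge_tape (edges L) []) t"
  have 1: "runs (Loop (\<lambda>rs. rs ! 0 \<noteq> 4) take_pair) (length ps * (8 * N + 19 + 1) + 1) (?S [] ps) (?S ps [])"
  proof (rule runs_Loop_list)
    fix L q R assume LqR: "L @ q # R = ps"
    obtain a b where q: "q = (a, b)" by (cases q)
    have ab: "fits1 N (cand a)" "fits1 N (cand b)"
      using LqR q by (auto intro!: fits_fits1[OF ps] simp: edges_def)
    show "reads (?S L (q # R)) ! 0 \<noteq> 4" using pair_word_read by simp
    let ?E = "concat (map edge_items (edges L))"
    let ?i1 = "(rev (cand a @ [3]) @ rev (pair_word L) @ il, cand b @ 3 # pair_word R @ 4 # r)"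
    let ?i2 = "(rev (pair_word (L @ [q])) @ il, pair_word R @ 4 # r)"
    have "runs (take_item 0 5) (4 * N + 5) (?S L (q # R)) (conf ?i1 out c d v (item_tape (?E @ [cand a]) []) t)"
      by (rule runs_weaken, rule runs_take_item_tape[where w = "cand a" and a = "rev (pair_word L) @ il"
            and r = "cand b @ 3 # pair_word R @ 4 # r" and L = ?E and N = N])
        (use ab q in auto)
    moreover have "runs (take_item 0 5) (4 * N + 5) (conf ?i1 out c d v (item_tape (?E @ [cand a]) []) t)
        (conf ?i2 out c d v (item_tape (?E @ [cand a, cand b]) []) t)"
      by (rule runs_weaken, rule runs_take_item_tape[where w = "cand b" and a = "rev (cand a @ [3]) @ rev (pair_word L) @ il"
            and r = "pair_word R @ 4 # r" and L = "?E @ [cand a]" and N = N])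
        (use ab q in auto)
    moreover have "runs (Put 5 2 Move_Right) 1 (conf ?i2 out c d v (item_tape (?E @ [cand a, cand b]) []) t)
        (conf ?i2 out c d v (2 # rev (5 # items (?E @ [cand a, cand b])), []) t)"
      by (rule runs_Put) (simp add: item_tape_def)
    moreover have "runs (Put 5 3 Move_Right) 1 (conf ?i2 out c d v (2 # rev (5 # items (?E @ [cand a, cand b])), []) t)
        (?S (L @ [q]) R)"
      by (rule runs_Put) (simp add: item_tape_def q edges_def)
    ultimately have "runs take_pair (4 * N + 5 + (4 * N + 5 + (1 + 1 + 1) + 1) + 1) (?S L (q # R)) (?S (L @ [q]) R)"
      unfolding take_pair_def by (intro runs_Seq)
    then show "runs take_pair (8 * N + 19) (?S L (q # R)) (?S (L @ [q]) R)"
      by (rule runs_weaken) auto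
  qed simp
  have N: "length ps \<le> N"
    using fits_length[OF ps] length_edges[of "edges ps"] by (simp add: edges_def)
  have 2: "runs (go 0 Move_Right) 1 (?S ps []) (conf (rev (pair_word ps @ [4]) @ il, r) out c d v (edge_tape (edges ps) []) t)"
    by (rule runs_Transfer) simp
  have "?S [] ps = conf (il, pair_word ps @ 4 # r) out c d v empty_tape t" by (simp add: edges_def)
  with runs_Seq[OF 1 2] have "runs (Loop (\<lambda>rs. rs ! 0 \<noteq> 4) take_pair ;; go 0 Move_Right)
      (length ps * (8 * N + 19 + 1) + 1 + 1 + 1) (conf (il, pair_word ps @ 4 # r) out c d v empty_tape t)
      (conf (rev (pair_word ps @ [4]) @ il, r) out c d v (edge_tape (edges ps) []) t)"
    by simp
  then show ?thesis
    by (rule runs_weaken) (use N in \<open>auto simp: add.commute intro: mult_le_mono\<close>)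
qed

definition order_block :: com where
  "order_block = (Loop (\<lambda>rs. rs ! 0 \<noteq> 4) take_pair ;; go 0 Move_Right) ;;
     foreach 3 (foreach 2 sort_step ;; next_item 3) ;; foreach 6 (copy_item 6 1 ;; next_item 6) ;;
     Put 1 4 Move_Right ;; clear 6 ;; foreach 2 (foreach 3 cost_step ;; next_item 2) ;;
     Put 1 4 Move_Right ;; clear 5"

definition order_word :: "nat list \<Rightarrow> (nat \<times> nat) list \<Rightarrow> nat list" where
  "order_word cs ps = items (map cand (sort_rounds (edges ps) cs cs)) @ [4] @ edge_word (cost_rows (edges ps) cs cs) @ [4]"

definition order_time :: "nat \<Rightarrow> nat" where
  "order_time N = N * (8 * N + 20) + foreach_time N (sort_time N + 2 * N + 10) + foreach_time N (8 * N + 20) +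
     foreach_time N (cost_time N + 2 * N + 10) + 4 * N + 50"

lemma runs_order_block:
  assumes cs: "fits N (map cand cs)" "distinct cs" and ps: "fits N (concat (map edge_items (edges ps)))"
  shows "runs order_block (order_time N)
    (conf (il, pair_word ps @ 4 # r) out (cand_tape cs []) (cand_tape cs []) empty_tape empty_tape empty_tape)
    (conf (rev (pair_word ps @ [4]) @ il, r) (out @ order_word cs ps) (cand_tape cs []) (cand_tape cs []) empty_tape empty_tape empty_tape)"
proof -
  let ?C = "cand_tape cs []" and ?E = "edge_tape (edges ps) []"
  let ?i0 = "(il, pair_word ps @ 4 # r)" and ?i1 = "(rev (pair_word ps @ [4]) @ il, r)"
  let ?ys = "sort_rounds (edges ps) cs cs"
  let ?o1 = "out @ items (map cand ?ys)"
  let ?o2 = "?o1 @ [4]"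
  let ?o3 = "?o2 @ edge_word (cost_rows (edges ps) cs cs)"
  have ys: "fits N (map cand ?ys)"
    by (rule fits_distinct_subset[OF cs]) (simp_all add: sort_rounds_subset)
  have "runs (Loop (\<lambda>rs. rs ! 0 \<noteq> 4) take_pair ;; go 0 Move_Right) (N * (8 * N + 20) + 3)
      (conf ?i0 out ?C ?C empty_tape empty_tape empty_tape) (conf ?i1 out ?C ?C empty_tape ?E empty_tape)"
    by (rule runs_take_pairs[OF ps])
  moreover have "runs (foreach 3 (foreach 2 sort_step ;; next_item 3)) (foreach_time N (sort_time N + 2 * N + 10))
      (conf ?i1 out ?C ?C empty_tape ?E empty_tape) (conf ?i1 out ?C ?C empty_tape ?E (cand_tape ?ys []))"
    by (rule runs_sort_rounds[OF cs ps])
  moreover have "runs (foreach 6 (copy_item 6 1 ;; next_item 6)) (foreach_time N (8 * N + 20))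
      (conf ?i1 out ?C ?C empty_tape ?E (cand_tape ?ys [])) (conf ?i1 ?o1 ?C ?C empty_tape ?E (cand_tape ?ys []))"
    by (rule runs_output_items[OF ys])
  moreover have "runs (Put 1 4 Move_Right) 1 (conf ?i1 ?o1 ?C ?C empty_tape ?E (cand_tape ?ys []))
      (conf ?i1 ?o2 ?C ?C empty_tape ?E (cand_tape ?ys []))"
    by (rule runs_Put) simp
  moreover have "runs (clear 6) (2 * N + 5) (conf ?i1 ?o2 ?C ?C empty_tape ?E (cand_tape ?ys []))
      (conf ?i1 ?o2 ?C ?C empty_tape ?E empty_tape)"
    by (rule runs_weaken, rule runs_clear_items[OF _ _ ys]) auto
  moreover have "runs (foreach 2 (foreach 3 cost_step ;; next_item 2)) (foreach_time N (cost_time N + 2 * N + 10))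
      (conf ?i1 ?o2 ?C ?C empty_tape ?E empty_tape) (conf ?i1 ?o3 ?C ?C empty_tape ?E empty_tape)"
    by (rule runs_cost_rows[OF cs(1) ps])
  moreover have "runs (Put 1 4 Move_Right) 1 (conf ?i1 ?o3 ?C ?C empty_tape ?E empty_tape)
      (conf ?i1 (out @ order_word cs ps) ?C ?C empty_tape ?E empty_tape)"
    by (rule runs_Put) (simp add: order_word_def)
  moreover have "runs (clear 5) (2 * N + 5) (conf ?i1 (out @ order_word cs ps) ?C ?C empty_tape ?E empty_tape)
      (conf ?i1 (out @ order_word cs ps) ?C ?C empty_tape empty_tape empty_tape)"
    by (rule runs_weaken, rule runs_clear_items[OF _ _ ps]) auto
  ultimately have "runs order_block (N * (8 * N + 20) + 3 + (foreach_time N (sort_time N + 2 * N + 10) + (foreach_time N (8 * N + 20) +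
      (1 + (2 * N + 5 + (foreach_time N (cost_time N + 2 * N + 10) + (1 + (2 * N + 5) + 1) + 1) + 1) + 1) + 1) + 1) + 1)
      (conf ?i0 out ?C ?C empty_tape empty_tape empty_tape)
      (conf ?i1 (out @ order_word cs ps) ?C ?C empty_tape empty_tape empty_tape)"
    unfolding order_block_def by (intro runs_Seq)
  then show ?thesis
    by (rule runs_weaken) (auto simp: order_time_def)
qed

text \<open>The two symbols written behind the header encode the budget 0.\<close>

definition order_program :: com where
  "order_program = header ;; Put 1 1 Move_Right ;; Put 1 3 Move_Right ;; Loop (\<lambda>rs. rs ! 0 \<noteq> 0) order_block"

definition order_program_time :: "nat \<Rightarrow> nat" where
  "order_program_time N = header_time N + N * (order_time N + 1) + 10"

lemma runs_order_program:
  assumes w: "word_symbols w = header_word cs p @ concat (map (\<lambda>ps. pair_word ps @ [4]) bs)"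
    and fits: "fits N (map cand cs)" "fits1 N (cand p)" "length bs \<le> N" and cs: "distinct cs"
    and blocks: "\<And>ps. ps \<in> set bs \<Longrightarrow> fits N (concat (map edge_items (edges ps)))"
  shows "\<exists>s. runs order_program (order_program_time N) (initial_state 10 w) s \<and>
    s ! 1 = (rev (header_word cs p @ [1, 3] @ concat (map (order_word cs) bs)), [])"
proof -
  let ?C = "cand_tape cs []"
  let ?h = "header_word cs p"
  let ?in = "\<lambda>bs. concat (map (\<lambda>ps. pair_word ps @ [4]) bs)"
  let ?out = "\<lambda>bs. ?h @ [1, 3] @ concat (map (order_word cs) bs)"
  let ?S = "\<lambda>L R. conf (rev (?in L) @ rev ?h, ?in R) (?out L) ?C ?C empty_tape empty_tape empty_tape"
  have "runs header (header_time N) (initial_state 10 w)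
      (conf (rev ?h, ?in bs) ?h ?C ?C empty_tape empty_tape empty_tape)"
    by (rule runs_header[OF w fits(1,2)])
  moreover have "runs (Put 1 1 Move_Right) 1 (conf (rev ?h, ?in bs) ?h ?C ?C empty_tape empty_tape empty_tape)
      (conf (rev ?h, ?in bs) (?h @ [1]) ?C ?C empty_tape empty_tape empty_tape)"
    by (rule runs_Put) simp
  moreover have "runs (Put 1 3 Move_Right) 1 (conf (rev ?h, ?in bs) (?h @ [1]) ?C ?C empty_tape empty_tape empty_tape)
      (?S [] bs)"
    by (rule runs_Put) simp
  moreover have "runs (Loop (\<lambda>rs. rs ! 0 \<noteq> 0) order_block) (length bs * (order_time N + 1) + 1) (?S [] bs) (?S bs [])"
  proof (rule runs_Loop_list)
    fix L ps R assume LbR: "L @ ps # R = bs"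
    then have "fits N (concat (map edge_items (edges ps)))" using blocks[of ps] by auto
    from runs_order_block[OF fits(1) cs this, of "rev (?in L) @ rev ?h" "?in R" "?out L"]
    show "runs order_block (order_time N) (?S L (ps # R)) (?S (L @ [ps]) R)"
      by simp
    show "reads (?S L (ps # R)) ! 0 \<noteq> 0" using pair_word_read[of _ ps "?in R"] by simp
  qed simp
  ultimately have "runs order_program (header_time N + (1 + (1 + (length bs * (order_time N + 1) + 1) + 1) + 1) + 1)
      (initial_state 10 w) (?S bs [])"
    unfolding order_program_def by (intro runs_Seq)
  then have "runs order_program (order_program_time N) (initial_state 10 w) (?S bs [])"
    by (rule runs_weaken)
      (use mult_le_mono1[OF fits(3), of "order_time N + 1"] in \<open>auto simp: order_program_time_def\<close>)
  then show ?thesis by (intro exI[of _ "?S bs []"]) simp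
qed

section \<open>Swaps of zero cost\<close>

lemma nth_rank: "a \<in> set v \<Longrightarrow> rank a v - 1 < length v \<and> v ! (rank a v - 1) = a"
proof -
  assume "a \<in> set v"
  then have "length (takeWhile (\<lambda>x. x \<noteq> a) v) < length v"
    by (induction v) auto
  then show ?thesis using nth_length_takeWhile[of "\<lambda>x. x \<noteq> a" v] by (simp add: rank_def)
qed

lemma rank_inj: "a \<in> set v \<Longrightarrow> b \<in> set v \<Longrightarrow> rank a v = rank b v \<Longrightarrow> a = b"
  using nth_rank[of a v] nth_rank[of b v] by simp

lemma rank_nth: "distinct v \<Longrightarrow> i < length v \<Longrightarrow> rank (v ! i) v = i + 1"
  using nth_rank[of "v ! i" v] nth_eq_iff_index_eq[of v i "rank (v ! i) v - 1"]
  by (force simp: rank_def)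

lemma order_of_vote_asym: "(a, b) \<in> order_of_vote v \<Longrightarrow> (b, a) \<notin> order_of_vote v"
  by (auto simp: order_of_vote_def)

lemma trans_order_of_vote: "trans (order_of_vote v)"
  by (auto simp: order_of_vote_def intro!: transI)

text \<open>Ranks are turned into prefixes of the list, the form in which the one-pass algorithms
  see a vote.\<close>

lemma order_of_vote_append:
  assumes "distinct (A @ x # B)"
  shows "(y, x) \<in> order_of_vote (A @ x # B) \<longleftrightarrow> y \<in> set A"
proof -
  have x: "rank x (A @ x # B) = length A + 1"
    using rank_nth[OF assms, of "length A"] by simp
  show ?thesis
  proof
    assume "y \<in> set A"
    then have "rank y (A @ x # B) = rank y A" "rank y A - 1 < length A"
      using nth_rank[of y A] by (auto simp: rank_def)
    with \<open>y \<in> set A\<close> x show "(y, x) \<in> order_of_vote (A @ x # B)" by (auto simp: order_of_vote_def)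
  next
    assume *: "(y, x) \<in> order_of_vote (A @ x # B)"
    then have "y \<in> set (A @ x # B)" "rank y (A @ x # B) - 1 < length A"
      using x by (auto simp: order_of_vote_def rank_def)
    with nth_rank[of y "A @ x # B"] show "y \<in> set A"
      by (metis nth_append nth_mem)
  qed
qed

text \<open>Applying a swap renames two candidates in the list, and a transposition is its own
  inverse.\<close>

lemma rank_apply_swap: "rank c (apply_swap (a, b) v) = rank (Transposition.transpose a b c) v"
proof -
  have "(Transposition.transpose a b x \<noteq> c) = (x \<noteq> Transposition.transpose a b c)" for x
    by (metis transpose_involutory)
  then show ?thesis by (simp add: rank_def apply_swap_def takeWhile_map comp_def)
qed

lemma apply_swap_vote:
  assumes "swap_admissible (a, b) v"
  shows "set (apply_swap (a, b) v) = set v" "distinct v \<Longrightarrow> distinct (apply_swap (a, b) v)"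
proof -
  have "a \<in> set v" "b \<in> set v" using assms by (auto simp: swap_admissible_def)
  then show "set (apply_swap (a, b) v) = set v"
    by (force simp: apply_swap_def Transposition.transpose_def image_iff)
  show "distinct v \<Longrightarrow> distinct (apply_swap (a, b) v)"
    by (simp add: apply_swap_def distinct_map inj_on_subset[OF inj_transpose])
qed

text \<open>The swapped candidates are neighbours: no third candidate lies between them, so no other
  pair changes its relative order.\<close>

lemma order_apply_swap:
  assumes s: "swap_admissible (a, b) v" and xy: "(x, y) \<in> order_of_vote v" "(x, y) \<noteq> (a, b)"
  shows "(x, y) \<in> order_of_vote (apply_swap (a, b) v)"
proof -
  have ab: "a \<in> set v" "b \<in> set v" "rank b v = rank a v + 1"
    using s by (auto simp: swap_admissible_def)
  have xy': "x \<in> set v" "y \<in> set v" "rank x v < rank y v"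
    using xy by (auto simp: order_of_vote_def)
  have x: "rank x v = rank a v \<longleftrightarrow> x = a" using rank_inj[of x v a] ab xy' by auto
  have y: "rank y v = rank b v \<longleftrightarrow> y = b" using rank_inj[of y v b] ab xy' by auto
  consider "x = a" "y \<noteq> a" "y \<noteq> b" | "x = b" "y \<noteq> a" "y \<noteq> b" | "x \<noteq> a" "x \<noteq> b" "y = a"
    | "x \<noteq> a" "x \<noteq> b" "y = b" | "x \<noteq> a" "x \<noteq> b" "y \<noteq> a" "y \<noteq> b"
    using xy(2) xy'(3) ab(3) by fastforce
  then have "rank (Transposition.transpose a b x) v < rank (Transposition.transpose a b y) v"
    using xy'(3) ab(3) x y by cases (auto simp: Transposition.transpose_def)
  then show ?thesis
    using xy' apply_swap_vote(1)[OF s] by (simp add: order_of_vote_def rank_apply_swap)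
qed

lemma swap_admissible_apply_swap: "swap_admissible (a, b) v \<Longrightarrow> swap_admissible (b, a) (apply_swap (a, b) v)"
  using apply_swap_vote(1)[of a b v] by (auto simp: swap_admissible_def rank_apply_swap)

lemma apply_swap_apply_swap: "apply_swap (b, a) (apply_swap (a, b) v) = v"
  by (simp add: apply_swap_def transpose_commute[of b a] comp_def)

text \<open>By the third part, \<open>y\<close> can overtake \<open>x\<close> only through the swap
  \<open>(x, y)\<close> itself, which is why avoiding costly swaps preserves costly pairs. All parts
  share one induction, whose hypothesis needs the intermediate list to be a vote again.\<close>

lemma swaps_admissible_vote:
  assumes "swaps_admissible ss v" "is_vote C v"
  shows "is_vote C (fold apply_swap ss v)"
    and "(a, b) \<in> set ss \<Longrightarrow> a \<in> C \<and> b \<in> C \<and> a \<noteq> b"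
    and "(x, y) \<in> order_of_vote v \<Longrightarrow> (x, y) \<notin> set ss \<Longrightarrow> (x, y) \<in> order_of_vote (fold apply_swap ss v)"
proof -
  have "is_vote C (fold apply_swap ss v) \<and> ((a, b) \<in> set ss \<longrightarrow> a \<in> C \<and> b \<in> C \<and> a \<noteq> b) \<and>
    ((x, y) \<in> order_of_vote v \<longrightarrow> (x, y) \<notin> set ss \<longrightarrow> (x, y) \<in> order_of_vote (fold apply_swap ss v))"
    using assms
  proof (induction ss arbitrary: v)
    case (Cons s ss)
    obtain c d where s: "s = (c, d)" by (cases s)
    have adm: "swap_admissible (c, d) v" using Cons.prems s by simp
    then have "is_vote C (apply_swap s v)"
      using Cons.prems apply_swap_vote[of c d v] by (auto simp: is_vote_def s)
    with Cons.IH[of "apply_swap s v"] Cons.prems order_apply_swap[OF adm, of x y] adm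
    show ?case by (auto simp: s is_vote_def swap_admissible_def)
  qed simp
  then show "is_vote C (fold apply_swap ss v)" "(a, b) \<in> set ss \<Longrightarrow> a \<in> C \<and> b \<in> C \<and> a \<noteq> b"
    "(x, y) \<in> order_of_vote v \<Longrightarrow> (x, y) \<notin> set ss \<Longrightarrow> (x, y) \<in> order_of_vote (fold apply_swap ss v)"
    by auto
qed

text \<open>Bubble sort: every adjacent swap removes exactly one inversion of \<open>v\<close> relative to \<open>w\<close>.\<close>

lemma bubble_sort:
  assumes "is_vote C v" "is_vote C w"
  obtains ss where "distinct ss" "swaps_admissible ss v" "fold apply_swap ss v = w"
    "set ss \<subseteq> order_of_vote v \<inter> (order_of_vote w)\<inverse>"
proof -
  define inversions where "inversions v = order_of_vote v \<inter> (order_of_vote w)\<inverse>" for v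
  have w: "distinct w" "set w = C" using assms by (auto simp: is_vote_def)
  have fin: "finite (inversions u)" for u
    by (rule finite_subset[of _ "set u \<times> set u"]) (auto simp: inversions_def order_of_vote_def)
  have "\<exists>ss. distinct ss \<and> swaps_admissible ss v \<and> fold apply_swap ss v = w \<and> set ss \<subseteq> inversions v"
    using assms(1)
  proof (induction "card (inversions v)" arbitrary: v rule: less_induct)
    case less
    have v: "distinct v" "set v = C" using less.prems by (auto simp: is_vote_def)
    show ?case
    proof (cases "sorted (map (\<lambda>x. rank x w) v)")
      case True
      \<comment> \<open>Ranks in \<open>w\<close> are distinct keys and \<open>w\<close> is sorted
        by them, so any vote sorted by these keys is \<open>w\<close>.\<close>
      have inj: "inj_on (\<lambda>x. rank x w) C" using rank_inj w(2) by (metis inj_onI)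
      have "sorted (map (\<lambda>x. rank x w) w)"
        using w(1) by (auto simp: sorted_iff_nth_mono rank_nth)
      then have "map (\<lambda>x. rank x w) v = map (\<lambda>x. rank x w) w"
        using True v w inj by (intro sorted_distinct_set_unique) (auto simp: distinct_map)
      then have "v = w" using inj v w by (simp add: inj_on_map_eq_map)
      then show ?thesis by (intro exI[of _ "[]"]) simp
    next
      case False
      then obtain i where i: "Suc i < length v" "rank (v ! Suc i) w < rank (v ! i) w"
        by (auto simp: sorted_iff_nth_Suc not_le)
      define a b where "a = v ! i" and "b = v ! Suc i"
      have ab: "a \<in> set v" "b \<in> set v" "rank a v = i + 1" "rank b v = i + 2" "a \<noteq> b"
        using i v rank_nth[of v i] rank_nth[of v "Suc i"] by (auto simp: a_def b_def)
      then have adm: "swap_admissible (a, b) v" by (simp add: swap_admissible_def)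
      have ba: "(b, a) \<in> order_of_vote w" using i ab v w by (auto simp: order_of_vote_def a_def b_def)
      let ?v = "apply_swap (a, b) v"
      have v': "is_vote C ?v" using apply_swap_vote[OF adm] v by (auto simp: is_vote_def)
      have "(a, b) \<notin> order_of_vote ?v"
        using ab by (simp add: order_of_vote_def rank_apply_swap)
      moreover have "(x, y) \<in> order_of_vote v" if "(x, y) \<in> order_of_vote ?v" "(x, y) \<noteq> (b, a)" for x y
        using order_apply_swap[OF swap_admissible_apply_swap[OF adm] that] by (simp add: apply_swap_apply_swap)
      moreover have "(b, a) \<notin> inversions ?v" using order_of_vote_asym[OF ba] by (auto simp: inversions_def)
      \<comment> \<open>The pair just swapped is no longer an inversion and no new one arises. Hence
        the remaining swaps avoid \<open>(a, b)\<close>, which yields distinctness as well as the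
        decrease of the measure.\<close>
      ultimately have sub: "inversions ?v \<subseteq> inversions v - {(a, b)}"
        by (auto simp: inversions_def)
      moreover have in_v: "(a, b) \<in> inversions v" using ba ab by (auto simp: inversions_def order_of_vote_def)
      ultimately have "inversions ?v \<subset> inversions v" by blast
      then have "card (inversions ?v) < card (inversions v)" by (rule psubset_card_mono[OF fin])
      from less.hyps[OF this v'] obtain ss where
        "distinct ss" "swaps_admissible ss ?v" "fold apply_swap ss ?v = w" "set ss \<subseteq> inversions ?v" by blast
      then show ?thesis using adm sub in_v by (intro exI[of _ "(a, b) # ss"]) auto
    qed
  qed
  then show thesis using that unfolding inversions_def by blast
qed

text \<open>If the total cost is 0, nonnegativity makes each swap free, so no costly pair of a given
  vote is ever swapped. Conversely, the bubble sort swaps only pairs that \<open>W\<close> reverses,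
  and \<open>W\<close> reverses no costly one.\<close>

lemma sb_solvable_iff:
  assumes I: "is_zero_budget_instance \<delta> I"
  shows "sb_solvable \<E> I \<longleftrightarrow> (\<exists>W. length W = length (sb_votes I) \<and>
    (\<forall>i<length W. is_vote (sb_candidates I) (W ! i) \<and>
       {(a, b) \<in> order_of_vote (sb_votes I ! i). sb_cost I i a b \<noteq> 0} \<subseteq> order_of_vote (W ! i)) \<and>
    sb_preferred I \<in> \<E> (sb_candidates I) W)"
    (is "_ \<longleftrightarrow> (\<exists>W. ?P W)")
proof
  let ?C = "sb_candidates I" and ?V = "sb_votes I"
  have V: "is_vote ?C (?V ! i)" if "i < length ?V" for i
    using I that by (auto simp: is_zero_budget_instance_def is_sb_instance_def is_election_def)
  assume "sb_solvable \<E> I"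
  then obtain \<Gamma> W where \<Gamma>: "profile_swap_result ?V \<Gamma> W" and
    cost: "(\<Sum>(i, a, b)\<in>\<Gamma>. sb_cost I i a b) \<le> 0" and win: "sb_preferred I \<in> \<E> ?C W"
    using I by (auto simp: sb_solvable_def is_zero_budget_instance_def)
  let ?S = "\<lambda>i. {(a, b). (i, a, b) \<in> \<Gamma>}"
  have len: "length W = length ?V" using \<Gamma> by (simp add: profile_swap_result_def)
  have swaps: "\<exists>ss. set ss = ?S i \<and> swaps_admissible ss (?V ! i) \<and> W ! i = fold apply_swap ss (?V ! i)"
    if "i < length ?V" for i
    using \<Gamma> that unfolding profile_swap_result_def swap_result_def by metis
  \<comment> \<open>Finiteness has to be derived: every slice is the set of a list of swaps. Sums
    over infinite sets are 0 by convention, so otherwise a vanishing total would say nothing about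
    single costs.\<close>
  have "\<Gamma> \<subseteq> (\<Union>i<length ?V. {i} \<times> ?S i)"
    using \<Gamma> by (auto simp: profile_swap_result_def)
  moreover have "finite (?S i)" if "i < length ?V" for i
    using swaps[OF that] by (metis List.finite_set)
  ultimately have fin: "finite \<Gamma>" by (meson finite_SigmaI finite_UN_I finite_lessThan finite_subset finite.emptyI finite_insert lessThan_iff)
  \<comment> \<open>Costs are known to be nonnegative only for proper swaps; admissibility shows
    that all elements of \<open>\<Gamma>\<close> are such.\<close>
  have valid: "is_sb_swap I (i, a, b)" if "(i, a, b) \<in> \<Gamma>" for i a b
  proof -
    have i: "i < length ?V" using \<Gamma> imageI[OF that, of fst] by (auto simp: profile_swap_result_def)
    then obtain ss where "set ss = ?S i" "swaps_admissible ss (?V ! i)" using swaps by blast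
    then show ?thesis
      using swaps_admissible_vote(2)[OF _ V[OF i], of ss a b] that i by (auto simp: is_sb_swap_def)
  qed
  have nonneg: "(case s of (i, a, b) \<Rightarrow> sb_cost I i a b) \<ge> 0" if "s \<in> \<Gamma>" for s
    using valid that I by (auto simp: is_zero_budget_instance_def is_sb_instance_def split: prod.splits)
  have "(\<Sum>(i, a, b)\<in>\<Gamma>. sb_cost I i a b) \<ge> 0"
    by (rule sum_nonneg) (rule nonneg)
  with cost have "(\<Sum>(i, a, b)\<in>\<Gamma>. sb_cost I i a b) = 0" by simp
  then have zero: "sb_cost I i a b = 0" if "(i, a, b) \<in> \<Gamma>" for i a b
    using sum_nonneg_eq_0_iff[OF fin nonneg] that by auto
  have "?P W"
  proof (intro conjI allI impI)
    fix i assume "i < length W"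
    then have i: "i < length ?V" using len by simp
    then obtain ss where ss: "set ss = ?S i" "swaps_admissible ss (?V ! i)" "W ! i = fold apply_swap ss (?V ! i)"
      using swaps by blast
    show "is_vote ?C (W ! i)" using swaps_admissible_vote(1)[OF ss(2) V[OF i]] ss by simp
    show "{(a, b) \<in> order_of_vote (?V ! i). sb_cost I i a b \<noteq> 0} \<subseteq> order_of_vote (W ! i)"
    proof clarify
      fix a b assume *: "(a, b) \<in> order_of_vote (?V ! i)" "sb_cost I i a b \<noteq> 0"
      then have "(a, b) \<notin> set ss" using ss(1) zero[of i a b] by auto
      then show "(a, b) \<in> order_of_vote (W ! i)"
        using swaps_admissible_vote(3)[OF ss(2) V[OF i] *(1)] ss(3) by simp
    qed
  qed (use len win in auto)
  then show "\<exists>W. ?P W" ..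
next
  let ?C = "sb_candidates I" and ?V = "sb_votes I"
  have V: "is_vote ?C (?V ! i)" if "i < length ?V" for i
    using I that by (auto simp: is_zero_budget_instance_def is_sb_instance_def is_election_def)
  assume "\<exists>W. ?P W"
  then obtain W where len: "length W = length ?V" and
    W: "\<And>i. i < length ?V \<Longrightarrow> is_vote ?C (W ! i)" and
    ext: "\<And>i. i < length ?V \<Longrightarrow> {(a, b) \<in> order_of_vote (?V ! i). sb_cost I i a b \<noteq> 0} \<subseteq> order_of_vote (W ! i)"
    and win: "sb_preferred I \<in> \<E> ?C W" by auto
  have "\<exists>ss. distinct ss \<and> swaps_admissible ss (?V ! i) \<and> fold apply_swap ss (?V ! i) = W ! i \<and>
      set ss \<subseteq> order_of_vote (?V ! i) \<inter> (order_of_vote (W ! i))\<inverse>" if "i < length ?V" for i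
    using bubble_sort[OF V[OF that] W[OF that]] by metis
  then obtain ss where ss: "\<And>i. i < length ?V \<Longrightarrow> distinct (ss i) \<and> swaps_admissible (ss i) (?V ! i) \<and>
      fold apply_swap (ss i) (?V ! i) = W ! i \<and> set (ss i) \<subseteq> order_of_vote (?V ! i) \<inter> (order_of_vote (W ! i))\<inverse>"
    by metis
  define \<Gamma> where "\<Gamma> = {(i, a, b). i < length ?V \<and> (a, b) \<in> set (ss i)}"
  have "{(a, b). (i, a, b) \<in> \<Gamma>} = set (ss i)" if "i < length ?V" for i
    using that by (auto simp: \<Gamma>_def)
  then have "swap_result (?V ! i) {(a, b). (i, a, b) \<in> \<Gamma>} (W ! i)" if "i < length ?V" for i
    unfolding swap_result_def using ss[OF that] that by (intro exI[of _ "ss i"]) auto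
  moreover have "fst ` \<Gamma> \<subseteq> {..<length ?V}" by (auto simp: \<Gamma>_def)
  ultimately have "profile_swap_result ?V \<Gamma> W"
    using len by (simp add: profile_swap_result_def)
  moreover have "sb_cost I i a b = 0" if "(i, a, b) \<in> \<Gamma>" for i a b
  proof -
    from that have i: "i < length ?V" and "(a, b) \<in> set (ss i)" by (auto simp: \<Gamma>_def)
    then have "(a, b) \<in> order_of_vote (?V ! i)" "(b, a) \<in> order_of_vote (W ! i)" using ss by auto
    \<comment> \<open>With a nonzero cost, \<open>W\<close> would also have to rank \<open>a\<close>
      before \<open>b\<close>.\<close>
    then show ?thesis using ext[OF i] order_of_vote_asym by fastforce
  qed
  then have "(\<Sum>(i, a, b)\<in>\<Gamma>. sb_cost I i a b) = 0" by (intro sum.neutral) auto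
  ultimately show "sb_solvable \<E> I"
    unfolding sb_solvable_def using I win
    by (intro exI[of _ \<Gamma>] exI[of _ W]) (simp add: is_zero_budget_instance_def)
qed

section \<open>Correctness of the computed instances\<close>

lemma hit_True: "hit True es ys x \<longleftrightarrow> (\<exists>y\<in>set ys. (y, x, True) \<in> set es)"
  by (auto simp: hit_def)

text \<open>A vote lists its candidates in a topological order of \<open>R\<close>, so one pass over it finds all
  candidates reachable from \<open>a\<close>.\<close>

lemma reach_eq_filter:
  assumes v: "distinct v" and R: "\<And>y x. (y, x) \<in> R \<longleftrightarrow> (y, x) \<in> order_of_vote v \<and> (y, x, True) \<in> set es"
  shows "reach es a v = filter (\<lambda>x. (a, x) \<in> R\<^sup>*) v"
proof -
  have "reach es a L = filter (\<lambda>x. (a, x) \<in> R\<^sup>*) L" if "v = L @ R'" for L R'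
    using that
  proof (induction L arbitrary: R' rule: rev_induct)
    case (snoc x L)
    then have L: "reach es a L = filter (\<lambda>x. (a, x) \<in> R\<^sup>*) L" by simp
    \<comment> \<open>A pair of \<open>R\<close> agrees with \<open>v\<close>, so its source lies in
      the prefix already visited.\<close>
    have before: "(y, x) \<in> R \<longleftrightarrow> y \<in> set L \<and> (y, x, True) \<in> set es" for y
      using order_of_vote_append[of L x R' y] v snoc.prems R by simp
    have "x = a \<or> hit True es (reach es a L) x \<longleftrightarrow> x = a \<or> (\<exists>y. (a, y) \<in> R\<^sup>* \<and> (y, x) \<in> R)"
      unfolding L hit_True before by auto
    also have "\<dots> \<longleftrightarrow> (a, x) \<in> R\<^sup>*"
      by (metis rtrancl.simps)
    finally show ?case using L by (simp add: reach_def)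
  qed (simp add: reach_def)
  from this[of v "[]"] show ?thesis by simp
qed

text \<open>This is the relation \<open>R\<close> of the overview; in general it is not
  transitive.\<close>

definition swap_constraints :: "'a vote \<Rightarrow> ('a \<Rightarrow> 'a \<Rightarrow> real) \<Rightarrow> 'a rel" where
  "swap_constraints v c = {(a, b) \<in> order_of_vote v. c a b \<noteq> 0}"

text \<open>The closure is the least transitive relation above \<open>R\<close>. Applied with the
  order of a vote for \<open>S\<close>, this shows that closing the constraints does not change
  which votes satisfy them.\<close>

lemma trancl_subset_iff: "trans S \<Longrightarrow> R\<^sup>+ \<subseteq> S \<longleftrightarrow> R \<subseteq> S"
  by (metis r_into_trancl' subset_iff subrelI trancl_id trancl_mono)

lemma swap_constraints_trancl: "(swap_constraints v c)\<^sup>+ \<subseteq> order_of_vote v"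
  by (subst trancl_subset_iff[OF trans_order_of_vote]) (auto simp: swap_constraints_def)

definition cost_edges :: "nat set \<Rightarrow> (nat \<Rightarrow> nat \<Rightarrow> real) \<Rightarrow> (nat \<times> nat \<times> bool) list" where
  "cost_edges C c = map (\<lambda>(a, b). (a, b, c a b \<noteq> 0)) (filter (\<lambda>(a, b). a \<noteq> b) (candidate_pairs C))"

text \<open>The row-by-row form matches the nested loops of the programs.\<close>

lemma filter_candidate_pairs:
  "filter P (candidate_pairs C) = concat (map (\<lambda>a. map (Pair a) (filter (\<lambda>b. P (a, b)) (sorted_list_of_set C)))
    (sorted_list_of_set C))"
  by (simp add: candidate_pairs_def product_concat_map filter_concat filter_map comp_def)

lemma concat_map_if: "concat (map (\<lambda>b. if P b then [f b] else []) xs) = map f (filter P xs)"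
  by (induction xs) auto

lemma concat_map_if_not: "concat (map (\<lambda>b. if P b then [] else [f b]) xs) = map f (filter (\<lambda>b. \<not> P b) xs)"
  by (induction xs) auto

lemma set_candidate_pairs: "finite C \<Longrightarrow> set (candidate_pairs C) = C \<times> C"
  by (simp add: candidate_pairs_def)

lemma set_cost_edges:
  "finite C \<Longrightarrow> (y, x, b) \<in> set (cost_edges C c) \<longleftrightarrow> y \<in> C \<and> x \<in> C \<and> y \<noteq> x \<and> b = (c y x \<noteq> 0)"
  by (force simp: cost_edges_def set_candidate_pairs image_iff)

lemma closure_rows:
  assumes C: "finite C" and v: "is_vote C v"
  shows "concat (map (\<lambda>a. row (reach (cost_edges C c) a v) a (sorted_list_of_set C)) (sorted_list_of_set C)) =
    filter (\<lambda>ab. ab \<in> (swap_constraints v c)\<^sup>+) (candidate_pairs C)"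
proof -
  let ?R = "swap_constraints v c" and ?es = "cost_edges C c"
  have sv: "distinct v" "set v = C" using v by (auto simp: is_vote_def)
  have "(y, x) \<in> ?R \<longleftrightarrow> (y, x) \<in> order_of_vote v \<and> (y, x, True) \<in> set ?es" for y x
    using C sv by (auto simp: swap_constraints_def set_cost_edges order_of_vote_def)
  from reach_eq_filter[OF sv(1) this] have reach: "reach ?es a v = filter (\<lambda>x. (a, x) \<in> ?R\<^sup>*) v" for a .
  have "b \<in> set (reach ?es a v) \<and> b \<noteq> a \<longleftrightarrow> (a, b) \<in> ?R\<^sup>+" if "b \<in> C" for a b
  proof -
    \<comment> \<open>The closure stays inside the strict order of \<open>v\<close>, so deleting
      \<open>a\<close> from the candidates reachable from \<open>a\<close> loses no pair of
      it.\<close>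
    have "(a, a) \<notin> ?R\<^sup>+" using swap_constraints_trancl[of v c] by (auto simp: order_of_vote_def)
    then show ?thesis using that sv by (auto simp: reach rtrancl_eq_or_trancl)
  qed
  then have "filter (\<lambda>b. b \<in> set (reach ?es a v) \<and> b \<noteq> a) (sorted_list_of_set C) =
      filter (\<lambda>b. (a, b) \<in> ?R\<^sup>+) (sorted_list_of_set C)" for a
    by (intro filter_cong) (use C in auto)
  then show ?thesis
    by (simp add: row_def concat_map_if filter_candidate_pairs)
qed

section \<open>Encodings as tape contents\<close>

lemma word_symbols_simps [simp]:
  "word_symbols [] = []" "word_symbols (x # u) = letter_symbol x # word_symbols u"
  "word_symbols (u @ v) = word_symbols u @ word_symbols v"
  "length (word_symbols u) = length u"
  by (auto simp: word_symbols_def)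

lemma word_symbols_concat [simp]: "word_symbols (concat us) = concat (map word_symbols us)"
  by (induction us) auto

lemma word_symbols_candidate [simp]: "word_symbols (encode_candidate c) = cand c @ [3]"
  by (simp add: encode_candidate_def cand_def)

lemma word_symbols_amount [simp]: "word_symbols (encode_amount x) = [if x = 0 then 1 else 2, 3]"
  by (simp add: encode_amount_def)

lemma word_symbols_candidate_list: "word_symbols (encode_list encode_candidate v) = items (map cand v) @ [4]"
  by (simp add: encode_list_def items_def comp_def)

lemma word_symbols_partial_vote:
  "word_symbols (encode_partial_vote C r) = pair_word (filter (\<lambda>ab. ab \<in> r) (candidate_pairs C)) @ [4]"
proof -
  have "concat (map (\<lambda>ab. word_symbols (case ab of (a, b) \<Rightarrow> encode_candidate a @ encode_candidate b)) ps) = pair_word ps" for ps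
    by (induction ps) auto
  then show ?thesis by (simp add: encode_partial_vote_def encode_list_def comp_def)
qed

lemma word_symbols_costs: "word_symbols (encode_costs C c) = edge_word (cost_edges C c) @ [4]"
proof -
  have "concat (map (\<lambda>ab. word_symbols (case ab of (a, b) \<Rightarrow> encode_candidate a @ encode_candidate b @ encode_amount (c a b))) ps) =
      edge_word (map (\<lambda>(a, b). (a, b, c a b \<noteq> 0)) ps)" for ps
    by (induction ps) auto
  then show ?thesis by (simp add: encode_costs_def encode_list_def cost_edges_def comp_def)
qed

lemma word_symbols_sb:
  "word_symbols (encode_zero_budget_sb I) = header_word (sorted_list_of_set (sb_candidates I)) (sb_preferred I) @
    [if sb_budget I = 0 then 1 else 2, 3] @
    concat (map (\<lambda>i. items (map cand (sb_votes I ! i)) @ [4] @ edge_word (cost_edges (sb_candidates I) (sb_cost I i)) @ [4])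
      [0..<length (sb_votes I)])"
  unfolding encode_zero_budget_sb_def
  by (simp add: word_symbols_candidate_list word_symbols_costs comp_def header_word_def encode_candidates_def)

lemma word_symbols_pw:
  "word_symbols (encode_pw I) = header_word (sorted_list_of_set (pw_candidates I)) (pw_preferred I) @
    concat (map (\<lambda>r. pair_word (filter (\<lambda>ab. ab \<in> r) (candidate_pairs (pw_candidates I))) @ [4]) (pw_votes I))"
  unfolding encode_pw_def
  by (simp add: word_symbols_candidate_list word_symbols_partial_vote comp_def header_word_def encode_candidates_def)

lemma length_concat_map_mem: "x \<in> set xs \<Longrightarrow> length (f x) \<le> length (concat (map f xs))"
  by (induction xs) auto

text \<open>Every voter's block is nonempty, so this bounds the number of voters by the length of
  the input.\<close>

lemma length_le_concat_map: "(\<And>x. x \<in> set xs \<Longrightarrow> f x \<noteq> []) \<Longrightarrow> length xs \<le> length (concat (map f xs))"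
proof (induction xs)
  case (Cons x xs)
  then have "f x \<noteq> []" "length xs \<le> length (concat (map f xs))" by auto
  then show ?case by (cases "f x") auto
qed simp

lemma fits_cand: "length (items (map cand cs)) \<le> N \<Longrightarrow> fits N (map cand cs)"
  by (auto simp: fits_def)

lemma fits_edges: "length (edge_word es) \<le> N \<Longrightarrow> fits N (concat (map edge_items es))"
proof -
  have "is_bits [if b then 2 else 1]" for b by (simp add: is_bits_def is_bit_def)
  then have "is_bits w" if "w \<in> set (edge_items e)" for w e using that by (cases e) auto
  then show "length (edge_word es) \<le> N \<Longrightarrow> fits N (concat (map edge_items es))"
    by (auto simp: fits_def edge_word_def)
qed

section \<open>From Swap Bribery to Possible Winner\<close>

definition closed_instance :: "nat swap_bribery \<Rightarrow> nat possible_winner" where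
  "closed_instance I = \<lparr>pw_candidates = sb_candidates I,
     pw_votes = map (\<lambda>i. (swap_constraints (sb_votes I ! i) (sb_cost I i))\<^sup>+) [0..<length (sb_votes I)],
     pw_preferred = sb_preferred I\<rparr>"

text \<open>The closure lies in the strict order of the original vote and is therefore irreflexive.
  A vote extends it exactly if it respects the constraints, so both instances admit the same
  profiles.\<close>

lemma closed_instance:
  assumes I: "is_zero_budget_instance \<delta> I"
  shows "is_pw_instance (closed_instance I)"
    and "sb_solvable \<E> I \<longleftrightarrow> pw_solvable \<E> (closed_instance I)"
proof -
  have V: "is_vote (sb_candidates I) (sb_votes I ! i)" if "i < length (sb_votes I)" for i
    using I that by (auto simp: is_zero_budget_instance_def is_sb_instance_def is_election_def)
  have "is_partial_vote (sb_candidates I) ((swap_constraints (sb_votes I ! i) (sb_cost I i))\<^sup>+)"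
    if "i < length (sb_votes I)" for i
    using swap_constraints_trancl[of "sb_votes I ! i" "sb_cost I i"] V[OF that]
    by (auto simp: is_partial_vote_def is_vote_def order_of_vote_def irrefl_def)
  then show "is_pw_instance (closed_instance I)"
    using I by (auto simp: is_pw_instance_def closed_instance_def is_zero_budget_instance_def is_sb_instance_def is_election_def)
  show "sb_solvable \<E> I \<longleftrightarrow> pw_solvable \<E> (closed_instance I)"
    unfolding sb_solvable_iff[OF I] pw_solvable_def closed_instance_def
    by (rule ex_cong1) (simp add: trancl_subset_iff[OF trans_order_of_vote] swap_constraints_def cong: conj_cong imp_cong)
qed

lemma runs_closure_instance:
  assumes I: "is_zero_budget_instance \<delta> I"
  defines "w \<equiv> encode_zero_budget_sb I"
  shows "\<exists>s. runs closure_program (closure_program_time (2 * length w)) (initial_state 10 w) s \<and>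
    s ! 1 = (rev (word_symbols (encode_pw (closed_instance I))), [])"
proof -
  let ?C = "sb_candidates I" and ?V = "sb_votes I"
  let ?cs = "sorted_list_of_set ?C"
  define bs where "bs = map (\<lambda>i. (?V ! i, cost_edges ?C (sb_cost I i))) [0..<length ?V]"
  let ?N = "2 * length w"
  have C: "finite ?C" using I by (auto simp: is_zero_budget_instance_def is_sb_instance_def is_election_def)
  have V: "is_vote ?C (?V ! i)" if "i < length ?V" for i
    using I that by (auto simp: is_zero_budget_instance_def is_sb_instance_def is_election_def)
  have w: "word_symbols w = header_word ?cs (sb_preferred I) @ [1, 3] @ concat (map closure_input bs)"
    using I by (simp add: w_def word_symbols_sb is_zero_budget_instance_def bs_def closure_input_def edge_word_def comp_def)
  have len: "length w = length (header_word ?cs (sb_preferred I)) + 2 + length (concat (map closure_input bs))"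
    using arg_cong[OF w, of length] by simp
  have "\<exists>s. runs closure_program (closure_program_time ?N) (initial_state 10 w) s \<and>
    s ! 1 = (rev (header_word ?cs (sb_preferred I) @ concat (map (\<lambda>(v, es). closure_word ?cs v es) bs)), [])"
  proof (rule runs_closure_program)
    show "word_symbols w = header_word ?cs (sb_preferred I) @ [1, 3] @ concat (map closure_input bs)" by (rule w)
    show "fits ?N (map cand ?cs)" by (rule fits_cand) (use len in \<open>simp add: header_word_def\<close>)
    show "fits1 ?N (cand (sb_preferred I))" using len by (simp add: header_word_def fits1_def)
    have "length bs \<le> length (concat (map closure_input bs))"
      by (rule length_le_concat_map) (auto simp: closure_input_def)
    then show "length bs \<le> ?N" using len by simp
    fix v es assume "(v, es) \<in> set bs"
    from length_concat_map_mem[OF this, of closure_input]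
    have "length (items (map cand v)) + length (edge_word es) \<le> ?N"
      using len by (simp add: closure_input_def edge_word_def)
    then show "fits ?N (map cand v) \<and> fits ?N (concat (map edge_items es))"
      by (auto intro: fits_cand fits_edges)
  qed
  moreover have "closure_word ?cs (?V ! i) (cost_edges ?C (sb_cost I i)) =
      pair_word (filter (\<lambda>ab. ab \<in> (swap_constraints (?V ! i) (sb_cost I i))\<^sup>+) (candidate_pairs ?C)) @ [4]"
    if "i < length ?V" for i
    by (simp add: closure_word_def closure_rows[OF C V[OF that]])
  then have "header_word ?cs (sb_preferred I) @ concat (map (\<lambda>(v, es). closure_word ?cs v es) bs) =
      word_symbols (encode_pw (closed_instance I))"
    by (auto simp: word_symbols_pw closed_instance_def bs_def comp_def intro!: arg_cong[where f = concat] map_cong)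
  ultimately show ?thesis by simp
qed

section \<open>Correctness of the topological sort\<close>

lemma hit_edges: "hit p (edges ps) ys x \<longleftrightarrow> (\<exists>y. (y \<in> set ys) = p \<and> (y, x) \<in> set ps)"
  by (force simp: hit_def edges_def)

lemma sort_round_mono: "set ys \<subseteq> set (sort_round es cs ys)"
  by (induction cs rule: rev_induct) (auto simp: sort_round_def)

text \<open>All predecessors of \<open>x\<close> are listed before the round starts and the list
  only grows, so nothing blocks \<open>x\<close> when the round reaches it.\<close>

lemma sort_round_complete:
  "x \<in> set cs \<Longrightarrow> (\<And>y. (y, x) \<in> set ps \<Longrightarrow> y \<in> set ys) \<Longrightarrow> x \<in> set (sort_round (edges ps) cs ys)"
proof (induction cs rule: rev_induct)
  case (snoc z cs)
  have "sort_round (edges ps) (cs @ [z]) ys = (let zs = sort_round (edges ps) cs ys in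
      if z \<notin> set zs \<and> \<not> hit False (edges ps) zs z then zs @ [z] else zs)"
    by (simp add: sort_round_def Let_def)
  moreover have "\<not> hit False (edges ps) (sort_round (edges ps) cs ys) x"
    using snoc.prems(2) sort_round_mono[of ys "edges ps" cs] by (auto simp: hit_edges)
  ultimately show ?case using snoc by (auto simp: Let_def)
qed simp

text \<open>A candidate is appended only when no predecessor is missing from the list, and listed
  candidates never move afterwards.\<close>

lemma sort_rounds_sorted:
  "sort_rounds (edges ps) cs ds = A @ x # B \<Longrightarrow> (y, x) \<in> set ps \<Longrightarrow> y \<in> set A"
proof -
  define sorted where "sorted zs \<longleftrightarrow> (\<forall>A x B y. zs = A @ x # B \<longrightarrow> (y, x) \<in> set ps \<longrightarrow> y \<in> set A)" for zs
  have snoc: "sorted (zs @ [z])" if "sorted zs" "\<And>y. (y, z) \<in> set ps \<Longrightarrow> y \<in> set zs" for zs z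
    unfolding sorted_def
  proof (intro allI impI)
    fix A x B y assume *: "zs @ [z] = A @ x # B" "(y, x) \<in> set ps"
    show "y \<in> set A"
    proof (cases B rule: rev_cases)
      case Nil
      then show ?thesis using * that(2) by auto
    next
      case (snoc B' b)
      then have "zs = A @ x # B'" using *(1) by auto
      then show ?thesis using that(1) *(2) unfolding sorted_def by blast
    qed
  qed
  have round: "sorted (sort_round (edges ps) cs ys)" if "sorted ys" for ys
    by (induction cs rule: rev_induct) (auto simp: sort_round_def hit_edges that intro!: snoc)
  have "sorted []" by (simp add: sorted_def)
  then have "sorted (sort_rounds (edges ps) cs ds)"
    by (induction ds rule: rev_induct) (simp_all add: sort_rounds_def round)
  then show "sort_rounds (edges ps) cs ds = A @ x # B \<Longrightarrow> (y, x) \<in> set ps \<Longrightarrow> y \<in> set A"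
    unfolding sorted_def by blast
qed

text \<open>By transitivity a predecessor of \<open>x\<close> has fewer predecessors than \<open>x\<close>, so it has been placed in an
  earlier round.\<close>

lemma sort_rounds_complete:
  assumes "trans (set ps)" "irrefl (set ps)" "set ps \<subseteq> set cs \<times> set cs"
  shows "x \<in> set cs \<Longrightarrow> card {y. (y, x) \<in> set ps} < length ds \<Longrightarrow> x \<in> set (sort_rounds (edges ps) cs ds)"
proof (induction ds arbitrary: x rule: rev_induct)
  case (snoc d ds)
  have "sort_rounds (edges ps) cs (ds @ [d]) = sort_round (edges ps) cs (sort_rounds (edges ps) cs ds)"
    by (simp add: sort_rounds_def)
  moreover have "y \<in> set (sort_rounds (edges ps) cs ds)" if yx: "(y, x) \<in> set ps" for y
  proof (rule snoc.IH)
    show "y \<in> set cs" using assms(3) yx by auto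
    have "{z. (z, x) \<in> set ps} \<subseteq> set cs" using assms(3) by auto
    then have "finite {z. (z, x) \<in> set ps}" by (rule finite_subset) simp
    moreover have "{z. (z, y) \<in> set ps} \<subset> {z. (z, x) \<in> set ps}"
    proof
      show "{z. (z, y) \<in> set ps} \<subseteq> {z. (z, x) \<in> set ps}" using transD[OF assms(1) _ yx] by auto
      \<comment> \<open>\<open>y\<close> is a predecessor of \<open>x\<close> but, by irreflexivity,
        not of itself.\<close>
      show "{z. (z, y) \<in> set ps} \<noteq> {z. (z, x) \<in> set ps}" using assms(2) yx by (auto simp: irrefl_def)
    qed
    ultimately have "card {z. (z, y) \<in> set ps} < card {z. (z, x) \<in> set ps}" by (rule psubset_card_mono)
    then show "card {z. (z, y) \<in> set ps} < length ds" using snoc.prems(2) by simp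
  qed
  ultimately show ?case using sort_round_complete[OF snoc.prems(1)] by metis
qed simp

definition relation_pairs :: "nat set \<Rightarrow> nat rel \<Rightarrow> (nat \<times> nat) list" where
  "relation_pairs C r = filter (\<lambda>ab. ab \<in> r) (candidate_pairs C)"

definition linear_extension :: "nat set \<Rightarrow> nat rel \<Rightarrow> nat vote" where
  "linear_extension C r = sort_rounds (edges (relation_pairs C r)) (sorted_list_of_set C) (sorted_list_of_set C)"

lemma linear_extension:
  assumes C: "finite C" and r: "is_partial_vote C r"
  shows "is_vote C (linear_extension C r)" and "r \<subseteq> order_of_vote (linear_extension C r)"
proof -
  let ?ps = "relation_pairs C r" and ?cs = "sorted_list_of_set C" and ?v = "linear_extension C r"
  have ps: "set ?ps = r"
    using r C by (auto simp: relation_pairs_def set_candidate_pairs is_partial_vote_def)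
  have "x \<in> set ?v" if x: "x \<in> C" for x
    unfolding linear_extension_def
  proof (rule sort_rounds_complete)
    \<comment> \<open>The predecessors of \<open>x\<close> exclude \<open>x\<close>, so they are
      fewer than the candidates, and as many rounds as candidates suffice.\<close>
    have "{y. (y, x) \<in> r} \<subseteq> C - {x}" using r by (auto simp: is_partial_vote_def irrefl_def)
    then have "card {y. (y, x) \<in> r} \<le> card (C - {x})" using C by (intro card_mono) auto
    also have "\<dots> < card C" using C x by (intro psubset_card_mono) auto
    finally show "card {y. (y, x) \<in> set ?ps} < length ?cs" by (simp add: ps)
  qed (use C x r in \<open>auto simp: ps is_partial_vote_def\<close>)
  then show vote: "is_vote C ?v"
    using sort_rounds_subset[of "edges ?ps" ?cs ?cs] C by (auto simp: is_vote_def linear_extension_def)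
  show "r \<subseteq> order_of_vote ?v"
  proof clarify
    fix y x assume yx: "(y, x) \<in> r"
    then have "x \<in> set ?v" using r vote by (auto simp: is_partial_vote_def is_vote_def)
    then obtain A B where AB: "?v = A @ x # B" by (auto simp: in_set_conv_decomp)
    then have "y \<in> set A"
      using sort_rounds_sorted[of ?ps ?cs ?cs A x B y] yx ps by (simp add: linear_extension_def)
    then show "(y, x) \<in> order_of_vote ?v"
      using order_of_vote_append[of A x B y] vote AB by (simp add: is_vote_def)
  qed
qed

section \<open>From Possible Winner to Swap Bribery\<close>

definition extended_instance :: "real \<Rightarrow> nat possible_winner \<Rightarrow> nat swap_bribery" where
  "extended_instance \<delta> I = \<lparr>sb_candidates = pw_candidates I,
     sb_votes = map (linear_extension (pw_candidates I)) (pw_votes I),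
     sb_preferred = pw_preferred I,
     sb_cost = (\<lambda>i a b. if (a, b) \<in> pw_votes I ! i then \<delta> else 0),
     sb_budget = 0\<rparr>"

text \<open>The constructed vote extends \<open>r\<close>, so it ranks every pair of
  \<open>r\<close> in the costly direction; since \<delta> is not 0, the constraints read off from
  the costs are exactly \<open>r\<close>.\<close>

lemma extended_instance:
  assumes I: "is_pw_instance I" and \<delta>: "\<delta> > 0"
  shows "is_zero_budget_instance \<delta> (extended_instance \<delta> I)"
    and "pw_solvable \<E> I \<longleftrightarrow> sb_solvable \<E> (extended_instance \<delta> I)"
proof -
  have C: "finite (pw_candidates I)" using I by (simp add: is_pw_instance_def)
  have r: "is_partial_vote (pw_candidates I) r" if "r \<in> set (pw_votes I)" for r
    using I that by (simp add: is_pw_instance_def)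
  show zero: "is_zero_budget_instance \<delta> (extended_instance \<delta> I)"
    using I \<delta> linear_extension(1)[OF C r] C
    by (auto simp: is_zero_budget_instance_def is_sb_instance_def is_election_def extended_instance_def is_pw_instance_def)
  let ?J = "extended_instance \<delta> I"
  have J: "sb_candidates ?J = pw_candidates I" "sb_preferred ?J = pw_preferred I"
    "length (sb_votes ?J) = length (pw_votes I)"
    by (simp_all add: extended_instance_def)
  have "{(a, b) \<in> order_of_vote (sb_votes ?J ! i). sb_cost ?J i a b \<noteq> 0} = pw_votes I ! i"
    if "i < length (pw_votes I)" for i
    using linear_extension(2)[OF C r, of "pw_votes I ! i"] that \<delta> by (auto simp: extended_instance_def)
  then show "pw_solvable \<E> I \<longleftrightarrow> sb_solvable \<E> ?J"
    unfolding sb_solvable_iff[OF zero] pw_solvable_def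
    by (intro ex_cong1) (simp add: J cong: conj_cong imp_cong)
qed

lemma cost_rows_eq:
  assumes C: "finite C" and r: "is_partial_vote C r" and \<delta>: "\<delta> > 0"
  shows "cost_rows (edges (relation_pairs C r)) (sorted_list_of_set C) (sorted_list_of_set C) =
    cost_edges C (\<lambda>a b. if (a, b) \<in> r then \<delta> else 0)"
proof -
  have "set (relation_pairs C r) = r"
    using r C by (auto simp: relation_pairs_def set_candidate_pairs is_partial_vote_def)
  then have "hit True (edges (relation_pairs C r)) [a] b \<longleftrightarrow> (a, b) \<in> r" for a b
    by (simp add: hit_edges)
  moreover have "(if (a, b) \<in> r then \<delta> else 0) \<noteq> 0 \<longleftrightarrow> (a, b) \<in> r" for a b using \<delta> by simp
  ultimately show ?thesis
    by (simp add: cost_rows_def cost_row_def concat_map_if_not cost_edges_def filter_candidate_pairs map_concat comp_def)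
qed

text \<open>A pair occupies at least its two commas, and the triple adds only a bit and one more
  comma.\<close>

lemma length_edges_relation: "length (edge_word (edges ps)) \<le> 2 * length (pair_word ps)"
  by (induction ps) (auto simp: edges_def)

lemma runs_order_instance:
  assumes I: "is_pw_instance I" and \<delta>: "\<delta> > 0"
  defines "w \<equiv> encode_pw I"
  shows "\<exists>s. runs order_program (order_program_time (2 * length w)) (initial_state 10 w) s \<and>
    s ! 1 = (rev (word_symbols (encode_zero_budget_sb (extended_instance \<delta> I))), [])"
proof -
  let ?C = "pw_candidates I"
  let ?cs = "sorted_list_of_set ?C"
  define bs where "bs = map (relation_pairs ?C) (pw_votes I)"
  let ?N = "2 * length w"
  let ?in = "concat (map (\<lambda>ps. pair_word ps @ [4]) bs)"
  have C: "finite ?C" using I by (simp add: is_pw_instance_def)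
  have r: "is_partial_vote ?C (pw_votes I ! i)" if "i < length (pw_votes I)" for i
    using I that by (simp add: is_pw_instance_def)
  have w: "word_symbols w = header_word ?cs (pw_preferred I) @ ?in"
    by (simp add: w_def word_symbols_pw bs_def relation_pairs_def comp_def)
  have len: "length w = length (header_word ?cs (pw_preferred I)) + length ?in"
    using arg_cong[OF w, of length] by simp
  have ex: "\<exists>s. runs order_program (order_program_time ?N) (initial_state 10 w) s \<and>
    s ! 1 = (rev (header_word ?cs (pw_preferred I) @ [1, 3] @ concat (map (order_word ?cs) bs)), [])"
  proof (rule runs_order_program)
    show "word_symbols w = header_word ?cs (pw_preferred I) @ ?in" by (rule w)
    show "fits ?N (map cand ?cs)" by (rule fits_cand) (use len in \<open>simp add: header_word_def\<close>)
    show "fits1 ?N (cand (pw_preferred I))" using len by (simp add: header_word_def fits1_def)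
    have "length bs \<le> length ?in" by (rule length_le_concat_map) auto
    then show "length bs \<le> ?N" using len by simp
    fix ps assume "ps \<in> set bs"
    from length_concat_map_mem[OF this, of "\<lambda>ps. pair_word ps @ [4]"]
    have "length (edge_word (edges ps)) \<le> ?N"
      using len length_edges_relation[of ps] by simp
    then show "fits ?N (concat (map edge_items (edges ps)))" by (rule fits_edges)
  qed simp
  have "order_word ?cs (relation_pairs ?C (pw_votes I ! i)) =
      items (map cand (linear_extension ?C (pw_votes I ! i))) @ [4] @
      edge_word (cost_edges ?C (\<lambda>a b. if (a, b) \<in> pw_votes I ! i then \<delta> else 0)) @ [4]"
    if "i < length (pw_votes I)" for i
    by (simp add: order_word_def linear_extension_def cost_rows_eq[OF C r[OF that] \<delta>])
  \<comment> \<open>In the encoding of the output, votes and costs are indexed by voters, so the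
    blocks are put into the same form.\<close>
  moreover have "bs = map (\<lambda>i. relation_pairs ?C (pw_votes I ! i)) [0..<length (pw_votes I)]"
    unfolding bs_def by (rule nth_equalityI) auto
  ultimately have eq: "header_word ?cs (pw_preferred I) @ [1, 3] @ concat (map (order_word ?cs) bs) =
      word_symbols (encode_zero_budget_sb (extended_instance \<delta> I))"
    by (auto simp: word_symbols_sb extended_instance_def comp_def intro!: arg_cong[where f = concat] map_cong)
  show ?thesis using ex unfolding eq .
qed

section \<open>Polynomial-time reductions\<close>

text \<open>As a predicate on functions it is closed under sums and products, so the time bounds are
  handled by their shape and no polynomial has to be written down.\<close>

definition polynomial :: "(nat \<Rightarrow> nat) \<Rightarrow> bool" where
  "polynomial f \<longleftrightarrow> (\<exists>P. f = poly P)"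

lemma polynomial_const: "polynomial (\<lambda>_. c)"
  unfolding polynomial_def by (intro exI[of _ "[:c:]"]) auto

lemma polynomial_id: "polynomial (\<lambda>n. n)"
  unfolding polynomial_def by (intro exI[of _ "[:0, 1:]"]) auto

lemma polynomial_add: "polynomial f \<Longrightarrow> polynomial g \<Longrightarrow> polynomial (\<lambda>n. f n + g n)"
  unfolding polynomial_def by (auto simp flip: poly_add)

lemma polynomial_mult: "polynomial f \<Longrightarrow> polynomial g \<Longrightarrow> polynomial (\<lambda>n. f n * g n)"
  unfolding polynomial_def by (auto simp flip: poly_mult)

lemmas polynomial_intros = polynomial_const polynomial_id polynomial_add polynomial_mult

lemmas subroutine_time_defs = header_time_def foreach_time_def member_time_def scan_time_def

lemma polynomial_closure_program_time: "polynomial (\<lambda>n. closure_program_time (2 * n))"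
  unfolding closure_program_time_def closure_time_def reach_time_def row_time_def subroutine_time_defs
  by (intro polynomial_intros)

lemma polynomial_order_program_time: "polynomial (\<lambda>n. order_program_time (2 * n))"
  unfolding order_program_time_def order_time_def sort_time_def cost_time_def subroutine_time_defs
  by (intro polynomial_intros)

lemmas subroutine_defs = header_def take_items_def take_item_def copy_bits_def foreach_def rewind_def
  scan_left_def copy_item_def next_item_def clear_def compare_def set_flag_def member_def scan_def skip_def

lemma well_formed_closure_program: "well_formed 10 closure_program"
  by (simp add: closure_program_def closure_block_def reach_step_def row_step_def subroutine_defs)

lemma well_formed_order_program: "well_formed 10 order_program"
  by (simp add: order_program_def order_block_def take_pair_def sort_step_def cost_step_def cost_entry_def subroutine_defs)

text \<open>Letters are not blank, so the tape content determines the length of the word and then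
  its letters. Hence a machine has at most one output.\<close>

lemma word_on_tape_inj: "word_on_tape u = word_on_tape v \<longleftrightarrow> u = v"
proof
  assume eq: "word_on_tape u = word_on_tape v"
  have "letter_symbol x \<noteq> 0" for x by (cases x) auto
  then have supp: "i < length w \<longleftrightarrow> word_on_tape w i \<noteq> 0" for i w by (auto simp: word_on_tape_def)
  have "length u = length v" using eq supp by (metis nat_neq_iff)
  then show "u = v"
  proof (rule nth_equalityI)
    fix i assume "i < length u"
    then show "u ! i = v ! i"
      using fun_cong[OF eq, of i] \<open>length u = length v\<close> inj_letter_symbol by (auto simp: word_on_tape_def inj_def)
  qed
qed simp

text \<open>A reduction is a function of words, but distinct instances can share an encoding, for
  example when their costs differ only outside the proper swaps. Therefore \<open>f\<close> is read
  off from the machine: its output is unique and depends only on the word, so it agrees with the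
  encoding of the target instance for every such instance.\<close>

lemma polytime_many_one_reducibleI:
  assumes c: "well_formed 10 c" and T: "polynomial T"
    and red: "\<And>x. x \<in> instances A \<Longrightarrow> \<exists>y\<in>instances B. (x \<in> yes_instances A \<longleftrightarrow> y \<in> yes_instances B) \<and>
      (\<exists>s. runs c (T (length (encoding A x))) (initial_state 10 (encoding A x)) s \<and>
        s ! 1 = (rev (word_symbols (encoding B y)), []))"
  shows "polytime_many_one_reducible A B"
proof -
  obtain M where M: "is_tm M" and comp: "\<And>w B s u. runs c B (initial_state 10 w) s \<Longrightarrow>
      s ! 1 = (rev (word_symbols u), []) \<Longrightarrow> tm_computes_within M w B u"
    using runs_tm[OF c] by auto
  obtain P where P: "T = poly P" using T by (auto simp: polynomial_def)
  define f where "f w = (SOME u. tm_computes_within M w (poly P (length w)) u)" for w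
  have f: "f w = u" "tm_computes_within M w (poly P (length w)) (f w)"
    if "tm_computes_within M w (poly P (length w)) u" for w u
  proof -
    show *: "tm_computes_within M w (poly P (length w)) (f w)"
      unfolding f_def using that by (rule someI)
    show "f w = u"
      using * that by (auto simp: tm_computes_within_def word_on_tape_inj split: prod.splits)
  qed
  have out: "\<exists>y\<in>instances B. (x \<in> yes_instances A \<longleftrightarrow> y \<in> yes_instances B) \<and>
      tm_computes_within M (encoding A x) (poly P (length (encoding A x))) (encoding B y)"
    if "x \<in> instances A" for x
    using red[OF that] comp unfolding P by blast
  have "polytime_on (encoding A ` instances A) f"
    unfolding polytime_on_def using M f(2) out by blast
  moreover have "\<exists>y\<in>instances B. f (encoding A x) = encoding B y \<and> (x \<in> yes_instances A \<longleftrightarrow> y \<in> yes_instances B)"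
    if "x \<in> instances A" for x
    using out[OF that] f(1) by metis
  ultimately show ?thesis unfolding polytime_many_one_reducible_def by blast
qed

theorem proposition2:
  fixes \<E> :: "nat election_system" and \<delta> :: real
  assumes "is_election_system \<E>" and "\<delta> > 0"
  shows "polytime_many_one_reducible
           (zero_budget_swap_bribery_problem \<E> \<delta>) (possible_winner_problem \<E>) \<and>
         polytime_many_one_reducible
           (possible_winner_problem \<E>) (zero_budget_swap_bribery_problem \<E> \<delta>)"
proof
  show "polytime_many_one_reducible (zero_budget_swap_bribery_problem \<E> \<delta>) (possible_winner_problem \<E>)"
  proof (rule polytime_many_one_reducibleI[OF well_formed_closure_program polynomial_closure_program_time])
    fix I assume "I \<in> instances (zero_budget_swap_bribery_problem \<E> \<delta>)"
    then have I: "is_zero_budget_instance \<delta> I" by (simp add: zero_budget_swap_bribery_problem_def)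
    show "\<exists>y\<in>instances (possible_winner_problem \<E>).
        (I \<in> yes_instances (zero_budget_swap_bribery_problem \<E> \<delta>) \<longleftrightarrow> y \<in> yes_instances (possible_winner_problem \<E>)) \<and>
        (\<exists>s. runs closure_program (closure_program_time (2 * length (encoding (zero_budget_swap_bribery_problem \<E> \<delta>) I)))
          (initial_state 10 (encoding (zero_budget_swap_bribery_problem \<E> \<delta>) I)) s \<and>
          s ! 1 = (rev (word_symbols (encoding (possible_winner_problem \<E>) y)), []))"
      using closed_instance[OF I] runs_closure_instance[OF I] I
      by (intro bexI[of _ "closed_instance I"]) (auto simp: zero_budget_swap_bribery_problem_def possible_winner_problem_def)
  qed
next
  show "polytime_many_one_reducible (possible_winner_problem \<E>) (zero_budget_swap_bribery_problem \<E> \<delta>)"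
  proof (rule polytime_many_one_reducibleI[OF well_formed_order_program polynomial_order_program_time])
    fix I assume "I \<in> instances (possible_winner_problem \<E>)"
    then have I: "is_pw_instance I" by (simp add: possible_winner_problem_def)
    show "\<exists>y\<in>instances (zero_budget_swap_bribery_problem \<E> \<delta>).
        (I \<in> yes_instances (possible_winner_problem \<E>) \<longleftrightarrow> y \<in> yes_instances (zero_budget_swap_bribery_problem \<E> \<delta>)) \<and>
        (\<exists>s. runs order_program (order_program_time (2 * length (encoding (possible_winner_problem \<E>) I)))
          (initial_state 10 (encoding (possible_winner_problem \<E>) I)) s \<and>
          s ! 1 = (rev (word_symbols (encoding (zero_budget_swap_bribery_problem \<E> \<delta>) y)), []))"
      using extended_instance[OF I assms(2)] runs_order_instance[OF I assms(2)] I
      by (intro bexI[of _ "extended_instance \<delta> I"]) (auto simp: zero_budget_swap_bribery_problem_def possible_winner_problem_def)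
  qed
qed

end
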